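(* There exist a compact smooth manifold $M$ with boundary, a real number $k$, and two $\mathcal{MP}$-systems $(g,\alpha,U)$ and $(g',\alpha',U')$ on $M$, with $k>\sup_M U$ and $k>\sup_M U'$, both simple at energy $k$, such that the two systems have the same boundary action function of energy $k$, and their restrictions to the boundary coincide (i.e. $g|_{\partial M}=g'|_{\partial M}$, $\alpha|_{\partial M}=\alpha'|_{\partial M}$, $U|_{\partial M}=U'|_{\partial M}$), but $(g,\alpha,U)$ and $(g',\alpha',U')$ are not gauge equivalent.
   Context: All manifolds have dimension $n\ge 2$. An $\mathcal{MP}$-system on $M$ is a triple $(g,\alpha,U)$ where $g$ is a Riemannian metric, $\alpha$ a smooth 1-form (magnetic potential) and $U$ a smooth real function on $M$. Put $\Omega=d\alpha$; the Lorentz force $Y:TM\to TM$ is the bundle map with $\Omega_x(\xi,\eta)=\langle Y_x(\xi),\eta\rangle_g$ for all $x\in M$, $\xi,\eta\in T_xM$. An $\mathcal{MP}$-geodesic is a curve $\gamma$ in $M$ with $\nabla_{\dot\gamma}\dot\gamma=Y(\dot\gamma)-\nabla U(\gamma)$, where $\nabla$ is the Levi-Civita connection (and gradient) of $g$. The energy $E(x,\xi)=\frac12|\xi|_g^2+U(x)$ is constant along $\mathcal{MP}$-geodesics. For a constant $k>\sup_M U$ put $S^kM=E^{-1}(k)\subset TM$, and $S^k(\partial M)=\{(x,\xi)\in S^kM: x\in\partial M,\ \xi\in T_x\partial M\}$. The restrictions $g|_{\partial M}$, $\alpha|_{\partial M}$ are the restrictions of the tensors to points of $\partial M$ (acting on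 all of $T_xM$, $x\in\partial M$). Simplicity at energy $k$. Let $\nu$ be the inward unit normal to $\partial M$ and $\Lambda(x,\xi)=-\langle\nabla_\xi\nu,\xi\rangle$ the second fundamental form of $\partial M$. $\partial M$ is strictly $\mathcal{MP}$-convex if $\Lambda(x,\xi)>\langle Y_x(\xi),\nu(x)\rangle-d_xU(\nu(x))$ for all $(x,\xi)\in S^k(\partial M)$. For $x\in M$ the $\mathcal{MP}$-exponential map is the partial map $\exp_x^{\mathcal{MP}}:T_xM\to M$, $\exp_x^{\mathcal{MP}}(t\xi)=\gamma_{x,\xi}(t)$ for $t\ge0$, $\xi\in S^k_xM$, where $\gamma_{x,\xi}$ is the $\mathcal{MP}$-geodesic with $\gamma_{x,\xi}(0)=x$, $\dot\gamma_{x,\xi}(0)=\xi$ (it is $C^1$, and $C^\infty$ away from $0$). The system is simple (at energy $k$) if $\partial M$ is strictly $\mathcal{MP}$-convex and $\exp_x^{\mathcal{MP}}:(\exp_x^{\mathcal{MP}})^{-1}(M)\to M$ is a diffeomorphism for every $x\in M$. Boundary action function of energy $k$. For $x,y\in M$ let $\mathcal C(x,y)$ be the set of absolutely continuous curves $\gamma:[0,T]\to M$, $T>0$, with $\gamma(0)=x$, $\gamma(T)=y$. For such $\gamma$ put $\mathbb A(\gamma)=\frac12\int_0^T|\dot\gamma(t)|_g^2\,dt+kT-\int_0^T\big(\alpha(\dot\gamma(t))+U(\gamma(t))\big)dt$, and $\mathbb A(x,y)=\inf_{\gamma\in\mathcal C(x,y)}\mathbb A(\gamma)$. The boundary action function is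 $\mathbb A|_{\partial M\times\partial M}$. Two $\mathcal{MP}$-systems $(g,\alpha,U)$, $(g',\alpha',U')$ are gauge equivalent if there are a diffeomorphism $f:M\to M$ with $f|_{\partial M}=\mathrm{Id}$ and a smooth $\varphi:M\to\mathbb R$ with $\varphi|_{\partial M}=0$ such that $g'=f^*g$, $\alpha'=f^*\alpha+d\varphi$, $U'=U\circ f$. *)

theory Defs
  imports "HOL-Analysis.Analysis"
begin

section \<open>Differentiability classes on subsets of Euclidean n-space\<close>

text \<open>
  The dimension of a manifold is quantified inside formulas, so n-space is the library's
  \<^term>\<open>Euclidean_space n\<close>, whose points are the sequences vanishing from index n on.

  \<open>pderiv S i f x\<close> is the i-th partial derivative at \<open>x\<close> of a function given on \<open>S\<close>; it is
  one-sided when \<open>x\<close> lies on the face \<open>x 0 = 0\<close> of a relatively open subset of the half-space.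
\<close>

definition pderiv :: "(nat \<Rightarrow> real) set \<Rightarrow> nat \<Rightarrow> ((nat \<Rightarrow> real) \<Rightarrow> real) \<Rightarrow> (nat \<Rightarrow> real) \<Rightarrow> real"
  where "pderiv S i f x =
    vector_derivative (\<lambda>t. f (x(i := t))) (at (x i) within {t. x(i := t) \<in> S})"

text \<open>
  \<open>Ck_open n r W f\<close>: \<open>W\<close> is open in n-space and all iterated partial derivatives of \<open>f\<close> of order
  at most \<open>r\<close> (every order if \<open>r = \<infinity>\<close>) exist and are continuous on \<open>W\<close>; \<open>D [i1, ..., im]\<close> is the
  partial derivative \<open>\<partial>_i1 ... \<partial>_im f\<close>.
\<close>

definition Ck_open :: "nat \<Rightarrow> enat \<Rightarrow> (nat \<Rightarrow> real) set \<Rightarrow> ((nat \<Rightarrow> real) \<Rightarrow> real) \<Rightarrow> bool"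
  where "Ck_open n r W f \<longleftrightarrow>
    openin (Euclidean_space n) W \<and>
    (\<exists>D :: nat list \<Rightarrow> (nat \<Rightarrow> real) \<Rightarrow> real.
      (\<forall>x\<in>W. D [] x = f x) \<and>
      (\<forall>is. set is \<subseteq> {..<n} \<and> enat (length is) \<le> r \<longrightarrow>
         continuous_map (subtopology (Euclidean_space n) W) euclideanreal (D is)) \<and>
      (\<forall>is i. set is \<subseteq> {..<n} \<and> i < n \<and> enat (length is) < r \<longrightarrow>
         (\<forall>x\<in>W. ((\<lambda>t. D is (x(i := t))) has_real_derivative D (i # is) x) (at (x i)))))"

text \<open>On an arbitrary subset of n-space, differentiability means having local extensions.\<close>

definition Ck_on :: "nat \<Rightarrow> enat \<Rightarrow> (nat \<Rightarrow> real) set \<Rightarrow> ((nat \<Rightarrow> real) \<Rightarrow> real) \<Rightarrow> bool"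
  where "Ck_on n r A f \<longleftrightarrow>
    (\<forall>x\<in>A. \<exists>W F. x \<in> W \<and> Ck_open n r W F \<and> (\<forall>y\<in>A \<inter> W. F y = f y))"


section \<open>Smooth manifolds with boundary\<close>

type_synonym 'a chart = "'a set \<times> ('a \<Rightarrow> nat \<Rightarrow> real)"

record 'a bmanifold =
  mdim :: nat
  mtop :: "'a topology"
  atlas :: "'a chart set"

abbreviation points :: "'a bmanifold \<Rightarrow> 'a set"
  where "points M \<equiv> topspace (mtop M)"

definition half_space :: "nat \<Rightarrow> (nat \<Rightarrow> real) set"
  where "half_space n = {x \<in> topspace (Euclidean_space n). 0 \<le> x 0}"

definition cdom :: "'a chart \<Rightarrow> 'a set"
  where "cdom c = fst c"

definition cmap :: "'a chart \<Rightarrow> 'a \<Rightarrow> nat \<Rightarrow> real"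
  where "cmap c = snd c"

definition cimg :: "'a chart \<Rightarrow> (nat \<Rightarrow> real) set"
  where "cimg c = cmap c ` cdom c"

definition cinv :: "'a chart \<Rightarrow> (nat \<Rightarrow> real) \<Rightarrow> 'a"
  where "cinv c = inv_into (cdom c) (cmap c)"

definition smooth_manifold_with_boundary :: "'a bmanifold \<Rightarrow> bool"
  where "smooth_manifold_with_boundary M \<longleftrightarrow>
    1 \<le> mdim M \<and>
    Hausdorff_space (mtop M) \<and> second_countable (mtop M) \<and>
    (\<Union>c\<in>atlas M. cdom c) = points M \<and>
    (\<forall>c\<in>atlas M.
       openin (mtop M) (cdom c) \<and>
       openin (subtopology (Euclidean_space (mdim M)) (half_space (mdim M))) (cimg c) \<and>
       homeomorphic_map (subtopology (mtop M) (cdom c))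
         (subtopology (Euclidean_space (mdim M)) (cimg c)) (cmap c)) \<and>
    (\<forall>c\<in>atlas M. \<forall>d\<in>atlas M. \<forall>i<mdim M.
       Ck_on (mdim M) \<infinity> (cmap c ` (cdom c \<inter> cdom d)) (\<lambda>x. cmap d (cinv c x) i))"

definition charts_at :: "'a bmanifold \<Rightarrow> 'a \<Rightarrow> 'a chart set"
  where "charts_at M p = {c \<in> atlas M. p \<in> cdom c}"

text \<open>
  Objects below that are given by a coordinate formula use \<open>chart_at M p\<close>; each of these formulas
  is invariant under changes of coordinates, so the choice is immaterial.
\<close>

definition chart_at :: "'a bmanifold \<Rightarrow> 'a \<Rightarrow> 'a chart"
  where "chart_at M p = (SOME c. c \<in> charts_at M p)"

definition mboundary :: "'a bmanifold \<Rightarrow> 'a set"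
  where "mboundary M = {p \<in> points M. \<exists>c\<in>charts_at M p. cmap c p 0 = 0}"

definition smooth_fun :: "'a bmanifold \<Rightarrow> ('a \<Rightarrow> real) \<Rightarrow> bool"
  where "smooth_fun M h \<longleftrightarrow> (\<forall>c\<in>atlas M. Ck_on (mdim M) \<infinity> (cimg c) (\<lambda>x. h (cinv c x)))"

definition smooth_self_map :: "'a bmanifold \<Rightarrow> ('a \<Rightarrow> 'a) \<Rightarrow> bool"
  where "smooth_self_map M f \<longleftrightarrow>
    continuous_map (mtop M) (mtop M) f \<and>
    (\<forall>c\<in>atlas M. \<forall>d\<in>atlas M. \<forall>i<mdim M.
       Ck_on (mdim M) \<infinity> {x \<in> cimg c. f (cinv c x) \<in> cdom d} (\<lambda>x. cmap d (f (cinv c x)) i))"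

definition diffeo :: "'a bmanifold \<Rightarrow> ('a \<Rightarrow> 'a) \<Rightarrow> bool"
  where "diffeo M f \<longleftrightarrow>
    bij_betw f (points M) (points M) \<and> smooth_self_map M f \<and>
    smooth_self_map M (inv_into (points M) f)"


section \<open>Tangent vectors and tensors\<close>

text \<open>
  A tangent vector at \<open>p\<close> is the family of its component vectors in all charts of the atlas around
  \<open>p\<close>, related by the Jacobians of the coordinate changes (and zero at the other charts).
\<close>

type_synonym 'a tvec = "'a chart \<Rightarrow> nat \<Rightarrow> real"

definition jacobian ::
    "'a bmanifold \<Rightarrow> 'a chart \<Rightarrow> 'a chart \<Rightarrow> 'a \<Rightarrow> (nat \<Rightarrow> real) \<Rightarrow> nat \<Rightarrow> real"
  where "jacobian M c d p w = (\<lambda>i. if i < mdim M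
    then (\<Sum>j<mdim M.
      pderiv (cmap c ` (cdom c \<inter> cdom d)) j (\<lambda>x. cmap d (cinv c x) i) (cmap c p) * w j)
    else 0)"

definition tangent_space :: "'a bmanifold \<Rightarrow> 'a \<Rightarrow> 'a tvec set"
  where "tangent_space M p =
    {v. (\<forall>c. c \<notin> charts_at M p \<longrightarrow> v c = (\<lambda>_. 0)) \<and>
        (\<forall>c\<in>charts_at M p. \<forall>d\<in>charts_at M p. v d = jacobian M c d p (v c))}"

text \<open>The tangent vector at \<open>p\<close> with components \<open>w\<close> in the chart \<open>c\<close>.\<close>

definition tvec_of :: "'a bmanifold \<Rightarrow> 'a chart \<Rightarrow> 'a \<Rightarrow> (nat \<Rightarrow> real) \<Rightarrow> 'a tvec"
  where "tvec_of M c p w = (\<lambda>d. if d \<in> charts_at M p then jacobian M c d p w else (\<lambda>_. 0))"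

definition coord_vec :: "'a bmanifold \<Rightarrow> 'a chart \<Rightarrow> 'a \<Rightarrow> nat \<Rightarrow> 'a tvec"
  where "coord_vec M c p j = tvec_of M c p (\<lambda>i. if i = j then 1 else 0)"

definition boundary_tangent_space :: "'a bmanifold \<Rightarrow> 'a \<Rightarrow> 'a tvec set"
  where "boundary_tangent_space M p =
    {v \<in> tangent_space M p. \<forall>c\<in>charts_at M p. v c 0 = 0}"

definition tlinear :: "'a bmanifold \<Rightarrow> 'a \<Rightarrow> ('a tvec \<Rightarrow> real) \<Rightarrow> bool"
  where "tlinear M p \<omega> \<longleftrightarrow>
    (\<forall>v\<in>tangent_space M p. \<forall>w\<in>tangent_space M p. \<forall>a b.
       \<omega> (\<lambda>c i. a * v c i + b * w c i) = a * \<omega> v + b * \<omega> w)"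

type_synonym 'a one_form = "'a \<Rightarrow> 'a tvec \<Rightarrow> real"
type_synonym 'a two_tensor = "'a \<Rightarrow> 'a tvec \<Rightarrow> 'a tvec \<Rightarrow> real"

definition smooth_one_form :: "'a bmanifold \<Rightarrow> 'a one_form \<Rightarrow> bool"
  where "smooth_one_form M \<alpha> \<longleftrightarrow>
    (\<forall>p\<in>points M. tlinear M p (\<alpha> p)) \<and>
    (\<forall>c\<in>atlas M. \<forall>i<mdim M.
       Ck_on (mdim M) \<infinity> (cimg c) (\<lambda>x. \<alpha> (cinv c x) (coord_vec M c (cinv c x) i)))"

definition riemannian_metric :: "'a bmanifold \<Rightarrow> 'a two_tensor \<Rightarrow> bool"
  where "riemannian_metric M g \<longleftrightarrow>
    (\<forall>p\<in>points M. \<forall>v\<in>tangent_space M p.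
       tlinear M p (g p v) \<and>
       (\<forall>w\<in>tangent_space M p. g p v w = g p w v) \<and>
       (v \<noteq> (\<lambda>_ _. 0) \<longrightarrow> 0 < g p v v)) \<and>
    (\<forall>c\<in>atlas M. \<forall>i<mdim M. \<forall>j<mdim M.
       Ck_on (mdim M) \<infinity> (cimg c)
         (\<lambda>x. g (cinv c x) (coord_vec M c (cinv c x) i) (coord_vec M c (cinv c x) j)))"

definition differential :: "'a bmanifold \<Rightarrow> ('a \<Rightarrow> real) \<Rightarrow> 'a one_form"
  where "differential M h p \<xi> = (let c = chart_at M p in
    (\<Sum>i<mdim M. pderiv (cimg c) i (\<lambda>x. h (cinv c x)) (cmap c p) * \<xi> c i))"

text \<open>The convention is \<open>d\<alpha>(X,Y) = X(\<alpha>(Y)) - Y(\<alpha>(X)) - \<alpha>([X,Y])\<close>.\<close>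

definition ext_deriv :: "'a bmanifold \<Rightarrow> 'a one_form \<Rightarrow> 'a two_tensor"
  where "ext_deriv M \<alpha> p \<xi> \<eta> =
    (let c = chart_at M p;
         a = (\<lambda>i x. \<alpha> (cinv c x) (coord_vec M c (cinv c x) i))
     in (\<Sum>i<mdim M. \<Sum>j<mdim M.
          (pderiv (cimg c) i (a j) (cmap c p) - pderiv (cimg c) j (a i) (cmap c p))
            * \<xi> c i * \<eta> c j))"

definition pushforward :: "'a bmanifold \<Rightarrow> ('a \<Rightarrow> 'a) \<Rightarrow> 'a \<Rightarrow> 'a tvec \<Rightarrow> 'a tvec"
  where "pushforward M f p \<xi> = (let c = chart_at M p in
    (\<lambda>d. if d \<in> charts_at M (f p)
      then (\<lambda>i. if i < mdim M
        then (\<Sum>j<mdim M.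
          pderiv {x \<in> cimg c. f (cinv c x) \<in> cdom d} j (\<lambda>x. cmap d (f (cinv c x)) i) (cmap c p)
            * \<xi> c j)
        else 0)
      else (\<lambda>_. 0)))"


section \<open>Riemannian geometry\<close>

text \<open>The tangent vector representing a covector with respect to the metric.\<close>

definition sharp :: "'a bmanifold \<Rightarrow> 'a two_tensor \<Rightarrow> 'a \<Rightarrow> ('a tvec \<Rightarrow> real) \<Rightarrow> 'a tvec"
  where "sharp M g p \<omega> =
    (THE w. w \<in> tangent_space M p \<and> (\<forall>\<eta>\<in>tangent_space M p. g p w \<eta> = \<omega> \<eta>))"

definition grad :: "'a bmanifold \<Rightarrow> 'a two_tensor \<Rightarrow> ('a \<Rightarrow> real) \<Rightarrow> 'a \<Rightarrow> 'a tvec"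
  where "grad M g h p = sharp M g p (differential M h p)"

definition metric_coeff ::
    "'a bmanifold \<Rightarrow> 'a two_tensor \<Rightarrow> 'a chart \<Rightarrow> nat \<Rightarrow> nat \<Rightarrow> (nat \<Rightarrow> real) \<Rightarrow> real"
  where "metric_coeff M g c i j x =
    g (cinv c x) (coord_vec M c (cinv c x) i) (coord_vec M c (cinv c x) j)"

text \<open>
  \<open>christoffel M g c p k i j\<close> is the Christoffel symbol with upper index k and lower indices i, j
  of the Levi-Civita connection in the chart \<open>c\<close>: the inner sum has the symbols of the first kind,
  and \<^const>\<open>sharp\<close> raises the index.
\<close>

definition christoffel ::
    "'a bmanifold \<Rightarrow> 'a two_tensor \<Rightarrow> 'a chart \<Rightarrow> 'a \<Rightarrow> nat \<Rightarrow> nat \<Rightarrow> nat \<Rightarrow> real"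
  where "christoffel M g c p k i j =
    sharp M g p (\<lambda>\<eta>. \<Sum>l<mdim M.
      (1/2) * (pderiv (cimg c) i (metric_coeff M g c j l) (cmap c p)
             + pderiv (cimg c) j (metric_coeff M g c i l) (cmap c p)
             - pderiv (cimg c) l (metric_coeff M g c i j) (cmap c p)) * \<eta> c l) c k"

definition velocity :: "'a bmanifold \<Rightarrow> real set \<Rightarrow> (real \<Rightarrow> 'a) \<Rightarrow> real \<Rightarrow> 'a tvec"
  where "velocity M I \<gamma> s = (\<lambda>c. if c \<in> charts_at M (\<gamma> s)
    then (\<lambda>i. if i < mdim M then vector_derivative (\<lambda>t. cmap c (\<gamma> t) i) (at s within I) else 0)
    else (\<lambda>_. 0))"

text \<open>The covariant derivative of the velocity along the curve.\<close>

definition cov_acceleration ::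
    "'a bmanifold \<Rightarrow> 'a two_tensor \<Rightarrow> real set \<Rightarrow> (real \<Rightarrow> 'a) \<Rightarrow> real \<Rightarrow> 'a tvec"
  where "cov_acceleration M g I \<gamma> s =
    (let c = chart_at M (\<gamma> s);
         v = (\<lambda>i t. vector_derivative (\<lambda>u. cmap c (\<gamma> u) i) (at t within I))
     in tvec_of M c (\<gamma> s) (\<lambda>k. vector_derivative (v k) (at s within I) +
          (\<Sum>i<mdim M. \<Sum>j<mdim M. christoffel M g c (\<gamma> s) k i j * v i s * v j s)))"

definition inward_normal :: "'a bmanifold \<Rightarrow> 'a two_tensor \<Rightarrow> 'a \<Rightarrow> 'a tvec"
  where "inward_normal M g p =
    (THE v. v \<in> tangent_space M p \<and> g p v v = 1 \<and>
       (\<forall>\<eta>\<in>boundary_tangent_space M p. g p v \<eta> = 0) \<and>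
       (\<forall>c\<in>charts_at M p. 0 < v c 0))"

text \<open>
  The covariant derivative of the normal field in a direction \<open>\<xi>\<close> tangent to the boundary. The
  field lives on the boundary only, so its components are differentiated along the face
  \<open>x 0 = 0\<close> of the chart.
\<close>

definition cov_deriv_normal :: "'a bmanifold \<Rightarrow> 'a two_tensor \<Rightarrow> 'a \<Rightarrow> 'a tvec \<Rightarrow> 'a tvec"
  where "cov_deriv_normal M g p \<xi> =
    (let c = chart_at M p in
     tvec_of M c p (\<lambda>k.
       (\<Sum>i\<in>{1..<mdim M}.
          pderiv {x \<in> cimg c. x 0 = 0} i (\<lambda>x. inward_normal M g (cinv c x) c k) (cmap c p) * \<xi> c i) +
       (\<Sum>i<mdim M. \<Sum>j<mdim M.
          christoffel M g c p k i j * \<xi> c i * inward_normal M g p c j)))"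

definition second_fund_form :: "'a bmanifold \<Rightarrow> 'a two_tensor \<Rightarrow> 'a \<Rightarrow> 'a tvec \<Rightarrow> real"
  where "second_fund_form M g p \<xi> = - g p (cov_deriv_normal M g p \<xi>) \<xi>"


section \<open>MP-systems\<close>

definition mp_system :: "'a bmanifold \<Rightarrow> 'a two_tensor \<Rightarrow> 'a one_form \<Rightarrow> ('a \<Rightarrow> real) \<Rightarrow> bool"
  where "mp_system M g \<alpha> U \<longleftrightarrow>
    riemannian_metric M g \<and> smooth_one_form M \<alpha> \<and> smooth_fun M U"

definition lorentz_force ::
    "'a bmanifold \<Rightarrow> 'a two_tensor \<Rightarrow> 'a one_form \<Rightarrow> 'a \<Rightarrow> 'a tvec \<Rightarrow> 'a tvec"
  where "lorentz_force M g \<alpha> p \<xi> = sharp M g p (ext_deriv M \<alpha> p \<xi>)"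

definition energy :: "'a two_tensor \<Rightarrow> ('a \<Rightarrow> real) \<Rightarrow> 'a \<Rightarrow> 'a tvec \<Rightarrow> real"
  where "energy g U p \<xi> = (1/2) * g p \<xi> \<xi> + U p"

definition energy_sphere ::
    "'a bmanifold \<Rightarrow> 'a two_tensor \<Rightarrow> ('a \<Rightarrow> real) \<Rightarrow> real \<Rightarrow> 'a \<Rightarrow> 'a tvec set"
  where "energy_sphere M g U k p = {\<xi> \<in> tangent_space M p. energy g U p \<xi> = k}"

definition twice_differentiable_curve :: "'a bmanifold \<Rightarrow> real set \<Rightarrow> (real \<Rightarrow> 'a) \<Rightarrow> bool"
  where "twice_differentiable_curve M I \<gamma> \<longleftrightarrow>
    continuous_map (top_of_set I) (mtop M) \<gamma> \<and>
    (\<forall>c\<in>atlas M. \<forall>i<mdim M. \<forall>s\<in>I. \<gamma> s \<in> cdom c \<longrightarrow>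
       (\<lambda>t. cmap c (\<gamma> t) i) differentiable (at s within I) \<and>
       (\<lambda>t. vector_derivative (\<lambda>u. cmap c (\<gamma> u) i) (at t within I)) differentiable (at s within I))"

definition mp_geodesic ::
    "'a bmanifold \<Rightarrow> 'a two_tensor \<Rightarrow> 'a one_form \<Rightarrow> ('a \<Rightarrow> real) \<Rightarrow> real set \<Rightarrow> (real \<Rightarrow> 'a) \<Rightarrow> bool"
  where "mp_geodesic M g \<alpha> U I \<gamma> \<longleftrightarrow>
    twice_differentiable_curve M I \<gamma> \<and>
    (\<forall>s\<in>I. cov_acceleration M g I \<gamma> s =
       (\<lambda>c i. lorentz_force M g \<alpha> (\<gamma> s) (velocity M I \<gamma> s) c i - grad M g U (\<gamma> s) c i))"

text \<open>
  \<open>mp_exp_rel M g \<alpha> U k x v y\<close>: \<open>v = t\<xi>\<close> with \<open>t \<ge> 0\<close>, \<open>\<xi>\<close> of energy \<open>k\<close>, and the MP-geodesic with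
  initial velocity \<open>\<xi>\<close> exists in \<open>M\<close> up to time \<open>t\<close> and is at \<open>y\<close> at that time. The case \<open>t = 0\<close>
  is separate because derivatives within the one-point interval are meaningless.
\<close>

definition mp_exp_rel ::
    "'a bmanifold \<Rightarrow> 'a two_tensor \<Rightarrow> 'a one_form \<Rightarrow> ('a \<Rightarrow> real) \<Rightarrow> real \<Rightarrow> 'a \<Rightarrow> 'a tvec \<Rightarrow> 'a \<Rightarrow> bool"
  where "mp_exp_rel M g \<alpha> U k x v y \<longleftrightarrow>
    (v = (\<lambda>_ _. 0) \<and> y = x) \<or>
    (\<exists>t>0. \<exists>\<xi>\<in>energy_sphere M g U k x. \<exists>\<gamma>.
       v = (\<lambda>c i. t * \<xi> c i) \<and>
       mp_geodesic M g \<alpha> U {0..t} \<gamma> \<and> \<gamma> 0 = x \<and> velocity M {0..t} \<gamma> 0 = \<xi> \<and> \<gamma> t = y)"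

definition mp_exp_dom ::
    "'a bmanifold \<Rightarrow> 'a two_tensor \<Rightarrow> 'a one_form \<Rightarrow> ('a \<Rightarrow> real) \<Rightarrow> real \<Rightarrow> 'a \<Rightarrow> 'a tvec set"
  where "mp_exp_dom M g \<alpha> U k x =
    {v \<in> tangent_space M x. \<exists>y\<in>points M. mp_exp_rel M g \<alpha> U k x v y}"

definition mp_exp ::
    "'a bmanifold \<Rightarrow> 'a two_tensor \<Rightarrow> 'a one_form \<Rightarrow> ('a \<Rightarrow> real) \<Rightarrow> real \<Rightarrow> 'a \<Rightarrow> 'a tvec \<Rightarrow> 'a"
  where "mp_exp M g \<alpha> U k x v = (THE y. mp_exp_rel M g \<alpha> U k x v y)"

text \<open>Maps between subsets of n-space and of the manifold.\<close>

definition Ck_into_manifold ::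
    "'a bmanifold \<Rightarrow> enat \<Rightarrow> (nat \<Rightarrow> real) set \<Rightarrow> ((nat \<Rightarrow> real) \<Rightarrow> 'a) \<Rightarrow> bool"
  where "Ck_into_manifold M r A F \<longleftrightarrow>
    continuous_map (subtopology (Euclidean_space (mdim M)) A) (mtop M) F \<and>
    (\<forall>d\<in>atlas M. \<forall>i<mdim M. Ck_on (mdim M) r {w \<in> A. F w \<in> cdom d} (\<lambda>w. cmap d (F w) i))"

definition Ck_from_manifold ::
    "'a bmanifold \<Rightarrow> enat \<Rightarrow> 'a set \<Rightarrow> ('a \<Rightarrow> nat \<Rightarrow> real) \<Rightarrow> bool"
  where "Ck_from_manifold M r B G \<longleftrightarrow>
    (\<forall>d\<in>atlas M. \<forall>i<mdim M. Ck_on (mdim M) r (cmap d ` (cdom d \<inter> B)) (\<lambda>z. G (cinv d z) i))"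

text \<open>
  The tangent space at \<open>x\<close> is identified with n-space by means of a chart. The MP-exponential map is
  in general only \<open>C\<^sup>1\<close> at the origin and smooth elsewhere, and "diffeomorphism" is meant in this
  sense.
\<close>

definition mp_exp_diffeo ::
    "'a bmanifold \<Rightarrow> 'a two_tensor \<Rightarrow> 'a one_form \<Rightarrow> ('a \<Rightarrow> real) \<Rightarrow> real \<Rightarrow> 'a \<Rightarrow> bool"
  where "mp_exp_diffeo M g \<alpha> U k x \<longleftrightarrow>
    (\<forall>c\<in>charts_at M x.
      let D = {w \<in> topspace (Euclidean_space (mdim M)). tvec_of M c x w \<in> mp_exp_dom M g \<alpha> U k x};
          F = (\<lambda>w. mp_exp M g \<alpha> U k x (tvec_of M c x w));
          G = inv_into D F
      in bij_betw F D (points M) \<and>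
         Ck_into_manifold M 1 D F \<and> Ck_from_manifold M 1 (points M) G \<and>
         Ck_into_manifold M \<infinity> (D - {\<lambda>_. 0}) F \<and> Ck_from_manifold M \<infinity> (points M - {x}) G)"

definition strictly_mp_convex ::
    "'a bmanifold \<Rightarrow> 'a two_tensor \<Rightarrow> 'a one_form \<Rightarrow> ('a \<Rightarrow> real) \<Rightarrow> real \<Rightarrow> bool"
  where "strictly_mp_convex M g \<alpha> U k \<longleftrightarrow>
    (\<forall>p\<in>mboundary M. \<forall>\<xi>\<in>energy_sphere M g U k p \<inter> boundary_tangent_space M p.
       second_fund_form M g p \<xi> >
         g p (lorentz_force M g \<alpha> p \<xi>) (inward_normal M g p) -
         differential M U p (inward_normal M g p))"

definition mp_simple ::
    "'a bmanifold \<Rightarrow> 'a two_tensor \<Rightarrow> 'a one_form \<Rightarrow> ('a \<Rightarrow> real) \<Rightarrow> real \<Rightarrow> bool"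
  where "mp_simple M g \<alpha> U k \<longleftrightarrow>
    strictly_mp_convex M g \<alpha> U k \<and> (\<forall>x\<in>points M. mp_exp_diffeo M g \<alpha> U k x)"


section \<open>The action function\<close>

definition abs_continuous :: "real \<Rightarrow> real \<Rightarrow> (real \<Rightarrow> real) \<Rightarrow> bool"
  where "abs_continuous a b f \<longleftrightarrow>
    (\<forall>\<epsilon>>0. \<exists>\<delta>>0. \<forall>(m::nat) u v.
       (\<forall>i<m. a \<le> u i \<and> u i \<le> v i \<and> v i \<le> b) \<and>
       (\<forall>i<m. \<forall>j<m. i \<noteq> j \<longrightarrow> {u i<..<v i} \<inter> {u j<..<v j} = {}) \<and>
       (\<Sum>i<m. v i - u i) < \<delta> \<longrightarrow>
       (\<Sum>i<m. \<bar>f (v i) - f (u i)\<bar>) < \<epsilon>)"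

definition abs_continuous_curve :: "'a bmanifold \<Rightarrow> real \<Rightarrow> (real \<Rightarrow> 'a) \<Rightarrow> bool"
  where "abs_continuous_curve M T \<gamma> \<longleftrightarrow>
    continuous_map (top_of_set {0..T}) (mtop M) \<gamma> \<and>
    (\<forall>a b. 0 \<le> a \<and> a \<le> b \<and> b \<le> T \<longrightarrow>
      (\<forall>c\<in>atlas M. \<gamma> ` {a..b} \<subseteq> cdom c \<longrightarrow>
        (\<forall>i<mdim M. abs_continuous a b (\<lambda>t. cmap c (\<gamma> t) i))))"

text \<open>
  The kinetic term is a nonnegative integral and may be infinite; the remaining integrand is
  integrable along every absolutely continuous curve.
\<close>

definition mp_action ::
    "'a bmanifold \<Rightarrow> 'a two_tensor \<Rightarrow> 'a one_form \<Rightarrow> ('a \<Rightarrow> real) \<Rightarrow> real \<Rightarrow> real \<Rightarrow> (real \<Rightarrow> 'a) \<Rightarrow> ereal"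
  where "mp_action M g \<alpha> U k T \<gamma> =
    (let v = velocity M {0..T} \<gamma> in
     ereal (1/2) *
       enn2ereal (\<integral>\<^sup>+ t. ennreal (g (\<gamma> t) (v t) (v t)) * indicator {0..T} t \<partial>lebesgue) +
     ereal (k * T - (LINT t:{0..T}|lebesgue. \<alpha> (\<gamma> t) (v t) + U (\<gamma> t))))"

definition action_function ::
    "'a bmanifold \<Rightarrow> 'a two_tensor \<Rightarrow> 'a one_form \<Rightarrow> ('a \<Rightarrow> real) \<Rightarrow> real \<Rightarrow> 'a \<Rightarrow> 'a \<Rightarrow> ereal"
  where "action_function M g \<alpha> U k x y =
    Inf {mp_action M g \<alpha> U k T \<gamma> |T \<gamma>.
      0 < T \<and> abs_continuous_curve M T \<gamma> \<and> \<gamma> 0 = x \<and> \<gamma> T = y}"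

definition same_boundary_action ::
    "'a bmanifold \<Rightarrow> real \<Rightarrow> 'a two_tensor \<Rightarrow> 'a one_form \<Rightarrow> ('a \<Rightarrow> real) \<Rightarrow>
      'a two_tensor \<Rightarrow> 'a one_form \<Rightarrow> ('a \<Rightarrow> real) \<Rightarrow> bool"
  where "same_boundary_action M k g \<alpha> U g' \<alpha>' U' \<longleftrightarrow>
    (\<forall>x\<in>mboundary M. \<forall>y\<in>mboundary M.
       action_function M g \<alpha> U k x y = action_function M g' \<alpha>' U' k x y)"

definition same_boundary_restriction ::
    "'a bmanifold \<Rightarrow> 'a two_tensor \<Rightarrow> 'a one_form \<Rightarrow> ('a \<Rightarrow> real) \<Rightarrow>
      'a two_tensor \<Rightarrow> 'a one_form \<Rightarrow> ('a \<Rightarrow> real) \<Rightarrow> bool"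
  where "same_boundary_restriction M g \<alpha> U g' \<alpha>' U' \<longleftrightarrow>
    (\<forall>p\<in>mboundary M.
       (\<forall>\<xi>\<in>tangent_space M p. \<forall>\<eta>\<in>tangent_space M p. g p \<xi> \<eta> = g' p \<xi> \<eta>) \<and>
       (\<forall>\<xi>\<in>tangent_space M p. \<alpha> p \<xi> = \<alpha>' p \<xi>) \<and>
       U p = U' p)"

definition gauge_equivalent ::
    "'a bmanifold \<Rightarrow> 'a two_tensor \<Rightarrow> 'a one_form \<Rightarrow> ('a \<Rightarrow> real) \<Rightarrow>
      'a two_tensor \<Rightarrow> 'a one_form \<Rightarrow> ('a \<Rightarrow> real) \<Rightarrow> bool"
  where "gauge_equivalent M g \<alpha> U g' \<alpha>' U' \<longleftrightarrow>
    (\<exists>f \<phi>. diffeo M f \<and> (\<forall>p\<in>mboundary M. f p = p) \<and>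
       smooth_fun M \<phi> \<and> (\<forall>p\<in>mboundary M. \<phi> p = 0) \<and>
       (\<forall>p\<in>points M.
         (\<forall>\<xi>\<in>tangent_space M p. \<forall>\<eta>\<in>tangent_space M p.
            g' p \<xi> \<eta> = g (f p) (pushforward M f p \<xi>) (pushforward M f p \<eta>)) \<and>
         (\<forall>\<xi>\<in>tangent_space M p.
            \<alpha>' p \<xi> = \<alpha> (f p) (pushforward M f p \<xi>) + differential M \<phi> p \<xi>) \<and>
         U' p = U (f p)))"

end

theory Submission
  imports Defs
begin


text \<open>
  On the closed unit disc, with energy \<open>k = 1/2\<close> and vanishing magnetic potential, let
  \<open>\<lambda> = (1 - \<epsilon>) + \<epsilon>|z|\<^sup>2\<close>, \<open>g = \<lambda>|dz|\<^sup>2\<close> and \<open>U = 1/2 - 1/(2\<lambda>)\<close>. The Jacobi metric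
  \<open>2(k - U)g\<close> is Euclidean for every \<open>\<epsilon>\<close>, so the geodesics of the system are reparametrised
  straight lines, the inverse of the exponential map is a polynomial in the endpoint, and the
  boundary action function is the Euclidean distance. As \<open>\<lambda> = 1\<close> on the unit circle, the
  boundary values do not depend on \<open>\<epsilon>\<close> either. The potential vanishes for \<open>\<epsilon> = 0\<close> but not for
  \<open>\<epsilon> = 1/2\<close>, and no diffeomorphism can relate these two potentials.
\<close>


section \<open>Smooth functions on n-space\<close>

text \<open>The potential is tied to the metric by 2(k - U) = 1/\<lambda>, so a factor can be moved
  between kinetic and potential part at one fixed energy. Gauge transformations do not have this
  freedom: composition with a diffeomorphism preserves the set of values of the potential, and U is
  identically 0 for \<epsilon> = 0 but U(0) = -1/2 for \<epsilon> = 1/2. A quadratic \<lambda> has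
  polynomial means over segments, and \<lambda> \<ge> 1 - \<epsilon> > 0 on the whole plane makes
  the polynomial inverse of the exponential map a bijection of the plane, not only of the disc.
  Three obstacles shape the work. The disc coordinate z is not a chart, because charts must map into
  a half-space, so every chart formula has to be carried to z through the complex derivative of a
  Moebius map. The exponential map has no closed form, so its smoothness comes from an algebra of
  functions that is closed under partial derivatives. The action is an infimum over all absolutely
  continuous curves, so its lower bound needs Lebesgue's form of the fundamental theorem of
  calculus.\<close>

text \<open>A class of functions that contains its own partial derivatives consists of smooth functions.\<close>

inductive rat_alg ::
    "(nat \<Rightarrow> real) set \<Rightarrow> ((nat \<Rightarrow> real) \<Rightarrow> real) set \<Rightarrow> ((nat \<Rightarrow> real) \<Rightarrow> real) \<Rightarrow> bool"
  for W B where
  base: "f \<in> B \<Longrightarrow> rat_alg W B f"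
| const: "rat_alg W B (\<lambda>x. a)"
| coord: "rat_alg W B (\<lambda>x. x i)"
| add: "rat_alg W B f \<Longrightarrow> rat_alg W B g \<Longrightarrow> rat_alg W B (\<lambda>x. f x + g x)"
| mult: "rat_alg W B f \<Longrightarrow> rat_alg W B g \<Longrightarrow> rat_alg W B (\<lambda>x. f x * g x)"
| inverse: "rat_alg W B f \<Longrightarrow> (\<And>x. x \<in> W \<Longrightarrow> f x \<noteq> 0) \<Longrightarrow> rat_alg W B (\<lambda>x. inverse (f x))"

lemma rat_alg_uminus: "rat_alg W B f \<Longrightarrow> rat_alg W B (\<lambda>x. - f x)"
  using rat_alg.mult[OF rat_alg.const[of W B "-1"]] by simp

lemma rat_alg_diff: "rat_alg W B f \<Longrightarrow> rat_alg W B g \<Longrightarrow> rat_alg W B (\<lambda>x. f x - g x)"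
  using rat_alg.add[OF _ rat_alg_uminus] by fastforce

lemma rat_alg_divide:
  "rat_alg W B f \<Longrightarrow> rat_alg W B g \<Longrightarrow> (\<And>x. x \<in> W \<Longrightarrow> g x \<noteq> 0) \<Longrightarrow> rat_alg W B (\<lambda>x. f x / g x)"
  using rat_alg.mult[OF _ rat_alg.inverse] by (fastforce simp: divide_inverse)

lemma rat_alg_power: "rat_alg W B f \<Longrightarrow> rat_alg W B (\<lambda>x. f x ^ n)"
  by (induction n) (auto intro: rat_alg.const rat_alg.mult)

lemmas rat_alg_intros = rat_alg.const rat_alg.coord rat_alg.add rat_alg.mult rat_alg_uminus
  rat_alg_diff rat_alg_divide rat_alg.inverse rat_alg_power

text \<open>The generators \<open>B\<close> are there for functions without a closed formula:
  \<open>B = {}\<close> gives the rational functions used for charts and tensors, while the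
  components of the exponential map need generators whose derivatives are rational in the generators
  themselves.\<close>

locale derivation_closed =
  fixes n :: nat and W :: "(nat \<Rightarrow> real) set" and B :: "((nat \<Rightarrow> real) \<Rightarrow> real) set"
  assumes open_W: "openin (Euclidean_space n) W"
    and base_continuous: "b \<in> B \<Longrightarrow> continuous_on W b"
    and base_deriv: "b \<in> B \<Longrightarrow> i < n \<Longrightarrow> \<exists>b'. rat_alg W B b' \<and>
      (\<forall>x\<in>W. ((\<lambda>t. b (x(i := t))) has_real_derivative b' x) (at (x i)))"
begin

lemma rat_alg_continuous: "rat_alg W B f \<Longrightarrow> continuous_on W f"
proof (induction rule: rat_alg.induct)
  case (coord i)
  have "continuous_on UNIV (\<lambda>x :: nat \<Rightarrow> real. x i)"
    by (rule continuous_on_product_coordinates)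
  then show ?case
    by (rule continuous_on_subset) auto
qed (auto intro: base_continuous continuous_intros)

lemma rat_alg_deriv:
  assumes "rat_alg W B f" "i < n"
  shows "\<exists>f'. rat_alg W B f' \<and>
    (\<forall>x\<in>W. ((\<lambda>t. f (x(i := t))) has_real_derivative f' x) (at (x i)))"
  using assms(1)
proof (induction rule: rat_alg.induct)
  case (base f)
  then show ?case using base_deriv assms(2) by blast
next
  case (const a)
  show ?case by (rule exI[of _ "\<lambda>_. 0"]) (auto intro: rat_alg.const)
next
  case (coord j)
  show ?case
    by (cases "i = j") (auto intro: exI[of _ "\<lambda>_. 1"] exI[of _ "\<lambda>_. 0"] rat_alg.const)
next
  case (add f g)
  then obtain f' g' where fg: "rat_alg W B f'" "rat_alg W B g'"
    "\<forall>x\<in>W. ((\<lambda>t. f (x(i := t))) has_real_derivative f' x) (at (x i))"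
    "\<forall>x\<in>W. ((\<lambda>t. g (x(i := t))) has_real_derivative g' x) (at (x i))" by blast
  have "((\<lambda>t. f (x(i := t)) + g (x(i := t))) has_real_derivative f' x + g' x) (at (x i))"
    if "x \<in> W" for x
    using fg(3,4) that by (intro DERIV_add) auto
  then show ?case
    using rat_alg.add[OF fg(1,2)] by (intro exI[of _ "\<lambda>x. f' x + g' x"]) blast
next
  case (mult f g)
  then obtain f' g' where fg: "rat_alg W B f'" "rat_alg W B g'"
    "\<forall>x\<in>W. ((\<lambda>t. f (x(i := t))) has_real_derivative f' x) (at (x i))"
    "\<forall>x\<in>W. ((\<lambda>t. g (x(i := t))) has_real_derivative g' x) (at (x i))" by blast
  have "((\<lambda>t. f (x(i := t)) * g (x(i := t))) has_real_derivative f' x * g x + g' x * f x) (at (x i))"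
    if "x \<in> W" for x
    using DERIV_mult[OF bspec[OF fg(3) that] bspec[OF fg(4) that]] by simp
  moreover have "rat_alg W B (\<lambda>x. f' x * g x + g' x * f x)"
    using fg(1,2) mult.hyps by (intro rat_alg.add rat_alg.mult)
  ultimately show ?case by blast
next
  case (inverse f)
  then obtain f' where f: "rat_alg W B f'"
    "\<forall>x\<in>W. ((\<lambda>t. f (x(i := t))) has_real_derivative f' x) (at (x i))" by blast
  have "((\<lambda>t. inverse (f (x(i := t)))) has_real_derivative
      - (inverse (f x) * f' x * inverse (f x))) (at (x i))" if "x \<in> W" for x
    using DERIV_inverse'[OF bspec[OF f(2) that]] inverse.hyps(2)[OF that] by simp
  moreover have "rat_alg W B (\<lambda>x. - (inverse (f x) * f' x * inverse (f x)))"
    using f(1) inverse.hyps by (intro rat_alg_uminus rat_alg.mult rat_alg.inverse)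
  ultimately show ?case by blast
qed

text \<open>Differentiation stays inside the algebra, so a chosen derivative can be iterated along
  any list of indices, which yields the family \<open>D\<close> for every order at once.\<close>

lemma rat_alg_Ck_open:
  assumes "rat_alg W B f"
  shows "Ck_open n r W f"
proof -
  \<comment> \<open>The default \<open>f\<close> keeps \<open>d h i\<close> in the algebra even for
    \<open>i \<ge> n\<close>, so membership of \<open>D is\<close> holds for all lists, not only for
    lists of valid indices.\<close>
  define d where "d h i = (if rat_alg W B h \<and> i < n then SOME h'. rat_alg W B h' \<and>
    (\<forall>x\<in>W. ((\<lambda>t. h (x(i := t))) has_real_derivative h' x) (at (x i))) else f)" for h i
  have d: "rat_alg W B (d h i)"
    "\<forall>x\<in>W. ((\<lambda>t. h (x(i := t))) has_real_derivative d h i x) (at (x i))"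
    if "rat_alg W B h" "i < n" for h i
    using someI_ex[OF rat_alg_deriv[OF that]] that by (auto simp: d_def)
  define D where "D is = foldr (\<lambda>i h. d h i) is f" for "is"
  have D: "rat_alg W B (D is)" for "is"
  proof (induction "is")
    case (Cons i "is")
    then show ?case using d(1) assms by (cases "i < n") (auto simp: D_def d_def)
  qed (auto simp: D_def assms)
  have "continuous_map (subtopology (Euclidean_space n) W) euclideanreal (D is)" for "is"
  proof -
    have "subtopology (Euclidean_space n) W = top_of_set W"
      using openin_subset[OF open_W]
      by (simp add: Euclidean_space_def euclidean_product_topology subtopology_subtopology
          topspace_subtopology Int_absorb1)
    then show ?thesis using rat_alg_continuous[OF D] by simp
  qed
  moreover have "\<forall>x\<in>W. ((\<lambda>t. D is (x(i := t))) has_real_derivative D (i # is) x) (at (x i))"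
    if "i < n" for i "is"
    using d(2)[OF D that] by (simp add: D_def)
  ultimately show ?thesis
    unfolding Ck_open_def using open_W by (intro conjI exI[of _ D]) (auto simp: D_def)
qed

end

lemma derivation_closed_empty: "openin (Euclidean_space n) W \<Longrightarrow> derivation_closed n W {}"
  by unfold_locales auto

lemma Ck_on_rat_alg:
  assumes "derivation_closed n W B" "rat_alg W B f'" "A \<subseteq> W" "\<And>x. x \<in> A \<Longrightarrow> f x = f' x"
  shows "Ck_on n r A f"
  unfolding Ck_on_def
proof
  fix x assume "x \<in> A"
  then show "\<exists>W F. x \<in> W \<and> Ck_open n r W F \<and> (\<forall>y\<in>A \<inter> W. F y = f y)"
    using derivation_closed.rat_alg_Ck_open[OF assms(1,2)] assms(3,4)
    by (intro exI[of _ W] exI[of _ f']) auto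
qed

section \<open>The plane as the complex numbers\<close>

definition emb :: "complex \<Rightarrow> nat \<Rightarrow> real"
  where "emb z = (\<lambda>i. if i = 0 then Re z else if i = 1 then Im z else 0)"

definition cpx :: "(nat \<Rightarrow> real) \<Rightarrow> complex"
  where "cpx x = Complex (x 0) (x 1)"

lemma Re_cpx [simp]: "Re (cpx x) = x 0" and Im_cpx [simp]: "Im (cpx x) = x (Suc 0)"
  by (auto simp: cpx_def)

lemma cpx_emb [simp]: "cpx (emb z) = z"
  by (auto simp: cpx_def emb_def complex_eq_iff)

lemma emb_0 [simp]: "emb z 0 = Re z" and emb_1 [simp]: "emb z (Suc 0) = Im z"
  and emb_ge2: "2 \<le> i \<Longrightarrow> emb z i = 0"
  by (auto simp: emb_def)

abbreviation plane :: "(nat \<Rightarrow> real) set"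
  where "plane \<equiv> topspace (Euclidean_space 2)"

lemma plane_eq: "plane = {x. \<forall>i\<ge>2. x i = 0}"
  by (simp add: topspace_Euclidean_space)

lemma emb_cpx [simp]: "x \<in> plane \<Longrightarrow> emb (cpx x) = x"
  by (auto simp: emb_def plane_eq fun_eq_iff)

lemma emb_in_plane [simp]: "emb z \<in> plane"
  by (auto simp: emb_def plane_eq)

lemma emb_eq_iff [simp]: "emb z = emb w \<longleftrightarrow> z = w"
  by (metis cpx_emb)

lemma emb_zero: "emb 0 = (\<lambda>_. 0)"
  by (auto simp: emb_def)

lemma Euclidean_plane: "Euclidean_space 2 = top_of_set {x. \<forall>i\<ge>2. x i = 0}"
  by (simp add: Euclidean_space_def euclidean_product_topology)

lemma Euclidean_plane_subtopology:
  "S \<subseteq> plane \<Longrightarrow> subtopology (Euclidean_space 2) S = top_of_set S"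
  unfolding plane_eq unfolding Euclidean_plane subtopology_subtopology by (simp add: Int_absorb1)

lemma continuous_on_emb: "continuous_on S emb"
  unfolding emb_def
proof (rule continuous_on_coordinatewise_then_product)
  show "continuous_on S (\<lambda>z. if i = 0 then Re z else if i = 1 then Im z else 0)" for i :: nat
    by (cases "i = 0"; cases "i = 1") (auto intro: continuous_intros)
qed

lemma continuous_on_cpx: "continuous_on S cpx"
proof -
  have "continuous_on UNIV (\<lambda>x :: nat \<Rightarrow> real. of_real (x 0) + \<i> * of_real (x (Suc 0)))"
    by (intro continuous_intros continuous_on_product_coordinates)
  then show ?thesis
    by (rule continuous_on_subset[THEN continuous_on_eq]) (auto simp: complex_eq_iff)
qed

lemma openin_plane_vimage:
  assumes "open S" shows "openin (Euclidean_space 2) {x \<in> plane. cpx x \<in> S}"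
proof -
  have "{x \<in> plane. cpx x \<in> S} = plane \<inter> cpx -` S" by auto
  then show ?thesis
    using continuous_openin_preimage_gen[OF continuous_on_cpx[of plane] assms]
    unfolding plane_eq unfolding Euclidean_plane by simp
qed

section \<open>Complex-valued members of the algebra\<close>

definition crat_alg ::
    "(nat \<Rightarrow> real) set \<Rightarrow> ((nat \<Rightarrow> real) \<Rightarrow> real) set \<Rightarrow> ((nat \<Rightarrow> real) \<Rightarrow> complex) \<Rightarrow> bool"
  where "crat_alg W B f \<longleftrightarrow> rat_alg W B (\<lambda>x. Re (f x)) \<and> rat_alg W B (\<lambda>x. Im (f x))"

lemma crat_alg_const: "crat_alg W B (\<lambda>x. a)"
  and crat_alg_cpx: "crat_alg W B cpx"
  and crat_alg_of_real: "rat_alg W B h \<Longrightarrow> crat_alg W B (\<lambda>x. complex_of_real (h x))"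
  and crat_alg_Re: "crat_alg W B f \<Longrightarrow> rat_alg W B (\<lambda>x. Re (f x))"
  and crat_alg_Im: "crat_alg W B f \<Longrightarrow> rat_alg W B (\<lambda>x. Im (f x))"
  and crat_alg_cnj: "crat_alg W B f \<Longrightarrow> crat_alg W B (\<lambda>x. cnj (f x))"
  and crat_alg_uminus: "crat_alg W B f \<Longrightarrow> crat_alg W B (\<lambda>x. - f x)"
  and crat_alg_add: "crat_alg W B f \<Longrightarrow> crat_alg W B g \<Longrightarrow> crat_alg W B (\<lambda>x. f x + g x)"
  and crat_alg_diff: "crat_alg W B f \<Longrightarrow> crat_alg W B g \<Longrightarrow> crat_alg W B (\<lambda>x. f x - g x)"
  and crat_alg_mult: "crat_alg W B f \<Longrightarrow> crat_alg W B g \<Longrightarrow> crat_alg W B (\<lambda>x. f x * g x)"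
  by (auto simp: crat_alg_def intro!: rat_alg_intros)

lemma crat_alg_norm2: "crat_alg W B f \<Longrightarrow> rat_alg W B (\<lambda>x. (cmod (f x))\<^sup>2)"
  by (auto simp: crat_alg_def cmod_power2 intro!: rat_alg_intros)

lemma crat_alg_inverse:
  assumes "crat_alg W B f" "\<And>x. x \<in> W \<Longrightarrow> f x \<noteq> 0"
  shows "crat_alg W B (\<lambda>x. inverse (f x))"
proof -
  have nz: "(Re (f x))\<^sup>2 + (Im (f x))\<^sup>2 \<noteq> 0" if "x \<in> W" for x
    using assms(2)[OF that] by (auto simp: complex_eq_iff sum_power2_eq_zero_iff)
  have "rat_alg W B (\<lambda>x. Re (f x))" "rat_alg W B (\<lambda>x. Im (f x))"
    using assms(1) by (auto simp: crat_alg_def)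
  then show ?thesis
    unfolding crat_alg_def inverse_complex.sel
    by (intro conjI rat_alg_divide rat_alg.add rat_alg_power rat_alg_uminus nz)
qed

lemma crat_alg_divide:
  "crat_alg W B f \<Longrightarrow> crat_alg W B g \<Longrightarrow> (\<And>x. x \<in> W \<Longrightarrow> g x \<noteq> 0) \<Longrightarrow> crat_alg W B (\<lambda>x. f x / g x)"
  using crat_alg_mult[OF _ crat_alg_inverse] by (fastforce simp: divide_inverse)

lemmas crat_alg_intros = crat_alg_const crat_alg_cpx crat_alg_of_real crat_alg_cnj crat_alg_add
  crat_alg_diff crat_alg_mult crat_alg_inverse crat_alg_divide


section \<open>The closed disc\<close>

definition cay :: "complex \<Rightarrow> complex"
  where "cay z = (1 - z) / (1 + z)"

text \<open>
  The disc without the boundary point \<open>-s\<close>, where \<open>s = \<plusminus>1\<close>, is mapped onto the half-plane by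
  \<open>z \<mapsto> cay (s z)\<close>; the inverse is \<open>w \<mapsto> s cay w\<close>.
\<close>

definition hchart :: "real \<Rightarrow> (nat \<Rightarrow> real) chart"
  where "hchart s = (emb ` (cball 0 1 - {- of_real s}), \<lambda>p. emb (cay (of_real s * cpx p)))"

definition disc :: "(nat \<Rightarrow> real) bmanifold"
  where "disc = \<lparr>mdim = 2, mtop = top_of_set (emb ` cball 0 1), atlas = {hchart 1, hchart (-1)}\<rparr>"

abbreviation sgns :: "real set"
  where "sgns \<equiv> {1, -1}"

lemma disc_simps [simp]:
  "mdim disc = 2" "mtop disc = top_of_set (emb ` cball 0 1)" "atlas disc = hchart ` sgns"
  by (auto simp: disc_def)

lemma cdom_hchart: "cdom (hchart s) = emb ` (cball 0 1 - {- of_real s})"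
  and cmap_hchart: "cmap (hchart s) p = emb (cay (of_real s * cpx p))"
  by (auto simp: cdom_def cmap_def hchart_def)

lemma cay_cay [simp]: "z \<noteq> -1 \<Longrightarrow> cay (cay z) = z"
proof -
  assume "z \<noteq> -1"
  then have nz: "1 + z \<noteq> 0" by (metis add.inverse_unique)
  have "1 + cay z = 2 / (1 + z)" "1 - cay z = 2 * z / (1 + z)"
    using nz by (simp_all add: cay_def divide_simps)
  then show ?thesis using nz by (simp add: cay_def[of "cay z"])
qed

lemma one_plus_neq_0_iff: "1 + z \<noteq> 0 \<longleftrightarrow> z \<noteq> (-1 :: complex)"
  by (metis add.inverse_unique add.right_inverse)

lemma sgn_mult_neq:
  "s \<in> sgns \<Longrightarrow> z \<noteq> - complex_of_real s \<Longrightarrow> of_real s * z \<noteq> -1"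
  by (auto simp: minus_equation_iff)

lemma sgn_sq [simp]: "s \<in> sgns \<Longrightarrow> complex_of_real s * (of_real s * z) = z"
  by auto

lemma one_plus_cay: "z \<noteq> -1 \<Longrightarrow> 1 + cay z = 2 / (1 + z)"
  using one_plus_neq_0_iff[of z] by (simp add: cay_def divide_simps)

lemma cay_neq: "z \<noteq> -1 \<Longrightarrow> cay z \<noteq> -1"
  using one_plus_cay[of z] one_plus_neq_0_iff[of z] one_plus_neq_0_iff[of "cay z"] by auto

lemma norm_one_minus: "(cmod (1 + w))\<^sup>2 - (cmod (1 - w))\<^sup>2 = 4 * Re w"
  unfolding cmod_power2 by (simp add: power2_sum power2_diff)

lemma norm_cay_le_1: "Re w \<ge> 0 \<Longrightarrow> cmod (cay w) \<le> 1"
proof -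
  assume w: "Re w \<ge> 0"
  have "(cmod (1 - w))\<^sup>2 \<le> (cmod (1 + w))\<^sup>2"
    using norm_one_minus[of w] w by linarith
  then have "cmod (1 - w) \<le> cmod (1 + w)"
    by (rule power2_le_imp_le) simp
  then show ?thesis by (simp add: cay_def norm_divide divide_le_eq_1)
qed

lemma Re_cay: "Re (cay z) = (1 - (cmod z)\<^sup>2) / (cmod (1 + z))\<^sup>2"
proof -
  have "(1 - Re z) * (1 + Re z) - Im z * Im z = 1 - ((Re z)\<^sup>2 + (Im z)\<^sup>2)"
    by algebra
  then show ?thesis by (simp add: cay_def Re_divide cmod_power2)
qed

lemma Re_cay_ge_0: "cmod z \<le> 1 \<Longrightarrow> Re (cay z) \<ge> 0"
  by (simp add: Re_cay power_le_one)

lemma Re_cay_eq_0: "z \<noteq> -1 \<Longrightarrow> cmod z \<le> 1 \<Longrightarrow> Re (cay z) = 0 \<longleftrightarrow> cmod z = 1"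
  using one_plus_neq_0_iff[of z] power2_eq_iff_nonneg[of 1 "cmod z"] by (auto simp: Re_cay)

lemma half_space_eq: "half_space 2 = {x \<in> plane. 0 \<le> Re (cpx x)}"
  by (simp add: half_space_def)

lemma cmap_in_half_space:
  assumes "s \<in> sgns" "z \<in> cball 0 1" "z \<noteq> - of_real s"
  shows "cmap (hchart s) (emb z) \<in> half_space 2"
  using assms Re_cay_ge_0[of "of_real s * z"]
  by (auto simp: half_space_eq cmap_hchart norm_mult)

lemma cinv_cmap [simp]:
  assumes "s \<in> sgns" "z \<in> cball 0 1" "z \<noteq> - of_real s"
  shows "cinv (hchart s) (emb (cay (of_real s * z))) = emb z"
proof -
  have inj: "inj_on (cmap (hchart s)) (cdom (hchart s))"
  proof (rule inj_on_inverseI[where g = "\<lambda>x. emb (of_real s * cay (cpx x))"])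
    fix p assume "p \<in> cdom (hchart s)"
    then show "emb (of_real s * cay (cpx (cmap (hchart s) p))) = p"
      using assms(1) sgn_mult_neq[OF assms(1)] by (auto simp: cdom_hchart cmap_hchart)
  qed
  have "emb (cay (of_real s * z)) = cmap (hchart s) (emb z)" by (simp add: cmap_hchart)
  then show ?thesis
    using inv_into_f_f[OF inj, of "emb z"] assms(2,3) by (simp add: cinv_def cdom_hchart)
qed

lemma chart_point:
  assumes "s \<in> sgns" "x \<in> half_space 2"
  shows "of_real s * cay (cpx x) \<in> cball 0 1" "of_real s * cay (cpx x) \<noteq> - of_real s"
    "cay (of_real s * (of_real s * cay (cpx x))) = cpx x"
    "cpx x \<noteq> -1" "x \<in> plane"
proof -
  have "0 \<le> Re (cpx x)" using assms(2) by (simp add: half_space_eq)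
  then show *: "cpx x \<noteq> -1" by (auto simp del: Re_cpx)
  show "x \<in> plane" using assms(2) by (simp add: half_space_eq)
  show "of_real s * cay (cpx x) \<in> cball 0 1"
    using assms norm_cay_le_1[of "cpx x"] by (auto simp: half_space_eq norm_mult)
  show "of_real s * cay (cpx x) \<noteq> - of_real s"
    using assms(1) cay_neq[OF *] by auto (metis minus_minus)
  show "cay (of_real s * (of_real s * cay (cpx x))) = cpx x"
    using assms(1) * by simp
qed

lemma cinv_hchart:
  assumes "s \<in> sgns" "x \<in> half_space 2"
  shows "cinv (hchart s) x = emb (of_real s * cay (cpx x))"
  using cinv_cmap[OF assms(1) chart_point(1,2)[OF assms]] chart_point(3,5)[OF assms] by simp

lemma cimg_hchart: 
  assumes "s \<in> sgns" shows "cimg (hchart s) = half_space 2"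
proof
  show "cimg (hchart s) \<subseteq> half_space 2"
    using cmap_in_half_space[OF assms] by (force simp: cimg_def cdom_hchart)
  show "half_space 2 \<subseteq> cimg (hchart s)"
  proof
    fix x assume x: "x \<in> half_space 2"
    have "x = cmap (hchart s) (emb (of_real s * cay (cpx x)))"
      using chart_point(3,5)[OF assms x] by (simp add: cmap_hchart)
    then show "x \<in> cimg (hchart s)"
      using chart_point(1,2)[OF assms x] unfolding cimg_def cdom_hchart by blast
  qed
qed

lemma hchart_eq_iff: "s \<in> sgns \<Longrightarrow> s' \<in> sgns \<Longrightarrow> hchart s = hchart s' \<longleftrightarrow> s = s'"
proof -
  have "emb 1 \<in> cdom (hchart 1)" "emb 1 \<notin> cdom (hchart (-1))"
    by (auto simp: cdom_hchart)
  then show "s \<in> sgns \<Longrightarrow> s' \<in> sgns \<Longrightarrow> hchart s = hchart s' \<longleftrightarrow> s = s'" by auto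
qed

lemma charts_at_disc:
  assumes "z \<in> cball 0 1"
  shows "charts_at disc (emb z) = {hchart s |s. s \<in> sgns \<and> z \<noteq> - of_real s}"
proof -
  have "emb z \<in> cdom (hchart s) \<longleftrightarrow> z \<noteq> - of_real s" for s
    using assms by (auto simp: cdom_hchart)
  then show ?thesis unfolding charts_at_def disc_simps by blast
qed

text \<open>\<open>chart_at\<close> is a choice operator, so which chart it picks is unknown
  wherever both are available. This is why all later chart computations are done for an unspecified
  sign \<open>s\<close>.\<close>

lemma chart_at_disc:
  assumes "z \<in> cball 0 1"
  obtains s where "s \<in> sgns" "z \<noteq> - of_real s" "chart_at disc (emb z) = hchart s"
proof -
  have "z \<noteq> - of_real 1 \<or> z \<noteq> - of_real (-1)" by (auto simp: complex_eq_iff)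
  then have "\<exists>c. c \<in> charts_at disc (emb z)" 
    unfolding charts_at_disc[OF assms] by blast
  then have "chart_at disc (emb z) \<in> charts_at disc (emb z)"
    unfolding chart_at_def by (rule someI_ex)
  then show ?thesis using that assms by (auto simp: charts_at_disc)
qed

lemma mboundary_disc: "mboundary disc = emb ` sphere 0 1"
proof -
  have *: "(\<exists>c\<in>charts_at disc (emb z). cmap c (emb z) 0 = 0) \<longleftrightarrow> cmod z = 1" if z: "cmod z \<le> 1" for z
  proof -
    have "cmap (hchart s) (emb z) 0 = 0 \<longleftrightarrow> cmod z = 1" if "s \<in> sgns" "z \<noteq> - of_real s" for s
      using Re_cay_eq_0[OF sgn_mult_neq[OF that]] z that by (auto simp: cmap_hchart norm_mult)
    moreover obtain s where "s \<in> sgns" "z \<noteq> - of_real s" "chart_at disc (emb z) = hchart s"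
      using chart_at_disc z by (metis mem_cball_0)
    ultimately show ?thesis using z by (simp only: charts_at_disc mem_cball_0) blast
  qed
  have "mboundary disc = emb ` {z \<in> cball 0 1. \<exists>c\<in>charts_at disc (emb z). cmap c (emb z) 0 = 0}"
    unfolding mboundary_def by (simp only: disc_simps topspace_euclidean_subtopology) blast
  also have "{z \<in> cball 0 1. \<exists>c\<in>charts_at disc (emb z). cmap c (emb z) 0 = 0} =
      {z \<in> cball 0 1. cmod z = 1}"
    using * by (intro Collect_cong conj_cong refl) (simp only: mem_cball_0)
  also have "\<dots> = sphere 0 1" by auto
  finally show ?thesis .
qed

text \<open>The point missing from the other chart is \<open>of_real s\<close>, and
  \<open>cay 1 = 0\<close>: the overlap of the two charts is the half-plane without the
  origin.\<close>

lemma transition_dom: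
  assumes "s \<in> sgns" "s' \<in> sgns"
  shows "cmap (hchart s) ` (cdom (hchart s) \<inter> cdom (hchart s')) =
    {x \<in> half_space 2. cpx x \<in> (if s = s' then UNIV else - {0})}" (is "?L = ?R")
proof
  have *: "s' = - s" if "s \<noteq> s'" using that assms by auto
  show "?L \<subseteq> ?R"
  proof
    fix x assume "x \<in> ?L"
    then obtain p where p: "p \<in> cdom (hchart s)" "p \<in> cdom (hchart s')" "x = cmap (hchart s) p"
      by blast
    from p(1) obtain z where z': "p = emb z" "z \<in> cball 0 1" "z \<noteq> - of_real s"
      unfolding cdom_hchart by blast
    with p have z: "z \<in> cball 0 1" "z \<noteq> - of_real s" "z \<noteq> - of_real s'"
      "x = cmap (hchart s) (emb z)" by (auto simp: cdom_hchart)
    have "cay (of_real s * z) \<noteq> 0" if "s \<noteq> s'"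
      using *[OF that] one_plus_neq_0_iff[of "of_real s * z"] sgn_mult_neq[OF assms(1) z(2)]
        sgn_mult_neq[OF assms(2) z(3)] by (auto simp: cay_def)
    then show "x \<in> ?R" using cmap_in_half_space[OF assms(1) z(1,2)] z(4)
      by (auto simp: cmap_hchart)
  qed
  show "?R \<subseteq> ?L"
  proof
    fix x assume x: "x \<in> ?R"
    then have h: "x \<in> half_space 2" by simp
    define z where "z = of_real s * cay (cpx x)"
    have "z \<noteq> - of_real s'"
    proof (cases "s = s'")
      case False
      then have nz: "cpx x \<noteq> 0" using x by auto
      have "cay (cpx x) \<noteq> 1"
        using nz chart_point(4)[OF assms(1) h] one_plus_neq_0_iff[of "cpx x"] by (simp add: cay_def)
      then show ?thesis using *[OF False] assms by (auto simp: z_def)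
    qed (use chart_point(2)[OF assms(1) h] in \<open>auto simp: z_def\<close>)
    moreover have "x = cmap (hchart s) (emb z)"
      using chart_point(3,5)[OF assms(1) h] by (simp add: cmap_hchart z_def)
    ultimately show "x \<in> ?L"
      using chart_point(1,2)[OF assms(1) h] unfolding cdom_hchart z_def by (auto intro!: imageI)
  qed
qed

text \<open>Conjugating the sign change z -> -z by the Cayley transform gives the inversion w ->
  1/w, which keeps the half-plane and is rational.\<close>

lemma transition_eq:
  assumes "s \<in> sgns" "s' \<in> sgns" "x \<in> half_space 2"
  shows "cmap (hchart s') (cinv (hchart s) x) = emb (if s = s' then cpx x else inverse (cpx x))"
proof -
  have nz: "1 + cpx x \<noteq> 0" using chart_point(4)[OF assms(1,3)] one_plus_neq_0_iff by blast
  have "cay (- cay w) = inverse w" if "1 + w \<noteq> 0" for w :: complex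
  proof -
    define a where "a = 2 / (1 + w)"
    have a: "a \<noteq> 0" "1 + cay w = a" "1 - cay w = w * a"
      using that by (simp_all add: cay_def a_def divide_simps)
    then have "cay (- cay w) = a / (w * a)"
      by (simp only: cay_def[of "- cay w"] diff_minus_eq_add flip: diff_conv_add_uminus)
    also have "\<dots> = inverse w" using a(1) by (simp add: divide_simps)
    finally show ?thesis .
  qed
  then have "cay (of_real s' * (of_real s * cay (cpx x))) =
      (if s = s' then cpx x else inverse (cpx x))"
    using nz assms(1,2) chart_point(4)[OF assms(1,3)] by auto
  then show ?thesis by (simp add: cinv_hchart[OF assms(1,3)] cmap_hchart)
qed

lemma disc_smooth_manifold: "smooth_manifold_with_boundary disc"
  unfolding smooth_manifold_with_boundary_def
proof (intro conjI ballI allI impI)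
  show "Hausdorff_space (mtop disc)"
    unfolding disc_simps by (simp add: Hausdorff_space_subtopology)
  obtain \<B> :: "(nat \<Rightarrow> real) set set" where \<B>: "countable \<B>" "\<And>C. C \<in> \<B> \<Longrightarrow> open C"
    "\<And>S. open S \<Longrightarrow> \<exists>U. U \<subseteq> \<B> \<and> S = \<Union>U" by (rule univ_second_countable) blast
  have "second_countable (euclidean :: (nat \<Rightarrow> real) topology)"
    unfolding second_countable_def using \<B> by (intro exI[of _ \<B>]) (simp, blast)
  then show "second_countable (mtop disc)"
    by (simp add: second_countable_subtopology)
  show "(\<Union>c\<in>atlas disc. cdom c) = points disc"
    by (auto simp: cdom_hchart image_iff complex_eq_iff)
next
  fix c assume "c \<in> atlas disc"
  then obtain s where s: "s \<in> sgns" and c: "c = hchart s" by auto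
  show "openin (subtopology (Euclidean_space (mdim disc)) (half_space (mdim disc))) (cimg c)"
    using s by (simp add: c cimg_hchart openin_subtopology_refl half_space_def subtopology_topspace)
  have eq: "emb ` (cball 0 1 - {- of_real s}) = emb ` cball 0 1 \<inter> cpx -` (- {- complex_of_real s})"
    by auto
  show "openin (mtop disc) (cdom c)"
    unfolding c cdom_hchart disc_simps eq
    by (intro continuous_openin_preimage_gen continuous_on_cpx) auto
  have sub: "cdom c \<subseteq> emb ` cball 0 1" by (auto simp: c cdom_hchart)
  have h: "half_space 2 \<subseteq> plane" by (auto simp: half_space_def)
  show "homeomorphic_map (subtopology (mtop disc) (cdom c))
         (subtopology (Euclidean_space (mdim disc)) (cimg c)) (cmap c)"
    unfolding homeomorphic_map_maps homeomorphic_maps_def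
  proof (intro exI[of _ "\<lambda>x. emb (of_real s * cay (cpx x))"] conjI)
    have t1: "subtopology (mtop disc) (cdom c) = top_of_set (cdom c)"
      using sub by (simp add: subtopology_subtopology Int_absorb1)
    have t2: "subtopology (Euclidean_space (mdim disc)) (cimg c) = top_of_set (half_space 2)"
      using s h by (simp add: c cimg_hchart Euclidean_plane_subtopology)
    have "continuous_on (cdom c) (\<lambda>p. emb (cay (of_real s * cpx p)))"
      unfolding cay_def
      by (intro continuous_on_compose2[OF continuous_on_emb[of UNIV]] continuous_intros
          continuous_on_cpx) (auto simp: one_plus_neq_0_iff c cdom_hchart dest: sgn_mult_neq[OF s])
    moreover have "cmap c \<in> cdom c \<rightarrow> half_space 2"
      unfolding c cdom_hchart using cmap_in_half_space[OF s] by blast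
    ultimately show "continuous_map (subtopology (mtop disc) (cdom c))
       (subtopology (Euclidean_space (mdim disc)) (cimg c)) (cmap c)"
      unfolding t1 t2 by (simp add: c cmap_hchart[abs_def])
    have "continuous_on (half_space 2) (\<lambda>x. emb (of_real s * cay (cpx x)))"
      unfolding cay_def
      by (intro continuous_on_compose2[OF continuous_on_emb[of UNIV]] continuous_intros
          continuous_on_cpx) (use one_plus_neq_0_iff chart_point(4)[OF s] in auto)
    then show "continuous_map (subtopology (Euclidean_space (mdim disc)) (cimg c))
       (subtopology (mtop disc) (cdom c)) (\<lambda>x. emb (of_real s * cay (cpx x)))"
      unfolding t1 t2 using chart_point(1,2)[OF s] by (auto simp: c cdom_hchart simp del: mem_cball_0)
    show "\<forall>x\<in>topspace (subtopology (mtop disc) (cdom c)).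
       emb (of_real s * cay (cpx (cmap c x))) = x"
      unfolding t1 using s sgn_mult_neq[OF s] by (auto simp: c cdom_hchart cmap_hchart)
    show "\<forall>x\<in>topspace (subtopology (Euclidean_space (mdim disc)) (cimg c)).
       cmap c (emb (of_real s * cay (cpx x))) = x"
      unfolding t2 using chart_point(3,5)[OF s] by (auto simp: c cmap_hchart)
  qed
next
  fix c d i assume "c \<in> atlas disc" "d \<in> atlas disc" "i < mdim disc"
  then obtain s s' where s: "s \<in> sgns" "s' \<in> sgns" and c: "c = hchart s" "d = hchart s'" by auto
  let ?W = "{x \<in> plane. cpx x \<in> (if s = s' then UNIV else - {0})}"
  have 1: "derivation_closed 2 ?W {}"
    by (intro derivation_closed_empty openin_plane_vimage) auto
  have 2: "crat_alg ?W {} (\<lambda>x. if s = s' then cpx x else inverse (cpx x))"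
    by (cases "s = s'") (auto intro!: crat_alg_intros)
  have 3: "rat_alg ?W {} (\<lambda>x. emb (if s = s' then cpx x else inverse (cpx x)) i)"
    using 2 unfolding crat_alg_def emb_def
    by (cases "i = 0"; cases "i = 1") (auto intro: rat_alg.const)
  show "Ck_on (mdim disc) \<infinity> (cmap c ` (cdom c \<inter> cdom d)) (\<lambda>x. cmap d (cinv c x) i)"
    unfolding disc_simps c transition_dom[OF s]
  proof (rule Ck_on_rat_alg[OF 1 3])
    show "{x \<in> half_space 2. cpx x \<in> (if s = s' then UNIV else - {0})} \<subseteq> ?W"
      by (auto simp: half_space_def)
  qed (use transition_eq[OF s] in simp)
qed simp

lemma disc_compact: "compact_space (mtop disc)"
  by (simp add: compact_space_subtopology compactin_euclidean_iff compact_continuous_image continuous_on_emb)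


section \<open>Tangent vectors of the disc\<close>

definition ax :: "nat \<Rightarrow> complex"
  where "ax i = (if i = 0 then 1 else \<i>)"

text \<open>A one-sided derivative is unique as soon as the parameter is a limit point of the slice,
  so it agrees with the derivative of any extension \<open>h\<close> that is differentiable at the
  point. The second form of \<open>S\<close> is the boundary face, on which the normal field will be
  differentiated.\<close>

lemma pderiv_plane:
  assumes x: "x \<in> half_space 2" "cpx x \<in> O'" "open O'" and i: "i < 2"
    and S: "S = {x \<in> half_space 2. cpx x \<in> O'} \<or> i = 1 \<and> S = {x \<in> half_space 2. x 0 = 0} \<and> x 0 = 0"
    and f: "\<And>y. y \<in> S \<Longrightarrow> f y = h (cpx y)"
    and h: "(h has_derivative h') (at (cpx x))"
  shows "pderiv S i f x = h' (ax i)"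
proof -
  have xS: "x \<in> S" using x S by auto
  have upd: "cpx (x(i := t)) = cpx x + of_real (t - x i) * ax i" for t
    using i by (auto simp: complex_eq_iff ax_def less_2_cases_iff)
  have "((\<lambda>t. cpx x + of_real (t - x i) * ax i) has_derivative (\<lambda>t. of_real t * ax i)) (at (x i))"
    by (auto intro!: derivative_eq_intros)
  then have "((\<lambda>t. cpx (x(i := t))) has_derivative (\<lambda>t. of_real t * ax i)) (at (x i))"
    unfolding upd .
  moreover have "(h has_derivative h') (at (cpx (x(i := x i))))" using h by simp
  ultimately have "((\<lambda>t. h (cpx (x(i := t)))) has_derivative (\<lambda>t. h' (of_real t * ax i))) (at (x i))"
    by (rule has_derivative_compose)
  moreover have "h' (of_real t * ax i) = t * h' (ax i)" for t
    using linear_cmul[OF has_derivative_linear[OF h], of t] by (simp add: scaleR_conv_of_real)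
  ultimately have 1: "((\<lambda>t. h (cpx (x(i := t)))) has_vector_derivative h' (ax i)) (at (x i) within {t. x(i := t) \<in> S})"
    by (auto simp: has_vector_derivative_def intro: has_derivative_at_withinI)
  have 2: "((\<lambda>t. f (x(i := t))) has_vector_derivative h' (ax i)) (at (x i) within {t. x(i := t) \<in> S})"
    by (rule has_vector_derivative_transform[OF _ _ 1]) (use xS f in auto)
  \<comment> \<open>Increasing a coordinate never leaves the half-plane, and on the face only
    coordinate 1 is varied; hence the slice contains an interval to the right of
    \<open>x i\<close>.\<close>
  have "\<exists>d>0. {x i<..<x i + d} \<subseteq> {t. x(i := t) \<in> S}"
  proof -
    have hs: "x(i := t) \<in> half_space 2" if "t \<ge> x i" for t
      using x(1) i that by (auto simp: half_space_def plane_eq)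
    obtain e where e: "e > 0" "ball (cpx x) e \<subseteq> O'" using x(2,3) openE by blast
    have "cpx (x(i := t)) \<in> O'" if "t \<in> {x i<..<x i + e}" for t
    proof -
      have "dist (cpx x) (cpx (x(i := t))) = \<bar>t - x i\<bar>"
        unfolding upd dist_norm by (simp add: norm_mult ax_def flip: of_real_diff)
      then show ?thesis using e(2) that by (auto simp: subset_iff)
    qed
    then show ?thesis using e(1) hs S by (intro exI[of _ e]) auto
  qed
  then have "x i islimpt {t. x(i := t) \<in> S}"
    by (metis islimpt_subset islimpt_greaterThanLessThan1 less_add_same_cancel1)
  then have "at (x i) within {t. x(i := t) \<in> S} \<noteq> bot"
    by (simp add: trivial_limit_within)
  then show ?thesis unfolding pderiv_def using 2 by (rule vector_derivative_within)
qed

text \<open>The complex derivative of the parametrisation w -> s cay w, taken at the chart point of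
  \<open>z\<close> but written in terms of \<open>z\<close>. Multiplication by it turns components
  in the chart \<open>s\<close> into directions in the disc.\<close>

definition scal :: "real \<Rightarrow> complex \<Rightarrow> complex"
  where "scal s z = - of_real s * (1 + of_real s * z)\<^sup>2 / 2"

lemma scal_nonzero: "s \<in> sgns \<Longrightarrow> z \<noteq> - of_real s \<Longrightarrow> scal s z \<noteq> 0"
  using sgn_mult_neq[of s z] one_plus_neq_0_iff[of "of_real s * z"] by (auto simp: scal_def)

lemma param_has_field_derivative:
  assumes "s \<in> sgns" "z \<noteq> - of_real s"
  shows "((\<lambda>w. of_real s * cay w) has_field_derivative scal s z) (at (cay (of_real s * z)))"
proof -
  have *: "of_real s * z \<noteq> -1" using sgn_mult_neq[OF assms] .
  have nz: "1 + cay (of_real s * z) \<noteq> 0" using cay_neq[OF *] one_plus_neq_0_iff by blast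
  have cay: "(cay has_field_derivative - 2 / (1 + w)\<^sup>2) (at w)" if "1 + w \<noteq> 0" for w
  proof -
    have "((\<lambda>w. (1 - w) / (1 + w)) has_field_derivative
        ((- 1) * (1 + w) - (1 - w) * 1) / ((1 + w) * (1 + w))) (at w)"
      using that by (intro DERIV_divide) (auto intro!: derivative_eq_intros)
    moreover have "(- 1) * (1 + w) - (1 - w) * 1 = -2" by simp
    ultimately show ?thesis unfolding cay_def[abs_def] by (simp only: power2_eq_square)
  qed
  have "((\<lambda>w. of_real s * cay w) has_field_derivative
      of_real s * (- 2 / (1 + cay (of_real s * z))\<^sup>2)) (at (cay (of_real s * z)))"
    by (rule DERIV_cmult[OF cay[OF nz]])
  moreover have "of_real s * (- 2 / (1 + cay (of_real s * z))\<^sup>2) = scal s z"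
    unfolding one_plus_cay[OF *] by (simp add: scal_def power2_eq_square)
  ultimately show ?thesis by simp
qed

text \<open>The chain rule through the holomorphic parametrisation. It reduces each chart derivative
  to an ordinary derivative in the disc coordinate, of any extension \<open>h\<close> beyond the
  disc.\<close>

lemma pderiv_chart:
  assumes s: "s \<in> sgns" "z \<noteq> - of_real s" "z \<in> cball 0 1" and i: "i < 2"
    and f: "\<And>y. y \<in> cball 0 1 \<Longrightarrow> y \<noteq> - of_real s \<Longrightarrow> f (emb y) = h y"
    and h: "(h has_derivative h') (at z)"
  shows "pderiv (cimg (hchart s)) i (\<lambda>x. f (cinv (hchart s) x)) (cmap (hchart s) (emb z)) =
    h' (scal s z * ax i)"
proof (rule pderiv_plane[where h = "\<lambda>w. h (of_real s * cay w)" and O' = UNIV])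
  show "cmap (hchart s) (emb z) \<in> half_space 2" by (rule cmap_in_half_space[OF s(1,3,2)])
  show "f (cinv (hchart s) y) = h (of_real s * cay (cpx y))" if "y \<in> cimg (hchart s)" for y
    using that s f chart_point(1,2)[OF s(1)] by (simp add: cimg_hchart cinv_hchart)
  have "((\<lambda>w. of_real s * cay w) has_derivative (\<lambda>k. scal s z * k)) (at (cay (of_real s * z)))"
    using param_has_field_derivative[OF s(1,2)] by (simp add: has_field_derivative_def)
  moreover have "(h has_derivative h') (at (of_real s * cay (cay (of_real s * z))))"
    using h sgn_mult_neq[OF s(1,2)] s(1) by simp
  ultimately show "((\<lambda>w. h (of_real s * cay w)) has_derivative (\<lambda>k. h' (scal s z * k)))
     (at (cpx (cmap (hchart s) (emb z))))"
    unfolding cmap_hchart cpx_emb by (rule has_derivative_compose)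
qed (use i s in \<open>auto simp: cimg_hchart\<close>)

lemma sum_less_2: "(\<Sum>i<2. f i) = f 0 + f (1::nat)"
  by (simp add: numeral_2_eq_2)

text \<open>Transition maps are holomorphic, so their real Jacobians are multiplications by complex
  numbers; by the chain rule the number is the quotient of the derivatives of the two
  parametrisations.\<close>

lemma jacobian_disc:
  assumes s: "s \<in> sgns" "z \<noteq> - of_real s" and s': "s' \<in> sgns" "z \<noteq> - of_real s'"
    and z: "z \<in> cball 0 1"
  shows "jacobian disc (hchart s) (hchart s') (emb z) w = emb (scal s z / scal s' z * cpx w)"
proof -
  define T where "T u = (if s = s' then u else inverse u)" for u :: complex
  define w0 where "w0 = cay (of_real s * z)"
  have w0: "cmap (hchart s) (emb z) = emb w0" by (simp add: cmap_hchart w0_def)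
  have nz: "1 + of_real s * z \<noteq> 0" using sgn_mult_neq[OF s] one_plus_neq_0_iff by blast
  have nz': "w0 \<noteq> 0" "1 - of_real s * z \<noteq> 0" "scal s z / scal s' z = - inverse (w0\<^sup>2)" if "s \<noteq> s'"
  proof -
    have "s' = - s" using that s(1) s'(1) by auto
    then show *: "1 - of_real s * z \<noteq> 0"
      using sgn_mult_neq[OF s'] one_plus_neq_0_iff[of "of_real s' * z"] by simp
    then show "w0 \<noteq> 0" using nz by (simp add: w0_def cay_def)
    show "scal s z / scal s' z = - inverse (w0\<^sup>2)"
      using * nz s(1) \<open>s' = - s\<close> by (auto simp: w0_def cay_def scal_def power_divide)
  qed
  have T': "(T has_field_derivative scal s z / scal s' z) (at w0)"
  proof (cases "s = s'")
    case True
    then show ?thesis using scal_nonzero[OF s] by (simp add: T_def[abs_def])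
  next
    case False
    then show ?thesis using nz'[OF False] unfolding T_def
      by (auto intro!: derivative_eq_intros simp: power2_eq_square)
  qed
  have *: "pderiv (cmap (hchart s) ` (cdom (hchart s) \<inter> cdom (hchart s'))) j
      (\<lambda>x. cmap (hchart s') (cinv (hchart s) x) i) (cmap (hchart s) (emb z)) =
      emb (scal s z / scal s' z * ax j) i" if "i < 2" "j < 2" for i j
    unfolding w0
  proof (rule pderiv_plane[where h = "\<lambda>u. emb (T u) i" and O' = "if s = s' then UNIV else - {0}"])
    show "emb w0 \<in> half_space 2" using cmap_in_half_space[OF s(1) z s(2)] w0 by simp
    show "cmap (hchart s') (cinv (hchart s) y) i = emb (T (cpx y)) i"
      if "y \<in> cmap (hchart s) ` (cdom (hchart s) \<inter> cdom (hchart s'))" for y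
      using that unfolding transition_dom[OF s(1) s'(1)] T_def
      by (simp add: transition_eq[OF s(1) s'(1)])
    show "((\<lambda>u. emb (T u) i) has_derivative (\<lambda>k. emb (scal s z / scal s' z * k) i)) (at (cpx (emb w0)))"
    proof -
      have d: "(T has_derivative (\<lambda>k. scal s z / scal s' z * k)) (at w0)"
        using T' unfolding has_field_derivative_def .
      show ?thesis
        using has_derivative_Re[OF d] has_derivative_Im[OF d] that
        by (cases "i = 0") (simp_all add: emb_def cpx_emb[unfolded emb_def])
    qed
  qed (use that nz' transition_dom[OF s(1) s'(1)] in auto)
  have lin: "emb (a * ax 0) i * w 0 + emb (a * ax 1) i * w 1 = emb (a * cpx w) i" for a i
    by (auto simp: emb_def ax_def)
  have "jacobian disc (hchart s) (hchart s') (emb z) w i = emb (scal s z / scal s' z * cpx w) i" for i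
  proof (cases "i < 2")
    case True
    then have "jacobian disc (hchart s) (hchart s') (emb z) w i =
        (\<Sum>j<2. emb (scal s z / scal s' z * ax j) i * w j)"
      by (simp add: jacobian_def * del: times_divide_eq_left)
    then show ?thesis by (simp only: sum_less_2 lin)
  qed (simp add: jacobian_def emb_ge2)
  then show ?thesis by blast
qed

text \<open>The tangent vector with direction \<open>\<zeta>\<close> in the disc coordinate, which
  itself does not belong to the atlas. The inner \<open>if\<close> reads the sign off the
  chart.\<close>

definition tv :: "complex \<Rightarrow> complex \<Rightarrow> (nat \<Rightarrow> real) tvec"
  where "tv z \<zeta> = (\<lambda>c. if c \<in> charts_at disc (emb z)
    then emb (\<zeta> / scal (if c = hchart 1 then 1 else -1) z) else (\<lambda>_. 0))"

lemma tv_hchart: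
  assumes "s \<in> sgns" "z \<noteq> - of_real s" "z \<in> cball 0 1"
  shows "tv z \<zeta> (hchart s) = emb (\<zeta> / scal s z)"
  using assms charts_at_disc[OF assms(3)] hchart_eq_iff[of "-1" 1] by (auto simp: tv_def)

lemma tv_outside: "c \<notin> charts_at disc (emb z) \<Longrightarrow> tv z \<zeta> c = (\<lambda>_. 0)"
  by (simp add: tv_def)

lemma charts_at_cases:
  assumes "c \<in> charts_at disc (emb z)" "z \<in> cball 0 1"
  obtains s where "s \<in> sgns" "z \<noteq> - of_real s" "c = hchart s"
  using assms charts_at_disc[OF assms(2)] by blast

lemma hchart_in_charts_at:
  "s \<in> sgns \<Longrightarrow> z \<noteq> - of_real s \<Longrightarrow> z \<in> cball 0 1 \<Longrightarrow> hchart s \<in> charts_at disc (emb z)"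
  using charts_at_disc by blast

lemma tvec_of_disc:
  assumes s: "s \<in> sgns" "z \<noteq> - of_real s" and z: "z \<in> cball 0 1"
  shows "tvec_of disc (hchart s) (emb z) w = tv z (scal s z * cpx w)"
proof
  fix d show "tvec_of disc (hchart s) (emb z) w d = tv z (scal s z * cpx w) d"
  proof (cases "d \<in> charts_at disc (emb z)")
    case True
    then obtain s' where s': "s' \<in> sgns" "z \<noteq> - of_real s'" "d = hchart s'"
      using charts_at_cases z by blast
    then show ?thesis
      using True by (simp add: tvec_of_def jacobian_disc[OF s s'(1,2) z] tv_hchart[OF s'(1,2) z])
  qed (simp add: tvec_of_def tv_outside)
qed

lemma coord_vec_disc:
  assumes "s \<in> sgns" "z \<noteq> - of_real s" "z \<in> cball 0 1" "i < 2"
  shows "coord_vec disc (hchart s) (emb z) i = tv z (scal s z * ax i)"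
proof -
  have "cpx (\<lambda>j. if j = i then 1 else 0) = ax i"
    using assms(4) by (auto simp: complex_eq_iff ax_def less_2_cases_iff)
  then show ?thesis unfolding coord_vec_def by (simp add: tvec_of_disc[OF assms(1-3)])
qed

lemma tangent_space_disc:
  assumes z: "z \<in> cball 0 1"
  shows "tangent_space disc (emb z) = range (tv z)"
proof
  show "tangent_space disc (emb z) \<subseteq> range (tv z)"
  proof
    fix v assume v: "v \<in> tangent_space disc (emb z)"
    obtain s where s: "s \<in> sgns" "z \<noteq> - of_real s" using chart_at_disc[OF z] by blast
    have "v d = tvec_of disc (hchart s) (emb z) (v (hchart s)) d" for d
    proof (cases "d \<in> charts_at disc (emb z)")
      case True
      then have "v d = jacobian disc (hchart s) d (emb z) (v (hchart s))"
        using v hchart_in_charts_at[OF s z] unfolding tangent_space_def by blast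
      then show ?thesis using True by (simp add: tvec_of_def)
    next
      case False
      then have "v d = (\<lambda>_. 0)" using v unfolding tangent_space_def by blast
      then show ?thesis using False by (simp add: tvec_of_def)
    qed
    then have "v = tvec_of disc (hchart s) (emb z) (v (hchart s))" ..
    then show "v \<in> range (tv z)" using tvec_of_disc[OF s z] by (metis rangeI)
  qed
  have "tv z \<zeta> d = jacobian disc c d (emb z) (tv z \<zeta> c)"
    if cd: "c \<in> charts_at disc (emb z)" "d \<in> charts_at disc (emb z)" for \<zeta> c d
  proof -
    obtain s where s: "s \<in> sgns" "z \<noteq> - of_real s" "c = hchart s"
      using charts_at_cases[OF cd(1) z] by blast
    obtain s' where s': "s' \<in> sgns" "z \<noteq> - of_real s'" "d = hchart s'"
      using charts_at_cases[OF cd(2) z] by blast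
    show ?thesis
      using scal_nonzero[OF s(1,2)]
      by (simp add: s(3) s'(3) jacobian_disc[OF s(1,2) s'(1,2) z] tv_hchart[OF s(1,2) z]
          tv_hchart[OF s'(1,2) z])
  qed
  then show "range (tv z) \<subseteq> tangent_space disc (emb z)"
    unfolding tangent_space_def using tv_outside by blast
qed

lemma tv_eq_iff [simp]:
  assumes "z \<in> cball 0 1"
  shows "tv z \<zeta> = tv z \<xi> \<longleftrightarrow> \<zeta> = \<xi>"
proof
  assume eq: "tv z \<zeta> = tv z \<xi>"
  obtain s where s: "s \<in> sgns" "z \<noteq> - of_real s" using chart_at_disc[OF assms] by blast
  then show "\<zeta> = \<xi>"
    using fun_cong[OF eq, of "hchart s"] scal_nonzero[OF s] by (simp add: tv_hchart[OF s assms])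
qed simp

lemma tv_lincomb:
  "(\<lambda>c i. a * tv z \<zeta> c i + b * tv z \<xi> c i) = tv z (of_real a * \<zeta> + of_real b * \<xi>)"
proof -
  have *: "(\<lambda>i. a * emb u i + b * emb v i) = emb (of_real a * u + of_real b * v)" for u v
    by (auto simp: emb_def)
  show ?thesis by (rule ext) (auto simp: tv_def * add_divide_distrib)
qed

lemma tv_0: "tv z 0 = (\<lambda>_ _. 0)"
  by (auto simp: tv_def emb_zero)

lemma tv_scale: "(\<lambda>c i. a * tv z \<zeta> c i) = tv z (of_real a * \<zeta>)"
  using tv_lincomb[of a z \<zeta> 0 0] by simp

lemma tv_diff: "(\<lambda>c i. tv z \<zeta> c i - tv z \<xi> c i) = tv z (\<zeta> - \<xi>)"
  using tv_lincomb[of 1 z \<zeta> "-1" \<xi>] by simp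

definition tc :: "complex \<Rightarrow> (nat \<Rightarrow> real) tvec \<Rightarrow> complex"
  where "tc z v = (THE \<zeta>. v = tv z \<zeta>)"

lemma tc_tv [simp]: "z \<in> cball 0 1 \<Longrightarrow> tc z (tv z \<zeta>) = \<zeta>"
  unfolding tc_def by (rule the_equality) auto

lemma linear_complex_components:
  assumes "linear h" "h 1 = a" "h \<i> = b"
  shows "h x = Re x * a + Im x * (b :: real)"
proof -
  have "x = Re x *\<^sub>R 1 + Im x *\<^sub>R \<i>" by (simp add: complex_eq_iff)
  then have "h x = h (Re x *\<^sub>R 1 + Im x *\<^sub>R \<i>)" by (rule arg_cong)
  then show ?thesis using assms by (simp add: linear_add linear_cmul)
qed

lemma differential_disc:
  assumes z: "z \<in> cball 0 1" and f: "\<And>y. y \<in> cball 0 1 \<Longrightarrow> f (emb y) = h y"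
    and h: "(h has_derivative h') (at z)"
  shows "differential disc f (emb z) (tv z \<zeta>) = h' \<zeta>"
proof -
  obtain s where s: "s \<in> sgns" "z \<noteq> - of_real s" and c: "chart_at disc (emb z) = hchart s"
    using chart_at_disc[OF z] by blast
  define u where "u = \<zeta> / scal s z"
  have p: "pderiv (cimg (hchart s)) i (\<lambda>x. f (cinv (hchart s) x)) (cmap (hchart s) (emb z)) =
    h' (scal s z * ax i)" if "i < 2" for i
    using pderiv_chart[OF s z that _ h, of f] f by blast
  have "linear (\<lambda>k. h' (scal s z * k))"
    using has_derivative_linear[OF h] by (intro linear_compose[unfolded o_def, of "\<lambda>k. scal s z * k" h'])
      (auto intro: bounded_linear.linear bounded_linear_mult_right)
  from linear_complex_components[OF this refl refl, of u]
  have "h' (scal s z * u) = (\<Sum>i<2. h' (scal s z * ax i) * emb u i)"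
    by (simp add: sum_less_2 ax_def mult.commute)
  then show ?thesis
    using p scal_nonzero[OF s] unfolding differential_def c Let_def
    by (simp add: u_def tv_hchart[OF s z] sum_less_2)
qed

lemma ext_deriv_zero:
  assumes z: "z \<in> cball 0 1"
  shows "ext_deriv disc (\<lambda>_ _. 0) (emb z) \<xi> \<eta> = 0"
proof -
  obtain s where s: "s \<in> sgns" "z \<noteq> - of_real s" and c: "chart_at disc (emb z) = hchart s"
    using chart_at_disc[OF z] by blast
  have "pderiv (cimg (hchart s)) i (\<lambda>x. 0) (cmap (hchart s) (emb z)) = 0" if "i < 2" for i
    using pderiv_chart[OF s z that, of "\<lambda>_. 0" "\<lambda>_. 0" "\<lambda>_. 0"] by simp
  then show ?thesis by (simp add: ext_deriv_def c Let_def)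
qed


section \<open>The systems\<close>

definition lam :: "real \<Rightarrow> complex \<Rightarrow> real"
  where "lam \<epsilon> z = (1 - \<epsilon>) + \<epsilon> * (cmod z)\<^sup>2"

definition met :: "real \<Rightarrow> (nat \<Rightarrow> real) two_tensor"
  where "met \<epsilon> p v w = lam \<epsilon> (cpx p) * (tc (cpx p) v \<bullet> tc (cpx p) w)"

definition pot :: "real \<Rightarrow> (nat \<Rightarrow> real) \<Rightarrow> real"
  where "pot \<epsilon> p = 1/2 - 1 / (2 * lam \<epsilon> (cpx p))"

abbreviation zform :: "(nat \<Rightarrow> real) one_form"
  where "zform \<equiv> (\<lambda>_ _. 0)"

lemma lam_inner: "lam \<epsilon> z = (1 - \<epsilon>) + \<epsilon> * (z \<bullet> z)"
  by (simp add: lam_def power2_norm_eq_inner)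

lemma lam_has_derivative: "(lam \<epsilon> has_derivative (\<lambda>h. (2 * \<epsilon>) *\<^sub>R z \<bullet> h)) (at z within S)"
  unfolding lam_inner[abs_def] by (auto intro!: derivative_eq_intros simp: inner_commute)

lemma lam_boundary: "cmod z = 1 \<Longrightarrow> lam \<epsilon> z = 1"
  by (simp add: lam_def)

lemma met_tv [simp]: "z \<in> cball 0 1 \<Longrightarrow> met \<epsilon> (emb z) (tv z \<zeta>) (tv z \<xi>) = lam \<epsilon> z * (\<zeta> \<bullet> \<xi>)"
  by (simp add: met_def)

lemma inner_mult_complex: "(\<sigma> * a) \<bullet> (\<sigma> * b) = (cmod \<sigma>)\<^sup>2 * (a \<bullet> b)"
proof -
  have "(\<sigma> * a) \<bullet> (\<sigma> * b) = ((Re \<sigma>)\<^sup>2 + (Im \<sigma>)\<^sup>2) * (a \<bullet> b)"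
    by (simp add: inner_complex_def) algebra
  then show ?thesis by (simp only: cmod_power2)
qed

text \<open>One locale serves both systems: the parameter will be 0 and 1/2. The upper bound keeps
  \<open>lam \<epsilon>\<close> at least 1/2 on the whole plane.\<close>

locale conformal =
  fixes \<epsilon> :: real
  assumes eps: "0 \<le> \<epsilon>" "\<epsilon> \<le> 1/2"
begin

lemma lam_pos: "0 < lam \<epsilon> z"
  using eps by (simp add: lam_def add_pos_nonneg)

lemma lam_nonzero: "lam \<epsilon> z \<noteq> 0"
  using lam_pos[of z] by simp

lemma sharp_disc:
  assumes z: "z \<in> cball 0 1" and \<omega>: "\<And>\<eta>. \<omega> (tv z \<eta>) = lam \<epsilon> z * (\<zeta> \<bullet> \<eta>)"
  shows "sharp disc (met \<epsilon>) (emb z) \<omega> = tv z \<zeta>"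
  unfolding sharp_def
proof (rule the_equality)
  show "tv z \<zeta> \<in> tangent_space disc (emb z) \<and>
      (\<forall>\<eta>\<in>tangent_space disc (emb z). met \<epsilon> (emb z) (tv z \<zeta>) \<eta> = \<omega> \<eta>)"
    using z \<omega> by (auto simp: tangent_space_disc[OF z])
next
  fix w assume w: "w \<in> tangent_space disc (emb z) \<and>
      (\<forall>\<eta>\<in>tangent_space disc (emb z). met \<epsilon> (emb z) w \<eta> = \<omega> \<eta>)"
  then obtain \<xi> where \<xi>: "w = tv z \<xi>" by (auto simp: tangent_space_disc[OF z])
  have "lam \<epsilon> z * (\<xi> \<bullet> \<eta>) = lam \<epsilon> z * (\<zeta> \<bullet> \<eta>)" for \<eta>
    using w z by (auto simp: tangent_space_disc[OF z] \<xi> simp flip: \<omega>)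
  then have "\<xi> \<bullet> \<eta> = \<zeta> \<bullet> \<eta>" for \<eta> using lam_nonzero[of z] by simp
  then show "w = tv z \<zeta>" using vector_eq_rdot[of \<xi> \<zeta>] \<xi> by simp
qed

lemma riemannian_metric_disc: "riemannian_metric disc (met \<epsilon>)"
  unfolding riemannian_metric_def
proof (intro conjI ballI allI impI)
  fix p v assume "p \<in> points disc" and v: "v \<in> tangent_space disc p"
  then obtain z where z: "z \<in> cball 0 1" and p: "p = emb z" by auto
  obtain \<zeta> where \<zeta>: "v = tv z \<zeta>" using v unfolding p tangent_space_disc[OF z] by blast
  show "tlinear disc p (met \<epsilon> p v)"
    unfolding tlinear_def p tangent_space_disc[OF z] \<zeta>
    using z by (auto simp: tv_lincomb inner_add_right ring_distribs simp flip: scaleR_conv_of_real)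
  show "met \<epsilon> p v w = met \<epsilon> p w v" for w
    by (simp add: met_def inner_commute)
  show "0 < met \<epsilon> p v v" if "v \<noteq> (\<lambda>_ _. 0)"
    using that z lam_pos[of z] tv_0[of z] by (cases "\<zeta> = 0") (auto simp: p \<zeta>)
next
  fix c i j assume "c \<in> atlas disc" and ij: "i < mdim disc" "j < mdim disc"
  then obtain s where s: "s \<in> sgns" and c: "c = hchart s" by auto
  let ?W = "{x \<in> plane. cpx x \<in> - {-1}}"
  let ?z = "\<lambda>x. of_real s * cay (cpx x)"
  have 1: "derivation_closed 2 ?W {}"
    by (intro derivation_closed_empty openin_plane_vimage) auto
  have z: "crat_alg ?W {} ?z"
    unfolding cay_def by (intro crat_alg_intros) (auto simp: one_plus_neq_0_iff)
  have e: "crat_alg ?W {} (\<lambda>x. scal s (?z x) * ax i)" for i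
    unfolding scal_def power2_eq_square minus_mult_left[symmetric]
    by (intro crat_alg_mult crat_alg_divide crat_alg_const crat_alg_add z crat_alg_diff
        crat_alg_uminus) auto
  have 3: "rat_alg ?W {} (\<lambda>x. lam \<epsilon> (?z x) * ((scal s (?z x) * ax i) \<bullet> (scal s (?z x) * ax j)))"
    unfolding lam_def inner_complex_def
    by (intro rat_alg.mult rat_alg.add rat_alg.const crat_alg_norm2 z e crat_alg_Re crat_alg_Im)
  show "Ck_on (mdim disc) \<infinity> (cimg c)
         (\<lambda>x. met \<epsilon> (cinv c x) (coord_vec disc c (cinv c x) i) (coord_vec disc c (cinv c x) j))"
    unfolding disc_simps c cimg_hchart[OF s]
  proof (rule Ck_on_rat_alg[OF 1 3])
    show "half_space 2 \<subseteq> ?W" using chart_point(4,5)[OF s] by auto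
    show "met \<epsilon> (cinv (hchart s) x) (coord_vec disc (hchart s) (cinv (hchart s) x) i)
        (coord_vec disc (hchart s) (cinv (hchart s) x) j) =
      lam \<epsilon> (?z x) * ((scal s (?z x) * ax i) \<bullet> (scal s (?z x) * ax j))" if x: "x \<in> half_space 2" for x
      using chart_point(1,2)[OF s x] ij
      by (simp add: cinv_hchart[OF s x] coord_vec_disc[OF s] del: mem_cball_0)
  qed
qed

lemma mp_system_disc: "mp_system disc (met \<epsilon>) zform (pot \<epsilon>)"
  unfolding mp_system_def
proof (intro conjI)
  show "riemannian_metric disc (met \<epsilon>)" by (rule riemannian_metric_disc)
  have 0: "derivation_closed 2 plane {}"
    by (rule derivation_closed_empty) simp
  show "smooth_one_form disc zform"
    unfolding smooth_one_form_def
    by (auto simp: tlinear_def cimg_hchart half_space_def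
        intro!: Ck_on_rat_alg[OF 0 rat_alg.const[of _ _ 0]])
  let ?W = "{x \<in> plane. cpx x \<in> - {-1}}"
  have 1: "derivation_closed 2 ?W {}"
    by (intro derivation_closed_empty openin_plane_vimage) auto
  show "smooth_fun disc (pot \<epsilon>)"
    unfolding smooth_fun_def
  proof
    fix c assume "c \<in> atlas disc"
    then obtain s where s: "s \<in> sgns" and c: "c = hchart s" by auto
    let ?z = "\<lambda>x. of_real s * cay (cpx x)"
    have z: "crat_alg ?W {} ?z"
      unfolding cay_def by (intro crat_alg_intros) (auto simp: one_plus_neq_0_iff)
    have l: "rat_alg ?W {} (\<lambda>x. lam \<epsilon> (?z x))"
      unfolding lam_def by (intro rat_alg.mult rat_alg.add rat_alg.const crat_alg_norm2 z)
    have 3: "rat_alg ?W {} (\<lambda>x. 1/2 - 1 / (2 * lam \<epsilon> (?z x)))"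
      by (intro rat_alg_diff rat_alg_divide rat_alg.const rat_alg.mult l) (simp add: lam_nonzero)
    show "Ck_on (mdim disc) \<infinity> (cimg c) (\<lambda>x. pot \<epsilon> (cinv c x))"
      unfolding disc_simps c cimg_hchart[OF s]
      by (rule Ck_on_rat_alg[OF 1 3]) (use chart_point(4,5)[OF s] cinv_hchart[OF s] in \<open>auto simp: pot_def\<close>)
  qed
qed

lemma pot_differential:
  assumes z: "z \<in> cball 0 1"
  shows "differential disc (pot \<epsilon>) (emb z) (tv z \<zeta>) = (\<epsilon> / (lam \<epsilon> z)\<^sup>2) *\<^sub>R z \<bullet> \<zeta>"
proof (rule differential_disc[OF z, where h = "\<lambda>y. 1/2 - 1 / (2 * lam \<epsilon> y)"])
  show "((\<lambda>y. 1/2 - 1 / (2 * lam \<epsilon> y)) has_derivative (\<lambda>\<zeta>. (\<epsilon> / (lam \<epsilon> z)\<^sup>2) *\<^sub>R z \<bullet> \<zeta>)) (at z)"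
  proof -
    have "((\<lambda>y. 1/2 - (1/2) * inverse (lam \<epsilon> y)) has_derivative
        (\<lambda>h. - ((1/2) * - (inverse (lam \<epsilon> z) * ((2 * \<epsilon>) *\<^sub>R z \<bullet> h) * inverse (lam \<epsilon> z))))) (at z)"
      by (auto intro!: derivative_eq_intros lam_has_derivative lam_nonzero)
    moreover have "1/2 - (1/2) * inverse (lam \<epsilon> y) = 1/2 - 1 / (2 * lam \<epsilon> y)" for y
      by (simp add: inverse_eq_divide)
    moreover have "- ((1/2) * - (inverse (lam \<epsilon> z) * ((2 * \<epsilon>) *\<^sub>R z \<bullet> h) * inverse (lam \<epsilon> z))) =
        (\<epsilon> / (lam \<epsilon> z)\<^sup>2) *\<^sub>R z \<bullet> h" for h
      by (simp add: inverse_eq_divide power2_eq_square)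
    ultimately show ?thesis by (simp only:)
  qed
qed (simp add: pot_def)

lemma grad_pot:
  assumes z: "z \<in> cball 0 1"
  shows "grad disc (met \<epsilon>) (pot \<epsilon>) (emb z) = tv z ((\<epsilon> / (lam \<epsilon> z) ^ 3) *\<^sub>R z)"
  unfolding grad_def
  by (rule sharp_disc[OF z])
    (use lam_nonzero[of z] in \<open>simp add: pot_differential[OF z] power2_eq_square power3_eq_cube\<close>)

lemma lorentz_zero:
  assumes z: "z \<in> cball 0 1"
  shows "lorentz_force disc (met \<epsilon>) zform (emb z) \<xi> = tv z 0"
  unfolding lorentz_force_def
  by (rule sharp_disc[OF z]) (simp add: ext_deriv_zero[OF z])

text \<open>The gradient of the logarithm of the conformal factor in the chart \<open>s\<close>, seen in the disc.\<close>

definition logd :: "real \<Rightarrow> complex \<Rightarrow> complex"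
  where "logd s z = (2 * \<epsilon> / lam \<epsilon> z) *\<^sub>R z + 4 *\<^sub>R cnj (of_real s / (1 + of_real s * z))"

lemma metric_coeff_disc:
  assumes s: "s \<in> sgns" "z \<noteq> - of_real s" and z: "z \<in> cball 0 1" and ij: "i < 2" "j < 2"
  shows "metric_coeff disc (met \<epsilon>) (hchart s) i j (cmap (hchart s) (emb z)) =
    (if i = j then lam \<epsilon> z * (cmod (scal s z))\<^sup>2 else 0)"
proof -
  have "(scal s z * ax i) \<bullet> (scal s z * ax j) = (if i = j then (cmod (scal s z))\<^sup>2 else 0)"
  proof (cases "i = j")
    case True
    then show ?thesis by (simp add: dot_square_norm norm_mult ax_def)
  next
    case False
    then show ?thesis using ij by (auto simp: ax_def less_2_cases_iff inner_complex_def)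
  qed
  then show ?thesis
    using assms by (simp add: metric_coeff_def cmap_hchart cinv_cmap coord_vec_disc)
qed

text \<open>In the chart the metric is \<mu> times the identity matrix with \<mu> =
  \<lambda>|scal|^2 = \<lambda>|1 + sz|^4/4. The derivative is written as \<mu> times the
  logarithmic derivative so that \<mu> cancels when an index is raised.\<close>

lemma metric_coeff_pderiv:
  assumes s: "s \<in> sgns" "z \<noteq> - of_real s" and z: "z \<in> cball 0 1" and ij: "i < 2" "j < 2" "l < 2"
  shows "pderiv (cimg (hchart s)) l (metric_coeff disc (met \<epsilon>) (hchart s) i j) (cmap (hchart s) (emb z)) =
    (if i = j then lam \<epsilon> z * (cmod (scal s z))\<^sup>2 * (logd s z \<bullet> (scal s z * ax l)) else 0)"
proof -
  define h where "h y = (if i = j then lam \<epsilon> y * (cmod (scal s y))\<^sup>2 else 0)" for y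
  have nz: "1 + of_real s * z \<noteq> 0" using sgn_mult_neq[OF s] one_plus_neq_0_iff by blast
  define u where "u = 1 + of_real s * z"
  have n: "(cmod (scal s y))\<^sup>2 = ((1 + of_real s * y) \<bullet> (1 + of_real s * y))\<^sup>2 / 4" for y
    using s(1) by (auto simp: scal_def norm_divide norm_mult norm_power power_divide
        simp flip: power2_norm_eq_inner)
  have D: "(h has_derivative (\<lambda>k. if i = j then lam \<epsilon> z * (cmod (scal s z))\<^sup>2 * (logd s z \<bullet> k) else 0)) (at z)"
  proof (cases "i = j")
    case True
    have uu: "u \<bullet> u \<noteq> 0" using nz by (simp add: u_def)
    have cn: "cnj (of_real s / u) \<bullet> k = (u \<bullet> (of_real s * k)) / (u \<bullet> u)" for k
    proof -
      have "cnj (of_real s / u) = of_real s * u / of_real (u \<bullet> u)"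
      proof -
        have "of_real (u \<bullet> u) = u * cnj u" "u \<noteq> 0"
          using nz complex_norm_square[of u] by (simp_all add: dot_square_norm u_def)
        then show ?thesis by simp
      qed
      then show ?thesis by (simp add: inner_complex_def algebra_simps add_divide_distrib)
    qed
    have D1: "((\<lambda>y. lam \<epsilon> y * (((1 + of_real s * y) \<bullet> (1 + of_real s * y))\<^sup>2 / 4)) has_derivative
        (\<lambda>k. lam \<epsilon> z * ((u \<bullet> u) * (u \<bullet> (of_real s * k))) + ((2 * \<epsilon>) *\<^sub>R z \<bullet> k) * ((u \<bullet> u)\<^sup>2 / 4))) (at z)"
      unfolding u_def
      by (auto intro!: derivative_eq_intros lam_has_derivative simp: inner_commute power2_eq_square)
    have e: "lam \<epsilon> z * ((u \<bullet> u) * (u \<bullet> (of_real s * k))) + ((2 * \<epsilon>) *\<^sub>R z \<bullet> k) * ((u \<bullet> u)\<^sup>2 / 4) =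
      lam \<epsilon> z * ((u \<bullet> u)\<^sup>2 / 4) * (logd s z \<bullet> k)" for k
    proof -
      have "logd s z \<bullet> k = (2 * \<epsilon> / lam \<epsilon> z) * (z \<bullet> k) + 4 * ((u \<bullet> (of_real s * k)) / (u \<bullet> u))"
        unfolding logd_def u_def[symmetric] inner_add_left cn[symmetric] by simp
      then show ?thesis
        using uu lam_nonzero[of z] by (simp add: field_simps power2_eq_square)
    qed
    show ?thesis using D1[unfolded e] True by (simp add: h_def[abs_def] n u_def)
  qed (simp add: h_def[abs_def])
  \<comment> \<open>\<open>metric_coeff\<close> takes chart coordinates, whereas
    \<open>pderiv_chart\<close> expects a function of points; the chart map is composed in here and
    removed below, where it cancels against \<open>cinv\<close> on the half-plane.\<close>
  define f where "f p = metric_coeff disc (met \<epsilon>) (hchart s) i j (cmap (hchart s) p)" for p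
  have "f (emb y) = h y" if "y \<in> cball 0 1" "y \<noteq> - of_real s" for y
    using metric_coeff_disc[OF s(1) that(2,1) ij(1,2)] by (simp add: f_def h_def)
  then have "pderiv (cimg (hchart s)) l (\<lambda>x. f (cinv (hchart s) x)) (cmap (hchart s) (emb z)) =
    (if i = j then lam \<epsilon> z * (cmod (scal s z))\<^sup>2 * (logd s z \<bullet> (scal s z * ax l)) else 0)"
    using pderiv_chart[OF s z ij(3) _ D, of f] by blast
  moreover have "pderiv (cimg (hchart s)) l (\<lambda>x. f (cinv (hchart s) x)) (cmap (hchart s) (emb z)) =
    pderiv (cimg (hchart s)) l (metric_coeff disc (met \<epsilon>) (hchart s) i j) (cmap (hchart s) (emb z))"
  proof -
    have "f (cinv (hchart s) x) = metric_coeff disc (met \<epsilon>) (hchart s) i j x"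
      if "x \<in> half_space 2" for x
      using chart_point(3,5)[OF s(1) that] by (simp add: f_def cinv_hchart[OF s(1) that] cmap_hchart)
    then have eq: "f (cinv (hchart s) ((cmap (hchart s) (emb z))(l := t))) =
        metric_coeff disc (met \<epsilon>) (hchart s) i j ((cmap (hchart s) (emb z))(l := t))"
      if "(cmap (hchart s) (emb z))(l := t) \<in> half_space 2" for t
      using that by blast
    show ?thesis
      unfolding pderiv_def cimg_hchart[OF s(1)]
      by (rule vector_derivative_cong_eq)
        (use eq cmap_in_half_space[OF s(1) z s(2)] in \<open>auto simp: eventually_at_filter\<close>)
  qed
  ultimately show ?thesis by simp
qed

lemma mult_if_zero: "(if P then a * b else 0) = a * (if P then b else (0 :: real))"
  by simp

text \<open>This is the classical formula for a conformally flat metric \<mu>|dw|^2: the symbols are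
  half of \<delta>_jk L_i + \<delta>_ik L_j - \<delta>_ij L_k, where L is the differential of log
  \<mu>. As \<open>christoffel\<close> raises the index by \<open>sharp\<close>, the proof exhibits
  the tangent vector that represents the covector.\<close>

lemma christoffel_disc:
  assumes s: "s \<in> sgns" "z \<noteq> - of_real s" and z: "z \<in> cball 0 1" and ij: "i < 2" "j < 2" "k < 2"
  shows "christoffel disc (met \<epsilon>) (hchart s) (emb z) k i j =
    ((if j = k then logd s z \<bullet> (scal s z * ax i) else 0) + (if i = k then logd s z \<bullet> (scal s z * ax j) else 0) -
      (if i = j then logd s z \<bullet> (scal s z * ax k) else 0)) / 2"
proof -
  define a where "a l = ((if j = l then logd s z \<bullet> (scal s z * ax i) else 0) +
      (if i = l then logd s z \<bullet> (scal s z * ax j) else 0) -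
      (if i = j then logd s z \<bullet> (scal s z * ax l) else 0)) / 2" for l
  define \<mu> where "\<mu> = lam \<epsilon> z * (cmod (scal s z))\<^sup>2"
  note nz = scal_nonzero[OF s]
  let ?\<zeta> = "scal s z * Complex (a 0) (a 1)"
  have "sharp disc (met \<epsilon>) (emb z) (\<lambda>\<eta>. \<Sum>l<mdim disc. (1/2) *
      (pderiv (cimg (hchart s)) i (metric_coeff disc (met \<epsilon>) (hchart s) j l) (cmap (hchart s) (emb z))
     + pderiv (cimg (hchart s)) j (metric_coeff disc (met \<epsilon>) (hchart s) i l) (cmap (hchart s) (emb z))
     - pderiv (cimg (hchart s)) l (metric_coeff disc (met \<epsilon>) (hchart s) i j) (cmap (hchart s) (emb z))) *
      \<eta> (hchart s) l) = tv z ?\<zeta>"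
  proof (rule sharp_disc[OF z])
    fix \<eta>
    define u where "u = \<eta> / scal s z"
    have "(\<Sum>l<mdim disc. (1/2) *
      (pderiv (cimg (hchart s)) i (metric_coeff disc (met \<epsilon>) (hchart s) j l) (cmap (hchart s) (emb z))
     + pderiv (cimg (hchart s)) j (metric_coeff disc (met \<epsilon>) (hchart s) i l) (cmap (hchart s) (emb z))
     - pderiv (cimg (hchart s)) l (metric_coeff disc (met \<epsilon>) (hchart s) i j) (cmap (hchart s) (emb z))) *
      tv z \<eta> (hchart s) l) = (\<Sum>l<2. \<mu> * a l * emb u l)"
    proof (rule sum.cong)
      fix l assume "l \<in> {..<2 :: nat}"
      then have l: "l < 2" by simp
      define L where "L i = logd s z \<bullet> (scal s z * ax i)" for i
      have d: "pderiv (cimg (hchart s)) l' (metric_coeff disc (met \<epsilon>) (hchart s) i' j') (cmap (hchart s) (emb z)) =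
          \<mu> * (if i' = j' then L l' else 0)" if "i' < 2" "j' < 2" "l' < 2" for i' j' l'
        unfolding metric_coeff_pderiv[OF s z that] \<mu>_def L_def by (rule mult_if_zero)
      have "(1/2) * (\<mu> * A + \<mu> * B - \<mu> * C) = \<mu> * ((A + B - C) / 2)" for A B C
        by (simp add: algebra_simps)
      then show "(1/2) *
      (pderiv (cimg (hchart s)) i (metric_coeff disc (met \<epsilon>) (hchart s) j l) (cmap (hchart s) (emb z))
     + pderiv (cimg (hchart s)) j (metric_coeff disc (met \<epsilon>) (hchart s) i l) (cmap (hchart s) (emb z))
     - pderiv (cimg (hchart s)) l (metric_coeff disc (met \<epsilon>) (hchart s) i j) (cmap (hchart s) (emb z))) *
      tv z \<eta> (hchart s) l = \<mu> * a l * emb u l"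
        unfolding d[OF ij(2) l ij(1)] d[OF ij(1) l ij(2)] d[OF ij(1,2) l]
        by (simp only: tv_hchart[OF s z] u_def a_def L_def)
    qed simp
    also have "\<dots> = \<mu> * (Complex (a 0) (a 1) \<bullet> u)"
      by (simp add: sum_less_2 inner_complex_def distrib_left)
    also have "\<dots> = lam \<epsilon> z * (?\<zeta> \<bullet> (scal s z * u))"
      by (simp add: \<mu>_def inner_mult_complex)
    also have "scal s z * u = \<eta>" using nz by (simp add: u_def)
    finally show "(\<Sum>l<mdim disc. (1/2) *
      (pderiv (cimg (hchart s)) i (metric_coeff disc (met \<epsilon>) (hchart s) j l) (cmap (hchart s) (emb z))
     + pderiv (cimg (hchart s)) j (metric_coeff disc (met \<epsilon>) (hchart s) i l) (cmap (hchart s) (emb z))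
     - pderiv (cimg (hchart s)) l (metric_coeff disc (met \<epsilon>) (hchart s) i j) (cmap (hchart s) (emb z))) *
      tv z \<eta> (hchart s) l) = lam \<epsilon> z * (?\<zeta> \<bullet> \<eta>)" .
  qed
  then have "christoffel disc (met \<epsilon>) (hchart s) (emb z) k i j = emb (?\<zeta> / scal s z) k"
    unfolding christoffel_def by (simp only: tv_hchart[OF s z])
  also have "?\<zeta> / scal s z = Complex (a 0) (a 1)" using nz by simp
  also have "emb (Complex (a 0) (a 1)) k = a k" using ij(3) by (auto simp: less_2_cases_iff)
  finally show ?thesis by (simp add: a_def)
qed

end


section \<open>Geodesics\<close>

lemma scal_inverse:
  assumes s: "s \<in> sgns" "z \<noteq> - of_real s"
  shows "inverse (scal s z) = - 2 * of_real s / (1 + of_real s * z)\<^sup>2"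
proof (rule inverse_unique)
  define n where "n = 1 + of_real s * z"
  have "n \<noteq> 0" unfolding n_def using sgn_mult_neq[OF s] one_plus_neq_0_iff by blast
  then have "(- of_real s * n\<^sup>2 / 2) * (- 2 * of_real s / n\<^sup>2) = of_real s * of_real s"
    by simp
  also have "\<dots> = 1" using s(1) by auto
  finally show "scal s z * (- 2 * of_real s / (1 + of_real s * z)\<^sup>2) = 1"
    unfolding scal_def n_def .
qed

lemma scal_has_field_derivative:
  assumes "s \<in> sgns"
  shows "(scal s has_field_derivative - (1 + of_real s * z)) (at z within S)"
proof -
  have "((\<lambda>z. (1 + of_real s * z)\<^sup>2) has_field_derivative 2 * (1 + of_real s * z) * of_real s) (at z within S)"
    by (auto intro!: derivative_eq_intros)
  from DERIV_cmult[OF this, of "- of_real s / 2"]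
  have "((\<lambda>z. - of_real s / 2 * (1 + of_real s * z)\<^sup>2) has_field_derivative
    - of_real s / 2 * (2 * (1 + of_real s * z) * of_real s)) (at z within S)" .
  moreover have "(\<lambda>z. - of_real s / 2 * (1 + of_real s * z)\<^sup>2) = scal s"
    by (simp add: scal_def fun_eq_iff)
  moreover have "- of_real s / 2 * (2 * (1 + of_real s * z) * of_real s) = - (1 + of_real s * z)"
    using assms by (auto simp: add_divide_distrib diff_divide_distrib)
  ultimately show ?thesis by simp
qed

lemma chart_has_field_derivative:
  assumes s: "s \<in> sgns" "z \<noteq> - of_real s"
  shows "((\<lambda>z. cay (of_real s * z)) has_field_derivative inverse (scal s z)) (at z)"
proof -
  have nz: "1 + of_real s * z \<noteq> 0" using sgn_mult_neq[OF s] one_plus_neq_0_iff by blast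
  have "((\<lambda>z. (1 - of_real s * z) / (1 + of_real s * z)) has_field_derivative
      ((- of_real s) * (1 + of_real s * z) - (1 - of_real s * z) * of_real s) /
      ((1 + of_real s * z) * (1 + of_real s * z))) (at z)"
    using nz by (intro DERIV_divide) (auto intro!: derivative_eq_intros)
  moreover have "((- of_real s) * (1 + of_real s * z) - (1 - of_real s * z) * of_real s) /
      ((1 + of_real s * z) * (1 + of_real s * z)) = inverse (scal s z)"
    unfolding scal_inverse[OF s] by (simp add: power2_eq_square algebra_simps)
  ultimately show ?thesis by (simp only: cay_def[abs_def])
qed

lemma bounded_linear_emb_component: "bounded_linear (\<lambda>w. emb w i)"
  unfolding emb_def
  by (cases "i = 0"; cases "i = 1") (simp_all add: bounded_linear_Re bounded_linear_Im)

lemma emb_component_has_vector_derivative: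
  "(f has_vector_derivative f') F \<Longrightarrow> ((\<lambda>u. emb (f u) i) has_vector_derivative emb f' i) F"
  by (rule bounded_linear.has_vector_derivative[OF bounded_linear_emb_component])

text \<open>The curve and its disc coordinate are separate parameters because the definitions
  constrain \<open>\<gamma>\<close> on \<open>{0..T}\<close> only, and outside the interval it may
  leave the disc.\<close>

locale disc_curve =
  fixes T :: real and z :: "real \<Rightarrow> complex" and \<gamma> :: "real \<Rightarrow> nat \<Rightarrow> real"
  assumes T: "0 < T"
    and z_disc: "t \<in> {0..T} \<Longrightarrow> z t \<in> cball 0 1"
    and \<gamma>: "t \<in> {0..T} \<Longrightarrow> \<gamma> t = emb (z t)"
begin

lemma vector_derivative_I:
  "t \<in> {0..T} \<Longrightarrow> (f has_vector_derivative f') (at t within {0..T}) \<Longrightarrow>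
    vector_derivative f (at t within {0..T}) = (f' :: 'a :: euclidean_space)"
  using T by (rule vector_derivative_within_closed_interval)

lemma \<gamma>_in_chart: "t \<in> {0..T} \<Longrightarrow> s \<in> sgns \<Longrightarrow> \<gamma> t \<in> cdom (hchart s) \<longleftrightarrow> z t \<noteq> - of_real s"
  using \<gamma> z_disc by (auto simp: cdom_hchart)

lemma avoid_near:
  assumes "continuous_on {0..T} z" "t \<in> {0..T}" "z t \<noteq> p"
  shows "\<exists>d>0. \<forall>u\<in>{0..T}. dist u t < d \<longrightarrow> z u \<noteq> p"
proof -
  have "0 < dist (z t) p" using assms(3) by simp
  then obtain d where "d > 0" "\<forall>u\<in>{0..T}. dist u t < d \<longrightarrow> dist (z u) (z t) < dist (z t) p"
    using assms(1,2) unfolding continuous_on_iff by blast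
  then show ?thesis by (intro exI[of _ d]) (auto simp: dist_commute)
qed

lemma chart_deriv_at:
  assumes z': "(z has_vector_derivative v) (at t within {0..T})"
    and s: "s \<in> sgns" "z t \<noteq> - of_real s" and t: "t \<in> {0..T}"
  shows "((\<lambda>u. cmap (hchart s) (\<gamma> u) i) has_vector_derivative emb (v / scal s (z t)) i)
    (at t within {0..T})"
proof -
  have "((\<lambda>y. cay (of_real s * y)) \<circ> z has_vector_derivative v * inverse (scal s (z t)))
      (at t within {0..T})"
    by (rule field_vector_diff_chain_within[OF z'
        DERIV_subset[OF chart_has_field_derivative[OF s] subset_UNIV]])
  then have "((\<lambda>u. cay (of_real s * z u)) has_vector_derivative v / scal s (z t)) (at t within {0..T})"
    by (simp add: o_def divide_inverse)
  from emb_component_has_vector_derivative[OF this, of i]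
  show ?thesis
    by (rule has_vector_derivative_transform[OF t, rotated]) (simp add: \<gamma> cmap_hchart)
qed

lemma velocity_at:
  assumes z': "(z has_vector_derivative v) (at t within {0..T})" and t: "t \<in> {0..T}"
  shows "velocity disc {0..T} \<gamma> t = tv (z t) v"
proof
  fix c show "velocity disc {0..T} \<gamma> t c = tv (z t) v c"
  proof (cases "c \<in> charts_at disc (emb (z t))")
    case True
    then obtain s where s: "s \<in> sgns" "z t \<noteq> - of_real s" "c = hchart s"
      using charts_at_cases z_disc[OF t] by blast
    have "velocity disc {0..T} \<gamma> t c i = emb (v / scal s (z t)) i" for i
      using True vector_derivative_I[OF t chart_deriv_at[OF z' s(1,2) t]] s(3)
      by (auto simp: velocity_def \<gamma>[OF t] emb_ge2)
    then show ?thesis using s tv_hchart[OF s(1,2) z_disc[OF t]] by auto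
  next
    case False
    then show ?thesis by (simp add: velocity_def \<gamma>[OF t] tv_outside)
  qed
qed

end

locale smooth_disc_curve = disc_curve +
  fixes v a :: "real \<Rightarrow> complex"
  assumes z_deriv: "t \<in> {0..T} \<Longrightarrow> (z has_vector_derivative v t) (at t within {0..T})"
    and v_deriv: "t \<in> {0..T} \<Longrightarrow> (v has_vector_derivative a t) (at t within {0..T})"
begin

lemma z_continuous: "continuous_on {0..T} z"
  unfolding continuous_on_eq_continuous_within
  by (rule ballI, rule has_vector_derivative_continuous, rule z_deriv)

lemmas chart_deriv = chart_deriv_at[OF z_deriv]

text \<open>The quotient rule for the chart velocity v / scal(z), using that the derivative of
  \<open>scal s\<close> is -(1 + sz).\<close>

lemma chart_second_deriv:
  assumes s: "s \<in> sgns" "z t \<noteq> - of_real s" and t: "t \<in> {0..T}"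
  shows "((\<lambda>u. vector_derivative (\<lambda>u. cmap (hchart s) (\<gamma> u) i) (at u within {0..T})) has_vector_derivative
    emb ((a t + (1 + of_real s * z t) * (v t)\<^sup>2 / scal s (z t)) / scal s (z t)) i) (at t within {0..T})"
proof -
  note nz = scal_nonzero[OF s]
  have "(scal s has_field_derivative - (1 + of_real s * z t)) (at (z t) within z ` {0..T})"
    by (rule scal_has_field_derivative[OF s(1)])
  from field_vector_diff_chain_within[OF z_deriv[OF t] this]
  have "((\<lambda>u. scal s (z u)) has_vector_derivative v t * - (1 + of_real s * z t)) (at t within {0..T})"
    by (simp add: o_def)
  then have "((\<lambda>u. scal s (z u)) has_derivative (\<lambda>h. h *\<^sub>R (v t * - (1 + of_real s * z t)))) (at t within {0..T})"
    by (simp add: has_vector_derivative_def)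
  moreover have "(v has_derivative (\<lambda>h. h *\<^sub>R a t)) (at t within {0..T})"
    using v_deriv[OF t] by (simp add: has_vector_derivative_def)
  ultimately have "((\<lambda>u. v u / scal s (z u)) has_derivative (\<lambda>h.
      (h *\<^sub>R a t * scal s (z t) - v t * h *\<^sub>R (v t * - (1 + of_real s * z t))) /
      (scal s (z t) * scal s (z t)))) (at t within {0..T})"
    by (intro has_derivative_divide') (use nz in auto)
  moreover have "(h *\<^sub>R a t * scal s (z t) - v t * h *\<^sub>R (v t * - (1 + of_real s * z t))) /
      (scal s (z t) * scal s (z t)) =
      h *\<^sub>R ((a t + (1 + of_real s * z t) * (v t)\<^sup>2 / scal s (z t)) / scal s (z t))" for h
    using nz by (simp add: scaleR_conv_of_real field_simps power2_eq_square)
  ultimately have "((\<lambda>u. v u / scal s (z u)) has_vector_derivative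
      (a t + (1 + of_real s * z t) * (v t)\<^sup>2 / scal s (z t)) / scal s (z t)) (at t within {0..T})"
    by (simp add: has_vector_derivative_def)
  note 1 = emb_component_has_vector_derivative[OF this, of i]
  \<comment> \<open>The chart velocity is known to be \<open>v u / scal s (z u)\<close> only while
    the curve stays in the chart, so the two functions are identified just near
    \<open>t\<close>.\<close>
  obtain d where d: "d > 0" "\<And>u. u \<in> {0..T} \<Longrightarrow> dist u t < d \<Longrightarrow> z u \<noteq> - of_real s"
    using avoid_near[OF z_continuous t s(2)] by blast
  have "emb (v u / scal s (z u)) i = vector_derivative (\<lambda>u. cmap (hchart s) (\<gamma> u) i) (at u within {0..T})"
    if "u \<in> {0..T}" "dist u t < d" for u
    using vector_derivative_I[OF that(1) chart_deriv[OF that(1) s(1) d(2)[OF that] that(1)]] by simp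
  then show ?thesis
    by (rule has_vector_derivative_transform_within[OF 1 d(1) t])
qed

lemma velocity_disc: "t \<in> {0..T} \<Longrightarrow> velocity disc {0..T} \<gamma> t = tv (z t) (v t)"
  by (rule velocity_at[OF z_deriv])

lemma twice_differentiable: "twice_differentiable_curve disc {0..T} \<gamma>"
  unfolding twice_differentiable_curve_def
proof (intro conjI ballI allI impI)
  have "continuous_on {0..T} \<gamma>"
    by (rule continuous_on_eq[OF continuous_on_compose2[OF continuous_on_emb[of UNIV] z_continuous]])
      (auto simp: \<gamma>)
  then show "continuous_map (top_of_set {0..T}) (mtop disc) \<gamma>"
    using \<gamma> z_disc by (auto simp: image_iff simp del: mem_cball_0)
  fix c i t assume c: "c \<in> atlas disc" and t: "t \<in> {0..T}" and \<gamma>t: "\<gamma> t \<in> cdom c"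
  from c obtain s where s: "s \<in> sgns" "c = hchart s" by auto
  have zt: "z t \<noteq> - of_real s" using \<gamma>t \<gamma>_in_chart[OF t s(1)] s(2) by blast
  show "(\<lambda>t. cmap c (\<gamma> t) i) differentiable (at t within {0..T})"
    using chart_deriv[OF t s(1) zt t] s(2) differentiableI_vector by blast
  show "(\<lambda>t. vector_derivative (\<lambda>u. cmap c (\<gamma> u) i) (at t within {0..T})) differentiable (at t within {0..T})"
    using chart_second_deriv[OF s(1) zt t] s(2) differentiableI_vector by blast
qed

end

section \<open>The geodesic equation in the disc coordinate\<close>

context conformal
begin

text \<open>The covariant acceleration for the metric \<lambda>|dz|^2 on the disc:
  2\<epsilon>z/\<lambda> is the Euclidean gradient of log \<lambda>.\<close>

definition geo_acc :: "complex \<Rightarrow> complex \<Rightarrow> complex \<Rightarrow> complex"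
  where "geo_acc z v a = a + ((2 * \<epsilon> / lam \<epsilon> z) * (z \<bullet> v)) *\<^sub>R v - ((2 * \<epsilon> / lam \<epsilon> z) * (v \<bullet> v) / 2) *\<^sub>R z"

text \<open>Multiplication by \<open>cnj (scal s z)\<close> is the adjoint of multiplication by
  \<open>scal s z\<close>; hence \<open>cnj (scal s z) * logd s z\<close> is the gradient of log
  \<mu> in chart coordinates, and the usual expression for the quadratic form of a conformal
  connection results.\<close>

lemma christoffel_sum:
  assumes s: "s \<in> sgns" "z \<noteq> - of_real s" and z: "z \<in> cball 0 1" and k: "k < 2"
  shows "(\<Sum>i<2. \<Sum>j<2. christoffel disc (met \<epsilon>) (hchart s) (emb z) k i j * emb w i * emb w j) =
    emb ((logd s z \<bullet> (scal s z * w)) *\<^sub>R w - ((w \<bullet> w) / 2) *\<^sub>R (cnj (scal s z) * logd s z)) k"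
proof -
  define M where "M i = logd s z \<bullet> (scal s z * ax i)" for i
  define L where "L = cnj (scal s z) * logd s z"
  define X where "X = logd s z \<bullet> (scal s z * w)"
  define Y where "Y = (w \<bullet> w) / 2"
  have LXY: "Re L = M 0" "Im L = M 1" "X = M 0 * Re w + M 1 * Im w"
      "Y = (Re w * Re w + Im w * Im w) / 2"
    by (auto simp: M_def L_def X_def Y_def inner_complex_def ax_def algebra_simps)
  have C: "christoffel disc (met \<epsilon>) (hchart s) (emb z) k i j =
      ((if j = k then M i else 0) + (if i = k then M j else 0) - (if i = j then M k else 0)) / 2"
    if "i < 2" "j < 2" "k < 2" for i j k
    using christoffel_disc[OF s z that] by (simp add: M_def)
  have C': "christoffel disc (met \<epsilon>) (hchart s) (emb z) 0 0 0 = M 0 / 2"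
    "christoffel disc (met \<epsilon>) (hchart s) (emb z) 0 0 1 = M 1 / 2"
    "christoffel disc (met \<epsilon>) (hchart s) (emb z) 0 1 0 = M 1 / 2"
    "christoffel disc (met \<epsilon>) (hchart s) (emb z) 0 1 1 = - M 0 / 2"
    "christoffel disc (met \<epsilon>) (hchart s) (emb z) 1 0 0 = - M 1 / 2"
    "christoffel disc (met \<epsilon>) (hchart s) (emb z) 1 0 1 = M 0 / 2"
    "christoffel disc (met \<epsilon>) (hchart s) (emb z) 1 1 0 = M 0 / 2"
    "christoffel disc (met \<epsilon>) (hchart s) (emb z) 1 1 1 = M 1 / 2"
    by (simp_all add: C)
  consider "k = 0" | "k = 1" using k by linarith
  then have "(\<Sum>i<2. \<Sum>j<2. christoffel disc (met \<epsilon>) (hchart s) (emb z) k i j * emb w i * emb w j) =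
      emb (X *\<^sub>R w - Y *\<^sub>R L) k"
  proof cases
    case 1
    show ?thesis unfolding 1 sum_less_2 C' by (simp add: LXY field_simps)
  next
    case 2
    show ?thesis unfolding 2 sum_less_2 C' by (simp add: LXY field_simps)
  qed
  then show ?thesis by (simp only: X_def Y_def L_def)
qed

text \<open>Coordinate invariance in concrete form: the part of \<open>logd\<close> that stems from
  |scal|^2 cancels the term that the second derivative of the chart adds to the acceleration, so
  only \<lambda> remains.\<close>

lemma christoffel_term:
  assumes s: "s \<in> sgns" "z \<noteq> - of_real s"
  shows "(1 + of_real s * z) * v\<^sup>2 / scal s z + (logd s z \<bullet> v) *\<^sub>R v - ((v \<bullet> v) / 2) *\<^sub>R logd s z =
    ((2 * \<epsilon> / lam \<epsilon> z) * (z \<bullet> v)) *\<^sub>R v - ((2 * \<epsilon> / lam \<epsilon> z) * (v \<bullet> v) / 2) *\<^sub>R z"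
proof -
  define \<kappa> where "\<kappa> = of_real s / (1 + of_real s * z)"
  define b where "b = (2 * \<epsilon> / lam \<epsilon> z) *\<^sub>R z"
  have nz: "1 + of_real s * z \<noteq> 0" using sgn_mult_neq[OF s] one_plus_neq_0_iff by blast
  have l: "logd s z = b + 4 *\<^sub>R cnj \<kappa>" by (simp add: logd_def b_def \<kappa>_def)
  have 1: "(1 + of_real s * z) * v\<^sup>2 / scal s z = - 2 * \<kappa> * v\<^sup>2"
    using nz unfolding divide_inverse[of _ "scal s z"] scal_inverse[OF s] \<kappa>_def
    by (simp add: power2_eq_square)
  \<comment> \<open>With c = cnj \<kappa> this is 2(c . v) = cnj c v + c cnj v, multiplied by
    2v.\<close>
  have "(4 * (cnj \<kappa> \<bullet> v)) *\<^sub>R v - (2 * (v \<bullet> v)) *\<^sub>R cnj \<kappa> = 2 * \<kappa> * v\<^sup>2"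
    by (simp add: complex_eq_iff inner_complex_def power2_eq_square algebra_simps)
  then have 2: "(4 *\<^sub>R cnj \<kappa> \<bullet> v) *\<^sub>R v - ((v \<bullet> v) / 2) *\<^sub>R (4 *\<^sub>R cnj \<kappa>) = 2 * \<kappa> * v\<^sup>2"
    by (simp add: mult.commute)
  have "(1 + of_real s * z) * v\<^sup>2 / scal s z + (logd s z \<bullet> v) *\<^sub>R v - ((v \<bullet> v) / 2) *\<^sub>R logd s z =
    (1 + of_real s * z) * v\<^sup>2 / scal s z + ((4 *\<^sub>R cnj \<kappa> \<bullet> v) *\<^sub>R v - ((v \<bullet> v) / 2) *\<^sub>R (4 *\<^sub>R cnj \<kappa>)) +
    ((b \<bullet> v) *\<^sub>R v - ((v \<bullet> v) / 2) *\<^sub>R b)"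
    unfolding l inner_add_left scaleR_add_left scaleR_add_right by simp
  also have "\<dots> = (b \<bullet> v) *\<^sub>R v - ((v \<bullet> v) / 2) *\<^sub>R b"
    unfolding 1 2 by simp
  finally show ?thesis by (simp add: b_def)
qed

lemma cov_acceleration_disc:
  assumes "smooth_disc_curve T z \<gamma> v a" and t: "t \<in> {0..T}"
  shows "cov_acceleration disc (met \<epsilon>) {0..T} \<gamma> t = tv (z t) (geo_acc (z t) (v t) (a t))"
proof -
  interpret smooth_disc_curve T z \<gamma> v a by fact
  obtain s where s: "s \<in> sgns" "z t \<noteq> - of_real s" and c: "chart_at disc (\<gamma> t) = hchart s"
    using chart_at_disc[OF z_disc[OF t]] \<gamma>[OF t] by metis
  note nz = scal_nonzero[OF s]
  define \<sigma> where "\<sigma> = scal s (z t)"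
  define w where "w = v t / \<sigma>"
  define A where "A = (a t + (1 + of_real s * z t) * (v t)\<^sup>2 / \<sigma>) / \<sigma>"
  define G where "G = (logd s (z t) \<bullet> (\<sigma> * w)) *\<^sub>R w - ((w \<bullet> w) / 2) *\<^sub>R (cnj \<sigma> * logd s (z t))"
  define r where "r k = vector_derivative (\<lambda>u. vector_derivative (\<lambda>u. cmap (hchart s) (\<gamma> u) k) (at u within {0..T}))
        (at t within {0..T}) +
      (\<Sum>i<2. \<Sum>j<2. christoffel disc (met \<epsilon>) (hchart s) (emb (z t)) k i j *
        vector_derivative (\<lambda>u. cmap (hchart s) (\<gamma> u) i) (at t within {0..T}) *
        vector_derivative (\<lambda>u. cmap (hchart s) (\<gamma> u) j) (at t within {0..T}))" for k
  have r: "r k = emb (A + G) k" if "k < 2" for k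
    unfolding r_def vector_derivative_I[OF t chart_deriv[OF t s t]]
      vector_derivative_I[OF t chart_second_deriv[OF s t]]
      \<sigma>_def[symmetric] w_def[symmetric] A_def[symmetric]
      christoffel_sum[OF s z_disc[OF t] that] G_def[symmetric]
    using that by (auto simp: emb_def)
  have "cov_acceleration disc (met \<epsilon>) {0..T} \<gamma> t = tv (z t) (\<sigma> * cpx r)"
    unfolding cov_acceleration_def c Let_def r_def[abs_def] \<sigma>_def
    by (simp add: \<gamma>[OF t] tvec_of_disc[OF s z_disc[OF t]])
  also have "cpx r = A + G" by (simp add: complex_eq_iff r)
  also have "\<sigma> * (A + G) = geo_acc (z t) (v t) (a t)"
  proof -
    have v: "\<sigma> * w = v t" using nz by (simp add: w_def \<sigma>_def)
    have "\<sigma> * ((w \<bullet> w) / 2) *\<^sub>R (cnj \<sigma> * logd s (z t)) = ((v t \<bullet> v t) / 2) *\<^sub>R logd s (z t)"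
    proof -
      have "\<sigma> * ((w \<bullet> w) / 2) *\<^sub>R (cnj \<sigma> * logd s (z t)) = ((w \<bullet> w) / 2) *\<^sub>R ((\<sigma> * cnj \<sigma>) * logd s (z t))"
        by (simp add: mult.assoc)
      also have "\<sigma> * cnj \<sigma> = of_real ((cmod \<sigma>)\<^sup>2)" by (rule complex_norm_square[symmetric])
      also have "((w \<bullet> w) / 2) *\<^sub>R (of_real ((cmod \<sigma>)\<^sup>2) * logd s (z t)) =
          ((cmod \<sigma>)\<^sup>2 * (w \<bullet> w) / 2) *\<^sub>R logd s (z t)"
        by (simp add: scaleR_conv_of_real)
      also have "(cmod \<sigma>)\<^sup>2 * (w \<bullet> w) = v t \<bullet> v t" by (simp add: v[symmetric] inner_mult_complex)
      finally show ?thesis .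
    qed
    then have "\<sigma> * G = (logd s (z t) \<bullet> v t) *\<^sub>R v t - ((v t \<bullet> v t) / 2) *\<^sub>R logd s (z t)"
      unfolding G_def v right_diff_distrib by (simp add: v mult_scaleR_right)
    moreover have "\<sigma> * A = a t + (1 + of_real s * z t) * (v t)\<^sup>2 / \<sigma>"
      using nz by (simp add: A_def \<sigma>_def)
    ultimately have "\<sigma> * (A + G) = a t + ((1 + of_real s * z t) * (v t)\<^sup>2 / \<sigma> +
        (logd s (z t) \<bullet> v t) *\<^sub>R v t - ((v t \<bullet> v t) / 2) *\<^sub>R logd s (z t))"
      unfolding distrib_left by simp
    then show ?thesis
      unfolding \<sigma>_def christoffel_term[OF s] by (simp add: geo_acc_def)
  qed
  finally show ?thesis .
qed

lemma mp_geodesic_iff: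
  assumes "smooth_disc_curve T z \<gamma> v a"
  shows "mp_geodesic disc (met \<epsilon>) zform (pot \<epsilon>) {0..T} \<gamma> \<longleftrightarrow>
    (\<forall>t\<in>{0..T}. geo_acc (z t) (v t) (a t) = - (\<epsilon> / (lam \<epsilon> (z t)) ^ 3) *\<^sub>R z t)"
proof -
  interpret smooth_disc_curve T z \<gamma> v a by fact
  have "cov_acceleration disc (met \<epsilon>) {0..T} \<gamma> t =
       (\<lambda>c i. lorentz_force disc (met \<epsilon>) zform (\<gamma> t) (velocity disc {0..T} \<gamma> t) c i
          - grad disc (met \<epsilon>) (pot \<epsilon>) (\<gamma> t) c i) \<longleftrightarrow>
    geo_acc (z t) (v t) (a t) = - (\<epsilon> / (lam \<epsilon> (z t)) ^ 3) *\<^sub>R z t" if t: "t \<in> {0..T}" for t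
    using z_disc[OF t]
    by (simp add: cov_acceleration_disc[OF assms t] \<gamma>[OF t] lorentz_zero grad_pot tv_diff)
  then show ?thesis unfolding mp_geodesic_def using twice_differentiable by blast
qed

end

text \<open>The definition of geodesics speaks of derivatives in charts only. Composing with the
  parametrisation, locally in time as long as the curve remains in one chart, recovers two
  derivatives of the disc coordinate; \<open>v\<close> and \<open>a\<close> are taken as derivatives
  of \<open>z\<close>, so they do not depend on the chart used.\<close>

lemma twice_differentiable_smooth:
  assumes T: "0 < T" and tw: "twice_differentiable_curve disc {0..T} \<gamma>"
  shows "\<exists>z v a. smooth_disc_curve T z \<gamma> v a"
proof -
  define z where "z t = cpx (\<gamma> t)" for t
  have cont: "continuous_on {0..T} \<gamma>"
    using tw by (auto simp: twice_differentiable_curve_def)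
  have pts: "\<gamma> t \<in> emb ` cball 0 1" if "t \<in> {0..T}" for t
    using tw that unfolding twice_differentiable_curve_def disc_simps continuous_map_in_subtopology
    by (simp add: image_subset_iff Pi_iff del: image_iff)
  interpret disc_curve T z \<gamma>
  proof
    fix t assume "t \<in> {0..T}"
    from pts[OF this] show "z t \<in> cball 0 1" "\<gamma> t = emb (z t)" by (auto simp: z_def)
  qed fact
  have zc: "continuous_on {0..T} z"
    unfolding z_def by (intro continuous_on_compose2[OF continuous_on_cpx[of UNIV] cont]) auto
  define W where "W s u = Complex (vector_derivative (\<lambda>u. cmap (hchart s) (\<gamma> u) 0) (at u within {0..T}))
    (vector_derivative (\<lambda>u. cmap (hchart s) (\<gamma> u) 1) (at u within {0..T}))" for s u
  have emb_deriv: "((\<lambda>u. Complex (f u) (g u)) has_vector_derivative Complex f' g') F"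
    if "(f has_vector_derivative f') F" "(g has_vector_derivative g') F" for f g f' g' F
    using has_vector_derivative_add[OF bounded_linear.has_vector_derivative[OF bounded_linear_of_real that(1)]
        has_vector_derivative_mult_right[OF bounded_linear.has_vector_derivative[OF bounded_linear_of_real that(2)], of \<i>]]
    by (simp add: Complex_eq)
  have diff: "(\<lambda>t. cmap (hchart s) (\<gamma> t) i) differentiable (at u within {0..T})"
    "(\<lambda>t. vector_derivative (\<lambda>u. cmap (hchart s) (\<gamma> u) i) (at t within {0..T})) differentiable (at u within {0..T})"
    if "s \<in> sgns" "u \<in> {0..T}" "z u \<noteq> - of_real s" "i < 2" for s u i
  proof -
    have "hchart s \<in> atlas disc" "i < mdim disc" "\<gamma> u \<in> cdom (hchart s)"
      using that \<gamma>_in_chart[OF that(2,1)] by auto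
    with tw that(2) show "(\<lambda>t. cmap (hchart s) (\<gamma> t) i) differentiable (at u within {0..T})"
      "(\<lambda>t. vector_derivative (\<lambda>u. cmap (hchart s) (\<gamma> u) i) (at t within {0..T})) differentiable (at u within {0..T})"
      unfolding twice_differentiable_curve_def by blast+
  qed
  have z': "(z has_vector_derivative scal s (z u) * W s u) (at u within {0..T})"
    if s: "s \<in> sgns" and u: "u \<in> {0..T}" and zu: "z u \<noteq> - of_real s" for s u
  proof -
    have "((\<lambda>t. Complex (cmap (hchart s) (\<gamma> t) 0) (cmap (hchart s) (\<gamma> t) 1)) has_vector_derivative W s u)
        (at u within {0..T})"
      unfolding W_def
      by (rule emb_deriv; rule vector_derivative_works[THEN iffD1]; rule diff(1)[OF s u zu]; simp)
    then have w: "((\<lambda>t. cay (of_real s * z t)) has_vector_derivative W s u) (at u within {0..T})"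
      by (rule has_vector_derivative_transform[OF u, rotated]) (simp add: \<gamma> cmap_hchart)
    have "((\<lambda>w. of_real s * cay w) has_field_derivative scal s (z u))
        (at (cay (of_real s * z u)) within (\<lambda>t. cay (of_real s * z t)) ` {0..T})"
      by (rule DERIV_subset[OF param_has_field_derivative[OF s zu] subset_UNIV])
    from field_vector_diff_chain_within[OF w this]
    have 1: "((\<lambda>t. of_real s * cay (cay (of_real s * z t))) has_vector_derivative scal s (z u) * W s u)
        (at u within {0..T})" by (simp add: o_def mult.commute)
    obtain d where d: "d > 0" "\<And>t. t \<in> {0..T} \<Longrightarrow> dist t u < d \<Longrightarrow> z t \<noteq> - of_real s"
      using avoid_near[OF zc u zu] by blast
    show ?thesis
      by (rule has_vector_derivative_transform_within[OF 1 d(1) u])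
        (use d(2) sgn_mult_neq[OF s] s in simp)
  qed
  define v where "v t = vector_derivative z (at t within {0..T})" for t
  define a where "a t = vector_derivative v (at t within {0..T})" for t
  have v: "v u = scal s (z u) * W s u" if "s \<in> sgns" "u \<in> {0..T}" "z u \<noteq> - of_real s" for s u
    unfolding v_def by (rule vector_derivative_I[OF that(2) z'[OF that]])
  show ?thesis
  proof (intro exI, unfold_locales)
    fix t assume t: "t \<in> {0..T}"
    obtain s where s: "s \<in> sgns" "z t \<noteq> - of_real s" using chart_at_disc[OF z_disc[OF t]] by blast
    show z1: "(z has_vector_derivative v t) (at t within {0..T})"
      using z'[OF s(1) t s(2)] v[OF s(1) t s(2)] by simp
    obtain d where d: "d > 0" "\<And>u. u \<in> {0..T} \<Longrightarrow> dist u t < d \<Longrightarrow> z u \<noteq> - of_real s"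
      using avoid_near[OF zc t s(2)] by blast
    have "(scal s has_field_derivative - (1 + of_real s * z t)) (at (z t) within z ` {0..T})"
      by (rule scal_has_field_derivative[OF s(1)])
    from field_vector_diff_chain_within[OF z1 this]
    have 1: "((\<lambda>u. scal s (z u)) has_vector_derivative v t * - (1 + of_real s * z t)) (at t within {0..T})"
      by (simp add: o_def)
    have 2: "(W s has_vector_derivative
        Complex (vector_derivative (\<lambda>u. vector_derivative (\<lambda>u. cmap (hchart s) (\<gamma> u) 0) (at u within {0..T})) (at t within {0..T}))
          (vector_derivative (\<lambda>u. vector_derivative (\<lambda>u. cmap (hchart s) (\<gamma> u) 1) (at u within {0..T})) (at t within {0..T})))
        (at t within {0..T})" (is "(_ has_vector_derivative ?A) _")
      unfolding W_def[abs_def]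
      by (rule emb_deriv; rule vector_derivative_works[THEN iffD1]; rule diff(2)[OF s(1) t s(2)]; simp)
    have "(v has_vector_derivative scal s (z t) * ?A + (v t * - (1 + of_real s * z t)) * W s t) (at t within {0..T})"
      by (rule has_vector_derivative_transform_within[OF has_vector_derivative_mult[OF 1 2] d(1) t])
        (use v d(2) s(1) in simp)
    then have "v differentiable (at t within {0..T})" by (rule differentiableI_vector)
    then show "(v has_vector_derivative a t) (at t within {0..T})"
      unfolding a_def by (simp add: vector_derivative_works)
  qed
qed


section \<open>The exponential map\<close>

context conformal
begin

text \<open>
  Along the segment \<open>x + r \<theta>\<close> the time is the integral of \<open>\<lambda>\<close>, so that the inverse of the
  exponential map at \<open>x\<close> multiplies \<open>y - x\<close> by the mean value of \<open>\<lambda>\<close> on the segment from \<open>x\<close> to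
  \<open>y\<close>, divided by \<open>\<lambda>(x)\<close>.
\<close>

definition mfac :: "complex \<Rightarrow> complex \<Rightarrow> real"
  where "mfac x q = (lam \<epsilon> x + \<epsilon> * (x \<bullet> q) + \<epsilon> * (q \<bullet> q) / 3) / lam \<epsilon> x"

definition mfac_deriv :: "complex \<Rightarrow> complex \<Rightarrow> complex \<Rightarrow> real"
  where "mfac_deriv x q h = (\<epsilon> * (x \<bullet> h) + 2 * \<epsilon> * (q \<bullet> h) / 3) / lam \<epsilon> x"

definition einv :: "complex \<Rightarrow> complex \<Rightarrow> complex"
  where "einv x y = mfac x (y - x) *\<^sub>R (y - x)"

definition einv_deriv :: "complex \<Rightarrow> complex \<Rightarrow> complex \<Rightarrow> complex"
  where "einv_deriv x q h = mfac x q *\<^sub>R h + mfac_deriv x q h *\<^sub>R q"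

text \<open>\<lambda> is at least 1 - \<epsilon> everywhere, hence so is its mean over a segment.
  Algebraically, x.x + x.q + q.q/3 equals |x + q/2|^2 + |q|^2/12.\<close>

lemma mfac_ge: "(1 - \<epsilon>) / lam \<epsilon> x \<le> mfac x q"
proof -
  have "(x + (1/2) *\<^sub>R q) \<bullet> (x + (1/2) *\<^sub>R q) = x \<bullet> x + x \<bullet> q + q \<bullet> q / 4"
    by (simp add: inner_add_left inner_add_right inner_commute[of q x] add_divide_distrib)
  then have "0 \<le> x \<bullet> x + x \<bullet> q + q \<bullet> q / 3"
    using inner_ge_zero[of "x + (1/2) *\<^sub>R q"] inner_ge_zero[of q] by linarith
  then have "0 \<le> \<epsilon> * (x \<bullet> x + x \<bullet> q + q \<bullet> q / 3)" using eps by simp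
  then have "1 - \<epsilon> \<le> lam \<epsilon> x + \<epsilon> * (x \<bullet> q) + \<epsilon> * (q \<bullet> q) / 3"
    by (simp add: lam_inner algebra_simps)
  then show ?thesis unfolding mfac_def using lam_pos[of x] by (intro divide_right_mono) auto
qed

lemma mfac_pos: "0 < mfac x q"
proof -
  have "0 < (1 - \<epsilon>) / lam \<epsilon> x" using lam_pos[of x] eps by simp
  then show ?thesis using mfac_ge[of x q] by linarith
qed

lemma lam_add: "lam \<epsilon> (x + q) = lam \<epsilon> x + 2 * \<epsilon> * (x \<bullet> q) + \<epsilon> * (q \<bullet> q)"
proof -
  have "(x + q) \<bullet> (x + q) = x \<bullet> x + 2 * (x \<bullet> q) + q \<bullet> q"
    by (simp add: inner_add_left inner_add_right inner_commute[of q x])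
  then show ?thesis unfolding lam_inner by (simp add: distrib_left)
qed

text \<open>The left-hand side is the derivative at r = 1 of r * mfac x (r q), that is, of the
  integral of \<lambda> along the ray divided by \<lambda>(x); it is therefore the endpoint value of
  \<lambda> over \<lambda>(x). It is the eigenvalue of \<open>einv_deriv x q\<close> in the radial
  direction.\<close>

lemma mfac_plus_deriv: "mfac x q + mfac_deriv x q q = lam \<epsilon> (x + q) / lam \<epsilon> x"
proof -
  have "mfac x q + mfac_deriv x q q = (lam \<epsilon> x + \<epsilon> * (x \<bullet> q) + \<epsilon> * (q \<bullet> q) / 3 +
      (\<epsilon> * (x \<bullet> q) + 2 * \<epsilon> * (q \<bullet> q) / 3)) / lam \<epsilon> x"
    by (simp only: mfac_def mfac_deriv_def add_divide_distrib[of _ _ "lam \<epsilon> x"])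
  also have "lam \<epsilon> x + \<epsilon> * (x \<bullet> q) + \<epsilon> * (q \<bullet> q) / 3 +
      (\<epsilon> * (x \<bullet> q) + 2 * \<epsilon> * (q \<bullet> q) / 3) = lam \<epsilon> (x + q)"
    unfolding lam_add by simp
  finally show ?thesis .
qed

lemma mfac_plus_deriv_pos: "0 < mfac x q + mfac_deriv x q q"
  unfolding mfac_plus_deriv using lam_pos by simp

lemma mfac_deriv_add: "mfac_deriv x q (h + k) = mfac_deriv x q h + mfac_deriv x q k"
  and mfac_deriv_diff: "mfac_deriv x q (h - k) = mfac_deriv x q h - mfac_deriv x q k"
  and mfac_deriv_scale: "mfac_deriv x q (c *\<^sub>R h) = c * mfac_deriv x q h"
  by (simp_all add: mfac_deriv_def inner_add_right inner_diff_right algebra_simps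
      add_divide_distrib diff_divide_distrib)

lemma einv_has_derivative: "(einv x has_derivative einv_deriv x (y - x)) (at y within S)"
proof -
  have "((\<lambda>y. ((lam \<epsilon> x + \<epsilon> * (x \<bullet> (y - x)) + \<epsilon> * ((y - x) \<bullet> (y - x)) / 3) * inverse (lam \<epsilon> x))) has_derivative
      (\<lambda>h. (\<epsilon> * (x \<bullet> h) + \<epsilon> * (2 * ((y - x) \<bullet> h)) / 3) * inverse (lam \<epsilon> x))) (at y within S)"
    by (auto intro!: derivative_eq_intros simp: inner_commute)
  moreover have "(lam \<epsilon> x + \<epsilon> * (x \<bullet> q) + \<epsilon> * (q \<bullet> q) / 3) * inverse (lam \<epsilon> x) = mfac x q" for q
    by (simp only: mfac_def divide_inverse[of _ "lam \<epsilon> x"])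
  moreover have "(\<lambda>h. (\<epsilon> * (x \<bullet> h) + \<epsilon> * (2 * (q \<bullet> h)) / 3) * inverse (lam \<epsilon> x)) = mfac_deriv x q" for q
    by (rule ext) (simp only: mfac_deriv_def divide_inverse[of _ "lam \<epsilon> x"] mult.assoc mult.left_commute[of \<epsilon> 2])
  ultimately have "((\<lambda>y. mfac x (y - x)) has_derivative mfac_deriv x (y - x)) (at y within S)"
    by (simp only:)
  moreover have "((\<lambda>y. y - x) has_derivative (\<lambda>h. h)) (at y within S)"
    by (auto intro!: derivative_eq_intros)
  ultimately show ?thesis
    unfolding einv_def[abs_def] einv_deriv_def[abs_def] by (rule has_derivative_scaleR)
qed

lemma einv_along:
  "einv_deriv x (r *\<^sub>R \<theta>) (c *\<^sub>R \<theta>) = (c * (lam \<epsilon> (x + r *\<^sub>R \<theta>) / lam \<epsilon> x)) *\<^sub>R \<theta>"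
proof -
  have "einv_deriv x (r *\<^sub>R \<theta>) (c *\<^sub>R \<theta>) = (c * (mfac x (r *\<^sub>R \<theta>) + mfac_deriv x (r *\<^sub>R \<theta>) (r *\<^sub>R \<theta>))) *\<^sub>R \<theta>"
    by (simp add: einv_deriv_def mfac_deriv_scale algebra_simps)
  then show ?thesis unfolding mfac_plus_deriv .
qed

text \<open>The Sherman-Morrison formula for the inverse of \<open>einv_deriv x q\<close>, which is
  a multiple of the identity plus a map of rank one. Both denominators are positive
  everywhere.\<close>

definition fexp_deriv :: "complex \<Rightarrow> complex \<Rightarrow> complex \<Rightarrow> complex"
  where "fexp_deriv x q k =
    (k - (mfac_deriv x q k / (mfac x q + mfac_deriv x q q)) *\<^sub>R q) /\<^sub>R mfac x q"

lemma fexp_einv_deriv: "fexp_deriv x q (einv_deriv x q h) = h"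
proof -
  have "mfac_deriv x q (einv_deriv x q h) = mfac_deriv x q h * (mfac x q + mfac_deriv x q q)"
    by (simp add: einv_deriv_def mfac_deriv_add mfac_deriv_scale algebra_simps)
  then have "mfac_deriv x q (einv_deriv x q h) / (mfac x q + mfac_deriv x q q) = mfac_deriv x q h"
    using mfac_plus_deriv_pos[of x q] by simp
  then show ?thesis using mfac_pos[of x q] by (simp add: fexp_deriv_def einv_deriv_def)
qed

lemma bounded_linear_fexp_deriv: "bounded_linear (fexp_deriv x q)"
proof -
  have "linear (fexp_deriv x q)"
    by (rule linearI) (simp_all add: fexp_deriv_def mfac_deriv_add mfac_deriv_scale add_divide_distrib
        scaleR_add_left scaleR_diff_right scaleR_add_right mult.commute)
  then show ?thesis by (simp add: linear_conv_bounded_linear)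
qed

text \<open>The integral of \<lambda> along x + \<rho> q for \<rho> from 0 to r. For a unit vector q
  it is the time at which the geodesic of speed 1/\<lambda> reaches x + r q.\<close>

definition radial :: "complex \<Rightarrow> complex \<Rightarrow> real \<Rightarrow> real"
  where "radial x q r = lam \<epsilon> x * r + \<epsilon> * (x \<bullet> q) * r\<^sup>2 + \<epsilon> * (q \<bullet> q) * r ^ 3 / 3"

lemma mfac_lam: "mfac x q * lam \<epsilon> x = lam \<epsilon> x + \<epsilon> * (x \<bullet> q) + \<epsilon> * (q \<bullet> q) / 3"
  using lam_nonzero[of x] by (simp add: mfac_def)

lemma radial_mfac: "radial x q r = r * (mfac x (r *\<^sub>R q) * lam \<epsilon> x)"
  unfolding mfac_lam radial_def by (simp add: distrib_left power2_eq_square power3_eq_cube)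

lemma einv_radial: "einv x (x + r *\<^sub>R q) = (radial x q r / lam \<epsilon> x) *\<^sub>R q"
  unfolding radial_mfac einv_def using lam_nonzero[of x] by (simp add: mult.commute)

lemma radial_strict_mono:
  assumes "r < r'"
  shows "radial x q r < radial x q r'"
  using assms
proof (rule DERIV_pos_imp_increasing)
  fix r :: real
  have "(radial x q has_real_derivative lam \<epsilon> x + \<epsilon> * (x \<bullet> q) * (2 * r) + \<epsilon> * (q \<bullet> q) * (3 * r\<^sup>2) / 3) (at r)"
    unfolding radial_def[abs_def] by (auto intro!: derivative_eq_intros)
  moreover have "lam \<epsilon> x + \<epsilon> * (x \<bullet> q) * (2 * r) + \<epsilon> * (q \<bullet> q) * (3 * r\<^sup>2) / 3 = lam \<epsilon> (x + r *\<^sub>R q)"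
    unfolding lam_add by (simp add: power2_eq_square)
  ultimately have "(radial x q has_real_derivative lam \<epsilon> (x + r *\<^sub>R q)) (at r)" by (simp only:)
  then show "\<exists>y. (radial x q has_real_derivative y) (at r) \<and> 0 < y" using lam_pos by blast
qed

lemma radial_ge: "0 \<le> r \<Longrightarrow> (1 - \<epsilon>) * r \<le> radial x q r"
proof -
  assume "0 \<le> r"
  have "radial x q r = r * (mfac x (r *\<^sub>R q) * lam \<epsilon> x)"
    by (rule radial_mfac)
  moreover have "1 - \<epsilon> \<le> mfac x (r *\<^sub>R q) * lam \<epsilon> x"
    using mfac_ge[of x "r *\<^sub>R q"] lam_pos[of x] by (simp add: pos_divide_le_eq)
  ultimately show ?thesis using \<open>0 \<le> r\<close> by (simp add: mult.commute mult_left_mono)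
qed

lemma radial_0 [simp]: "radial x q 0 = 0"
  by (simp add: radial_def)

lemma radial_continuous: "continuous_on S (radial x q)"
  unfolding radial_def[abs_def] by (intro continuous_intros) auto

text \<open>\<open>einv x y\<close> is a positive multiple of \<open>y - x\<close>, so points with
  the same image lie on one ray from \<open>x\<close>, and along a ray \<open>radial\<close> is
  strictly increasing.\<close>

lemma einv_inj: "inj (einv x)"
proof (rule injI)
  fix y y' assume eq: "einv x y = einv x y'"
  define q where "q = y - x"
  define q' where "q' = y' - x"
  define r where "r = mfac x q / mfac x q'"
  have "q' = (mfac x q' *\<^sub>R q') /\<^sub>R mfac x q'" using mfac_pos[of x q'] by simp
  also have "mfac x q' *\<^sub>R q' = mfac x q *\<^sub>R q" using eq by (simp add: einv_def q_def q'_def)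
  finally have "q' = r *\<^sub>R q" by (simp add: r_def divide_inverse mult.commute)
  then have y: "y = x + 1 *\<^sub>R q" "y' = x + r *\<^sub>R q" by (simp_all add: q_def q'_def algebra_simps)
  have "radial x q 1 = radial x q r" if "q \<noteq> 0"
    using eq that lam_nonzero[of x] unfolding y einv_radial by simp
  then have "q \<noteq> 0 \<Longrightarrow> r = 1"
    using radial_strict_mono[of 1 r x q] radial_strict_mono[of r 1 x q] by (cases r "1::real" rule: linorder_cases) auto
  then show "y = y'" using y by (cases "q = 0") auto
qed

lemma radial_surj:
  assumes "0 \<le> c" "c \<le> radial x q b" "0 \<le> b"
  shows "\<exists>r\<ge>0. r \<le> b \<and> radial x q r = c"
  using IVT'[of "radial x q" 0 c b] assms radial_continuous by auto

lemma einv_surj: "surj (einv x)"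
proof (rule surjI)
  fix k
  have e: "1 - \<epsilon> > 0" using eps by simp
  \<comment> \<open>By the linear growth in \<open>radial_ge\<close> the value lam x is reached
    before r = lam x / (1 - \<epsilon>); at that r the image of x + r k under \<open>einv x\<close>
    is exactly k.\<close>
  have "lam \<epsilon> x \<le> radial x k (lam \<epsilon> x / (1 - \<epsilon>))"
    using radial_ge[of "lam \<epsilon> x / (1 - \<epsilon>)" x k] e lam_pos[of x] by simp
  then obtain r where "radial x k r = lam \<epsilon> x"
    using radial_surj[of "lam \<epsilon> x" x k "lam \<epsilon> x / (1 - \<epsilon>)"] e lam_pos[of x] by auto
  then have "einv x (x + r *\<^sub>R k) = k" using lam_nonzero[of x] by (simp add: einv_radial)
  then show "einv x (SOME y. einv x y = k) = k" by (rule someI)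
qed

definition fexp :: "complex \<Rightarrow> complex \<Rightarrow> complex"
  where "fexp x = inv (einv x)"

lemma fexp_einv [simp]: "fexp x (einv x y) = y"
  by (simp add: fexp_def einv_inj)

lemma einv_fexp [simp]: "einv x (fexp x k) = k"
  by (simp add: fexp_def einv_surj surj_f_inv_f)

lemma einv_continuous: "continuous_on S (einv x)"
  by (rule has_derivative_continuous_on) (rule einv_has_derivative)

text \<open>A continuous bijection of the plane is open by invariance of domain, so its inverse is
  continuous. This continuity is what the inverse function rule for derivatives asks for
  next.\<close>

lemma fexp_continuous: "continuous_on S (fexp x)"
proof -
  have "continuous_on UNIV (fexp x)"
  proof (rule continuous_on_inverse_open_map[OF einv_continuous])
    show "einv x ` UNIV = UNIV" by (rule einv_surj)
    show "openin (top_of_set UNIV) (einv x ` U)" if "openin (top_of_set UNIV) U" for U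
      using invariance_of_domain[OF einv_continuous _ inj_on_subset[OF einv_inj subset_UNIV], of U x] that
      by simp
  qed simp
  then show ?thesis by (rule continuous_on_subset) simp
qed

lemma fexp_has_derivative: "(fexp x has_derivative fexp_deriv x (fexp x k - x)) (at k within S)"
proof -
  have "continuous (at k) (fexp x)"
    using fexp_continuous[of UNIV x] by (simp add: continuous_on_eq_continuous_at)
  then have "(fexp x has_derivative fexp_deriv x (fexp x k - x)) (at k)"
    by (intro has_derivative_inverse_basic[of "einv x", OF einv_has_derivative bounded_linear_fexp_deriv _ _ open_UNIV])
      (auto simp: fexp_einv_deriv fun_eq_iff)
  then show ?thesis by (rule has_derivative_at_withinI)
qed

text \<open>The Euclidean segment run through at speed 1/\<lambda>. Its image under
  \<open>einv x\<close> moves linearly in time, so no differential equation has to be solved: the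
  curve is \<open>fexp x\<close> along a ray. It remains in the disc because the disc is
  convex.\<close>

lemma segment_curve:
  assumes x: "x \<in> cball 0 1" and y: "y \<in> cball 0 1" and \<theta>: "\<theta> \<bullet> \<theta> = 1"
    and r: "y = x + r *\<^sub>R \<theta>" "0 < r"
  obtains z where "z 0 = x" "z (radial x \<theta> r) = y" "0 < radial x \<theta> r"
    "smooth_disc_curve (radial x \<theta> r) z (\<lambda>u. emb (z u)) (\<lambda>u. \<theta> /\<^sub>R lam \<epsilon> (z u))
      (\<lambda>u. - (2 * \<epsilon> * (z u \<bullet> \<theta>) / lam \<epsilon> (z u) ^ 3) *\<^sub>R \<theta>)"
    "mp_geodesic disc (met \<epsilon>) zform (pot \<epsilon>) {0..radial x \<theta> r} (\<lambda>u. emb (z u))"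
proof -
  define T where "T = radial x \<theta> r"
  \<comment> \<open>The factor 1 / lam x makes the initial velocity
    \<open>\<theta> /\<^sub>R lam \<epsilon> x\<close>, which has the prescribed energy.\<close>
  define z where "z u = fexp x ((u / lam \<epsilon> x) *\<^sub>R \<theta>)" for u
  have T: "0 < T" using radial_strict_mono[OF r(2), of x \<theta>] by (simp add: T_def)
  have zr: "z (radial x \<theta> p) = x + p *\<^sub>R \<theta>" for p
    unfolding z_def einv_radial[symmetric] by simp
  have zu: "\<exists>p. 0 \<le> p \<and> p \<le> r \<and> z u = x + p *\<^sub>R \<theta>" if "u \<in> {0..T}" for u
    using radial_surj[of u x \<theta> r] that r(2) zr by (auto simp: T_def)
  have disc: "z u \<in> cball 0 1" if u: "u \<in> {0..T}" for u
  proof -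
    obtain p where p: "0 \<le> p" "p \<le> r" "z u = x + p *\<^sub>R \<theta>" using zu[OF u] by blast
    have "(1 - p / r) *\<^sub>R x + (p / r) *\<^sub>R y = z u"
      using r(2) by (simp add: p(3) r(1) algebra_simps)
    moreover have "(1 - p / r) *\<^sub>R x + (p / r) *\<^sub>R y \<in> cball 0 1"
      using p r(2) by (intro convexD_alt[OF convex_cball x y]) auto
    ultimately show ?thesis by simp
  qed
  have z': "(z has_vector_derivative \<theta> /\<^sub>R lam \<epsilon> (z u)) (at u within {0..T})" if u: "u \<in> {0..T}" for u
  proof -
    obtain p where p: "z u = x + p *\<^sub>R \<theta>" using zu[OF u] by blast
    have q: "z u - x = p *\<^sub>R \<theta>" by (simp add: p)
    have "((\<lambda>u. (u / lam \<epsilon> x) *\<^sub>R \<theta>) has_derivative (\<lambda>h. (h / lam \<epsilon> x) *\<^sub>R \<theta>)) (at u within {0..T})"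
      by (auto intro!: derivative_eq_intros simp: lam_nonzero)
    from has_derivative_compose[OF this fexp_has_derivative]
    have "(z has_derivative (\<lambda>h. fexp_deriv x (z u - x) ((h / lam \<epsilon> x) *\<^sub>R \<theta>))) (at u within {0..T})"
      by (simp add: z_def[abs_def])
    moreover have "fexp_deriv x (z u - x) ((h / lam \<epsilon> x) *\<^sub>R \<theta>) = h *\<^sub>R (\<theta> /\<^sub>R lam \<epsilon> (z u))" for h
    proof -
      \<comment> \<open>\<open>z u - x\<close> is parallel to \<theta>, where
        \<open>einv_deriv\<close> acts as multiplication by lam (z u) / lam x; applying its inverse
        then gives the velocity.\<close>
      have "einv_deriv x (z u - x) ((h / lam \<epsilon> (z u)) *\<^sub>R \<theta>) = (h / lam \<epsilon> x) *\<^sub>R \<theta>"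
        unfolding q einv_along using lam_nonzero[of "z u"] by (simp add: p)
      from arg_cong[OF this, of "fexp_deriv x (z u - x)"]
      have "fexp_deriv x (z u - x) ((h / lam \<epsilon> x) *\<^sub>R \<theta>) = (h / lam \<epsilon> (z u)) *\<^sub>R \<theta>"
        by (simp only: fexp_einv_deriv)
      then show ?thesis by (simp add: divide_inverse)
    qed
    ultimately show ?thesis by (simp add: has_vector_derivative_def)
  qed
  have v': "((\<lambda>u. \<theta> /\<^sub>R lam \<epsilon> (z u)) has_vector_derivative
      - (2 * \<epsilon> * (z u \<bullet> \<theta>) / lam \<epsilon> (z u) ^ 3) *\<^sub>R \<theta>) (at u within {0..T})" if u: "u \<in> {0..T}" for u
  proof -
    have "((\<lambda>u. lam \<epsilon> (z u)) has_derivative (\<lambda>h. (2 * \<epsilon>) *\<^sub>R z u \<bullet> (h *\<^sub>R (\<theta> /\<^sub>R lam \<epsilon> (z u))))) (at u within {0..T})"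
      using has_derivative_compose[OF z'[OF u, unfolded has_vector_derivative_def] lam_has_derivative[of \<epsilon>]] .
    from has_derivative_scaleR_left[OF Deriv.has_derivative_inverse[OF lam_nonzero this], of \<theta>]
    have "((\<lambda>u. \<theta> /\<^sub>R lam \<epsilon> (z u)) has_derivative (\<lambda>h. (- (inverse (lam \<epsilon> (z u)) *
        ((2 * \<epsilon>) *\<^sub>R z u \<bullet> (h *\<^sub>R (\<theta> /\<^sub>R lam \<epsilon> (z u)))) * inverse (lam \<epsilon> (z u)))) *\<^sub>R \<theta>)) (at u within {0..T})" .
    moreover have "(- (inverse (lam \<epsilon> (z u)) * ((2 * \<epsilon>) *\<^sub>R z u \<bullet> (h *\<^sub>R (\<theta> /\<^sub>R lam \<epsilon> (z u)))) *
        inverse (lam \<epsilon> (z u)))) *\<^sub>R \<theta> = h *\<^sub>R (- (2 * \<epsilon> * (z u \<bullet> \<theta>) / lam \<epsilon> (z u) ^ 3) *\<^sub>R \<theta>)" for h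
      by (simp add: inverse_eq_divide power3_eq_cube)
    ultimately show ?thesis by (simp only: has_vector_derivative_def)
  qed
  have sm: "smooth_disc_curve T z (\<lambda>u. emb (z u)) (\<lambda>u. \<theta> /\<^sub>R lam \<epsilon> (z u))
      (\<lambda>u. - (2 * \<epsilon> * (z u \<bullet> \<theta>) / lam \<epsilon> (z u) ^ 3) *\<^sub>R \<theta>)"
    by unfold_locales (use T disc z' v' in auto)
  have "geo_acc (z u) (\<theta> /\<^sub>R lam \<epsilon> (z u)) (- (2 * \<epsilon> * (z u \<bullet> \<theta>) / lam \<epsilon> (z u) ^ 3) *\<^sub>R \<theta>) =
      - (\<epsilon> / lam \<epsilon> (z u) ^ 3) *\<^sub>R z u" for u
    using \<theta> lam_nonzero[of "z u"] by (simp add: geo_acc_def power3_eq_cube field_simps)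
  then have "mp_geodesic disc (met \<epsilon>) zform (pot \<epsilon>) {0..T} (\<lambda>u. emb (z u))"
    unfolding mp_geodesic_iff[OF sm] by simp
  moreover have "z 0 = x" "z T = y" using zr[of 0] zr[of r] by (simp_all add: T_def r)
  ultimately show ?thesis using that sm T unfolding T_def by blast
qed

text \<open>Uniqueness of geodesics is obtained from conserved quantities instead of a theorem on
  differential equations. Constant in turn are the energy, the momentum \<lambda>v, the offset from
  the line through the starting point, and the difference between \<open>einv\<close> along the
  curve and uniform motion.\<close>

lemma geodesic_straight:
  assumes sm: "smooth_disc_curve T z \<gamma> v a"
    and geo: "mp_geodesic disc (met \<epsilon>) zform (pot \<epsilon>) {0..T} \<gamma>"
    and energy: "lam \<epsilon> (z 0) * (v 0 \<bullet> v 0) = 1 / lam \<epsilon> (z 0)"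
  shows "einv (z 0) (z T) = T *\<^sub>R v 0"
proof -
  interpret smooth_disc_curve T z \<gamma> v a by fact
  define x where "x = z 0"
  have 0: "0 \<in> {0..T}" "T \<in> {0..T}" using T by auto
  have const: "f u = f 0" if "\<And>u. u \<in> {0..T} \<Longrightarrow> (f has_vector_derivative 0) (at u within {0..T})" "u \<in> {0..T}"
    for f :: "real \<Rightarrow> 'b::real_normed_vector" and u
    using has_vector_derivative_zero_constant[of "{0..T}" f] that 0(1) by (metis convex_real_interval(5))
  note z1 = z_deriv[unfolded has_vector_derivative_def]
  note v1 = v_deriv[unfolded has_vector_derivative_def]
  have l1: "((\<lambda>u. lam \<epsilon> (z u)) has_derivative (\<lambda>h. (2 * \<epsilon>) *\<^sub>R z u \<bullet> (h *\<^sub>R v u))) (at u within {0..T})"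
    if "u \<in> {0..T}" for u
    using has_derivative_compose[OF z1[OF that] lam_has_derivative[of \<epsilon>]] .
  have a: "a u = ((\<epsilon> / lam \<epsilon> (z u)) * (v u \<bullet> v u) - \<epsilon> / lam \<epsilon> (z u) ^ 3) *\<^sub>R z u -
      (2 * \<epsilon> / lam \<epsilon> (z u) * (z u \<bullet> v u)) *\<^sub>R v u" if "u \<in> {0..T}" for u
    using geo[unfolded mp_geodesic_iff[OF sm]] that by (simp add: geo_acc_def algebra_simps)
  \<comment> \<open>Twice the energy minus 2k = 1; the hypothesis \<open>energy\<close> says that it
    starts at 0.\<close>
  define e where "e u = lam \<epsilon> (z u) * (v u \<bullet> v u) - inverse (lam \<epsilon> (z u))" for u
  have "(e has_vector_derivative 0) (at u within {0..T})" if u: "u \<in> {0..T}" for u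
  proof -
    have vv: "((\<lambda>u. v u \<bullet> v u) has_derivative (\<lambda>h. v u \<bullet> (h *\<^sub>R a u) + (h *\<^sub>R a u) \<bullet> v u)) (at u within {0..T})"
      by (rule has_derivative_inner[OF v1[OF u] v1[OF u]])
    from has_derivative_diff[OF has_derivative_mult[OF l1[OF u] vv] Deriv.has_derivative_inverse[OF lam_nonzero l1[OF u]]]
    have "(e has_derivative (\<lambda>h. (lam \<epsilon> (z u) * (v u \<bullet> (h *\<^sub>R a u) + (h *\<^sub>R a u) \<bullet> v u) +
        (2 * \<epsilon>) *\<^sub>R z u \<bullet> (h *\<^sub>R v u) * (v u \<bullet> v u)) -
        - (inverse (lam \<epsilon> (z u)) * ((2 * \<epsilon>) *\<^sub>R z u \<bullet> (h *\<^sub>R v u)) * inverse (lam \<epsilon> (z u))))) (at u within {0..T})"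
      unfolding e_def[abs_def] .
    moreover have "(lam \<epsilon> (z u) * (v u \<bullet> (h *\<^sub>R a u) + (h *\<^sub>R a u) \<bullet> v u) +
        (2 * \<epsilon>) *\<^sub>R z u \<bullet> (h *\<^sub>R v u) * (v u \<bullet> v u)) -
        - (inverse (lam \<epsilon> (z u)) * ((2 * \<epsilon>) *\<^sub>R z u \<bullet> (h *\<^sub>R v u)) * inverse (lam \<epsilon> (z u))) = h *\<^sub>R 0" for h
    proof -
      define l where "l = lam \<epsilon> (z u)"
      define V where "V = v u \<bullet> v u"
      define Z where "Z = z u \<bullet> v u"
      have va: "v u \<bullet> a u = ((\<epsilon> / l) * V - \<epsilon> / l ^ 3) * Z - (2 * \<epsilon> / l * Z) * V"
        unfolding a[OF u] l_def V_def Z_def by (simp add: inner_diff_right inner_commute)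
      have "l \<noteq> 0" unfolding l_def by (rule lam_nonzero)
      then have "l * (2 * (v u \<bullet> a u)) + 2 * \<epsilon> * Z * V + inverse l * (2 * \<epsilon> * Z) * inverse l = 0"
        unfolding va by (simp add: field_simps power3_eq_cube)
      then have "h * (l * (2 * (v u \<bullet> a u)) + 2 * \<epsilon> * Z * V + inverse l * (2 * \<epsilon> * Z) * inverse l) = 0"
        by simp
      then show ?thesis
        unfolding l_def[symmetric] by (simp add: V_def Z_def inner_commute algebra_simps)
    qed
    ultimately show ?thesis by (simp add: has_vector_derivative_def)
  qed
  then have "e u = 0" if "u \<in> {0..T}" for u
    using const[of e u] that energy by (simp add: e_def inverse_eq_divide)
  then have vv: "v u \<bullet> v u = 1 / (lam \<epsilon> (z u))\<^sup>2" if "u \<in> {0..T}" for u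
    using that lam_nonzero[of "z u"] by (simp add: e_def field_simps power2_eq_square)
  define \<theta> where "\<theta> = lam \<epsilon> x *\<^sub>R v 0"
  \<comment> \<open>On the energy level |v|^2 = 1/\<lambda>^2 the coefficient of \<open>z u\<close>
    in the acceleration vanishes. What remains is parallel to the velocity and cancels the
    derivative of \<lambda>.\<close>
  have "((\<lambda>u. lam \<epsilon> (z u) *\<^sub>R v u) has_vector_derivative 0) (at u within {0..T})" if u: "u \<in> {0..T}" for u
  proof -
    have "((\<lambda>u. lam \<epsilon> (z u) *\<^sub>R v u) has_derivative
      (\<lambda>h. lam \<epsilon> (z u) *\<^sub>R (h *\<^sub>R a u) + ((2 * \<epsilon>) *\<^sub>R z u \<bullet> (h *\<^sub>R v u)) *\<^sub>R v u)) (at u within {0..T})"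
      by (rule has_derivative_scaleR[OF l1[OF u] v1[OF u]])
    moreover have "lam \<epsilon> (z u) *\<^sub>R (h *\<^sub>R a u) + ((2 * \<epsilon>) *\<^sub>R z u \<bullet> (h *\<^sub>R v u)) *\<^sub>R v u = h *\<^sub>R 0" for h
    proof -
      have "a u = - (2 * \<epsilon> / lam \<epsilon> (z u) * (z u \<bullet> v u)) *\<^sub>R v u"
        unfolding a[OF u] vv[OF u] by (simp add: power2_eq_square power3_eq_cube)
      then show ?thesis using lam_nonzero[of "z u"] by simp
    qed
    ultimately show ?thesis by (simp add: has_vector_derivative_def)
  qed
  from const[OF this] have \<theta>: "lam \<epsilon> (z u) *\<^sub>R v u = \<theta>" if "u \<in> {0..T}" for u
    using that unfolding \<theta>_def x_def by blast
  then have v: "v u = (1 / lam \<epsilon> (z u)) *\<^sub>R \<theta>" if "u \<in> {0..T}" for u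
    using lam_nonzero[of "z u"] by (simp add: \<theta>[OF that, symmetric])
  have \<theta>\<theta>: "\<theta> \<bullet> \<theta> = 1"
    using vv[OF 0(1)] lam_nonzero[of x] by (simp add: \<theta>_def x_def power2_eq_square)
  \<comment> \<open>The component of z - x orthogonal to \<theta>; it is constant because the
    velocity is a multiple of the unit vector \<theta>, and it starts at 0.\<close>
  have "((\<lambda>u. (z u - x) - ((z u - x) \<bullet> \<theta>) *\<^sub>R \<theta>) has_vector_derivative 0) (at u within {0..T})" if u: "u \<in> {0..T}" for u
  proof -
    have "((\<lambda>u. (z u - x) - ((z u - x) \<bullet> \<theta>) *\<^sub>R \<theta>) has_derivative
        (\<lambda>h. h *\<^sub>R v u - ((h *\<^sub>R v u) \<bullet> \<theta>) *\<^sub>R \<theta>)) (at u within {0..T})"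
      by (auto intro!: derivative_eq_intros z1[OF u])
    then show ?thesis
      using v[OF u] \<theta>\<theta> by (simp add: has_vector_derivative_def)
  qed
  note linear' = this
  have line: "z u - x = ((z u - x) \<bullet> \<theta>) *\<^sub>R \<theta>" if "u \<in> {0..T}" for u
  proof -
    from const[OF linear' that] show ?thesis by (simp add: x_def)
  qed
  \<comment> \<open>Radial motion of speed 1/\<lambda> becomes uniform motion under
    \<open>einv x\<close>, since \<open>einv_along\<close> multiplies by lam (z u) / lam x.\<close>
  have "((\<lambda>u. einv x (z u) - (u / lam \<epsilon> x) *\<^sub>R \<theta>) has_vector_derivative 0) (at u within {0..T})" if u: "u \<in> {0..T}" for u
  proof -
    have "((\<lambda>u. einv x (z u) - (u / lam \<epsilon> x) *\<^sub>R \<theta>) has_derivative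
      (\<lambda>h. einv_deriv x (z u - x) (h *\<^sub>R v u) - (h / lam \<epsilon> x) *\<^sub>R \<theta>)) (at u within {0..T})"
      using has_derivative_compose[OF z1[OF u] einv_has_derivative[of x]]
      by (auto intro!: derivative_eq_intros simp: lam_nonzero)
    moreover have "einv_deriv x (z u - x) (h *\<^sub>R v u) = (h / lam \<epsilon> x) *\<^sub>R \<theta>" for h
    proof -
      define r where "r = (z u - x) \<bullet> \<theta>"
      have q: "z u - x = r *\<^sub>R \<theta>" using line[OF u] by (simp add: r_def)
      then have zu: "x + r *\<^sub>R \<theta> = z u" by (metis add.commute diff_add_cancel)
      have "h *\<^sub>R v u = (h / lam \<epsilon> (z u)) *\<^sub>R \<theta>" by (simp add: v[OF u])
      then show ?thesis unfolding q by (simp only: einv_along zu) (simp add: lam_nonzero)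
    qed
    ultimately show ?thesis by (simp add: has_vector_derivative_def)
  qed
  from const[OF this 0(2)] have "einv x (z T) = (T / lam \<epsilon> x) *\<^sub>R \<theta>"
    by (simp add: x_def einv_def)
  then show ?thesis using lam_nonzero[of x] by (simp add: \<theta>_def x_def)
qed

end


section \<open>Smoothness of the exponential map\<close>

lemma differentiable_component:
  assumes f: "(f has_derivative f') (at (cpx w))"
  shows "((\<lambda>t. f (cpx (w(i := t)))) has_derivative (\<lambda>t. if i < 2 then f' (of_real t * ax i) else 0)) (at (w i))"
proof (cases "i < 2")
  case True
  have upd: "cpx (w(i := t)) = cpx w + of_real (t - w i) * ax i" for t
    using True by (auto simp: complex_eq_iff ax_def less_2_cases_iff)
  have "((\<lambda>t. cpx w + of_real (t - w i) * ax i) has_derivative (\<lambda>t. of_real t * ax i)) (at (w i))"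
    by (auto intro!: derivative_eq_intros)
  then have "((\<lambda>t. cpx (w(i := t))) has_derivative (\<lambda>t. of_real t * ax i)) (at (w i))"
    unfolding upd .
  moreover have "(f has_derivative f') (at (cpx (w(i := w i))))" using f by simp
  ultimately have "((\<lambda>t. f (cpx (w(i := t)))) has_derivative (\<lambda>t. f' (of_real t * ax i))) (at (w i))"
    by (rule has_derivative_compose)
  then show ?thesis using True by simp
next
  case False
  then have "cpx (w(i := t)) = cpx w" for t by (simp add: cpx_def)
  then show ?thesis using False by simp
qed

context conformal
begin

text \<open>The two components of the exponential map at \<open>x\<close>, read in chart components
  of the tangent space; \<open>\<sigma>\<close> will be \<open>scal s x\<close>, which converts
  those components into a direction in the disc.\<close>

definition lift_base :: "complex \<Rightarrow> complex \<Rightarrow> ((nat \<Rightarrow> real) \<Rightarrow> real) set"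
  where "lift_base x \<sigma> = {\<lambda>w. Re (fexp x (\<sigma> * cpx w)), \<lambda>w. Im (fexp x (\<sigma> * cpx w))}"

text \<open>
  The derivative of the inverse of \<open>einv\<close> is a rational function of the inverse itself, so that
  its components generate a class closed under partial derivatives.
\<close>

lemma lift_derivation_closed:
  assumes W: "openin (Euclidean_space 2) W"
  shows "derivation_closed 2 W (lift_base x \<sigma>)"
proof
  let ?F = "\<lambda>w. fexp x (\<sigma> * cpx w)"
  show "openin (Euclidean_space 2) W" by fact
  have F: "crat_alg W (lift_base x \<sigma>) ?F"
    unfolding crat_alg_def by (auto simp: lift_base_def intro: rat_alg.base)
  have cont: "continuous_on W ?F"
    by (intro continuous_on_compose2[OF fexp_continuous[of UNIV]] continuous_intros continuous_on_cpx) auto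
  show "continuous_on W b" if "b \<in> lift_base x \<sigma>" for b
    using that cont unfolding lift_base_def by (auto intro!: continuous_intros)
  show "\<exists>b'. rat_alg W (lift_base x \<sigma>) b' \<and>
      (\<forall>w\<in>W. ((\<lambda>t. b (w(i := t))) has_real_derivative b' w) (at (w i)))"
    if b: "b \<in> lift_base x \<sigma>" and i: "i < 2" for b i
  proof -
    define d where "d w = fexp_deriv x (?F w - x) (\<sigma> * ax i)" for w
    have D: "((\<lambda>t. ?F (w(i := t))) has_derivative (\<lambda>h. h *\<^sub>R d w)) (at (w i))" for w
    proof -
      have "((\<lambda>u. \<sigma> * u) has_derivative (\<lambda>u. \<sigma> * u)) (at (cpx w))"
        by (auto intro!: derivative_eq_intros)
      from has_derivative_compose[OF this fexp_has_derivative]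
      have "((\<lambda>u. fexp x (\<sigma> * u)) has_derivative (\<lambda>u. fexp_deriv x (?F w - x) (\<sigma> * u))) (at (cpx w))" .
      from differentiable_component[OF this, of i]
      have "((\<lambda>t. ?F (w(i := t))) has_derivative (\<lambda>t. fexp_deriv x (?F w - x) (\<sigma> * (of_real t * ax i)))) (at (w i))"
        using i by simp
      moreover have "fexp_deriv x (?F w - x) (\<sigma> * (of_real h * ax i)) = h *\<^sub>R d w" for h
        using linear_cmul[OF bounded_linear.linear[OF bounded_linear_fexp_deriv], of x "?F w - x" h "\<sigma> * ax i"]
        by (simp add: d_def scaleR_conv_of_real mult.left_commute)
      ultimately show ?thesis by (simp only:)
    qed
    have inn: "rat_alg W (lift_base x \<sigma>) (\<lambda>w. f w \<bullet> g w)"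
      if "crat_alg W (lift_base x \<sigma>) f" "crat_alg W (lift_base x \<sigma>) g" for f g
      unfolding inner_complex_def using that
      by (intro rat_alg.add rat_alg.mult crat_alg_Re crat_alg_Im)
    have q: "crat_alg W (lift_base x \<sigma>) (\<lambda>w. ?F w - x)"
      by (intro crat_alg_diff F crat_alg_const)
    have m: "rat_alg W (lift_base x \<sigma>) (\<lambda>w. mfac x (?F w - x))"
      unfolding mfac_def
      by (intro rat_alg_divide rat_alg.add rat_alg.mult rat_alg.const inn q crat_alg_const)
        (auto simp: lam_nonzero)
    have md: "rat_alg W (lift_base x \<sigma>) (\<lambda>w. mfac_deriv x (?F w - x) (k w))"
      if "crat_alg W (lift_base x \<sigma>) k" for k
      unfolding mfac_deriv_def
      by (intro rat_alg_divide rat_alg.add rat_alg.mult rat_alg.const inn q crat_alg_const that)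
        (auto simp: lam_nonzero)
    have d: "crat_alg W (lift_base x \<sigma>) d"
      unfolding d_def[abs_def] fexp_deriv_def scaleR_conv_of_real
      by (intro crat_alg_mult crat_alg_diff crat_alg_of_real rat_alg.inverse rat_alg_divide rat_alg.add
          m md q crat_alg_const)
        (auto simp: less_imp_neq[OF mfac_pos, symmetric] less_imp_neq[OF mfac_plus_deriv_pos, symmetric])
    have "((\<lambda>t. Re (?F (w(i := t)))) has_real_derivative Re (d w)) (at (w i))"
      "((\<lambda>t. Im (?F (w(i := t)))) has_real_derivative Im (d w)) (at (w i))" for w
      using bounded_linear.has_vector_derivative[OF bounded_linear_Re D[folded has_vector_derivative_def]]
        bounded_linear.has_vector_derivative[OF bounded_linear_Im D[folded has_vector_derivative_def]]
      by (simp_all add: has_real_derivative_iff_has_vector_derivative)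
    then show ?thesis
      using b crat_alg_Re[OF d] crat_alg_Im[OF d] unfolding lift_base_def by blast
  qed
qed

lemma energy_sphere_disc:
  assumes x: "x \<in> cball 0 1"
  shows "tv x \<zeta> \<in> energy_sphere disc (met \<epsilon>) (pot \<epsilon>) (1/2) (emb x) \<longleftrightarrow>
    lam \<epsilon> x * (\<zeta> \<bullet> \<zeta>) = 1 / lam \<epsilon> x"
  using x by (auto simp: energy_sphere_def energy_def tangent_space_disc[OF x] pot_def field_simps)

text \<open>The relation is the graph of the inverse of \<open>einv x\<close>, cut off at the disc:
  \<open>segment_curve\<close> supplies a geodesic to each point of the disc, and
  \<open>geodesic_straight\<close> shows that every geodesic of the right energy arises in this way.
  For y = x the vector is 0, which is the separate case of time 0.\<close>

lemma mp_exp_rel_disc: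
  assumes x: "x \<in> cball 0 1"
  shows "mp_exp_rel disc (met \<epsilon>) zform (pot \<epsilon>) (1/2) (emb x) w p \<longleftrightarrow>
    (\<exists>y\<in>cball 0 1. p = emb y \<and> w = tv x (einv x y))"
proof
  assume "\<exists>y\<in>cball 0 1. p = emb y \<and> w = tv x (einv x y)"
  then obtain y where y: "y \<in> cball 0 1" "p = emb y" "w = tv x (einv x y)" by blast
  show "mp_exp_rel disc (met \<epsilon>) zform (pot \<epsilon>) (1/2) (emb x) w p"
  proof (cases "y = x")
    case True
    then show ?thesis using y by (simp add: mp_exp_rel_def einv_def tv_0)
  next
    case False
    define r where "r = cmod (y - x)"
    define \<theta> where "\<theta> = (y - x) /\<^sub>R r"
    have r: "0 < r" "y = x + r *\<^sub>R \<theta>" using False by (simp_all add: r_def \<theta>_def)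
    have \<theta>: "\<theta> \<bullet> \<theta> = 1"
      using r(1) by (simp add: \<theta>_def dot_square_norm power2_eq_square flip: r_def)
    obtain z where z: "z 0 = x" "z (radial x \<theta> r) = y" "0 < radial x \<theta> r"
      "smooth_disc_curve (radial x \<theta> r) z (\<lambda>u. emb (z u)) (\<lambda>u. \<theta> /\<^sub>R lam \<epsilon> (z u))
        (\<lambda>u. - (2 * \<epsilon> * (z u \<bullet> \<theta>) / lam \<epsilon> (z u) ^ 3) *\<^sub>R \<theta>)"
      "mp_geodesic disc (met \<epsilon>) zform (pot \<epsilon>) {0..radial x \<theta> r} (\<lambda>u. emb (z u))"
      by (rule segment_curve[OF x y(1) \<theta> r(2,1)])
    interpret smooth_disc_curve "radial x \<theta> r" z "\<lambda>u. emb (z u)" "\<lambda>u. \<theta> /\<^sub>R lam \<epsilon> (z u)"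
      "\<lambda>u. - (2 * \<epsilon> * (z u \<bullet> \<theta>) / lam \<epsilon> (z u) ^ 3) *\<^sub>R \<theta>" by (rule z(4))
    define \<xi> where "\<xi> = tv x (\<theta> /\<^sub>R lam \<epsilon> x)"
    have "\<xi> \<in> energy_sphere disc (met \<epsilon>) (pot \<epsilon>) (1/2) (emb x)"
      unfolding \<xi>_def energy_sphere_disc[OF x] using \<theta> lam_nonzero[of x] by (simp add: field_simps)
    moreover have "w = (\<lambda>c i. radial x \<theta> r * \<xi> c i)"
      unfolding \<xi>_def tv_scale y(3) r(2) einv_radial by (simp add: scaleR_conv_of_real divide_inverse mult.assoc)
    moreover have "velocity disc {0..radial x \<theta> r} (\<lambda>u. emb (z u)) 0 = \<xi>"
      using velocity_disc[of 0] z(1,3) by (simp add: \<xi>_def)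
    ultimately show ?thesis
      unfolding mp_exp_rel_def using z(1,2,3,5) y(2) by blast
  qed
next
  assume "mp_exp_rel disc (met \<epsilon>) zform (pot \<epsilon>) (1/2) (emb x) w p"
  then consider "w = (\<lambda>_ _. 0)" "p = emb x" | t \<xi> \<gamma> where "0 < t"
    "\<xi> \<in> energy_sphere disc (met \<epsilon>) (pot \<epsilon>) (1/2) (emb x)" "w = (\<lambda>c i. t * \<xi> c i)"
    "mp_geodesic disc (met \<epsilon>) zform (pot \<epsilon>) {0..t} \<gamma>" "\<gamma> 0 = emb x" "velocity disc {0..t} \<gamma> 0 = \<xi>" "\<gamma> t = p"
    unfolding mp_exp_rel_def by blast
  then show "\<exists>y\<in>cball 0 1. p = emb y \<and> w = tv x (einv x y)"
  proof cases
    case 1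
    then show ?thesis using x by (intro bexI[of _ x]) (simp_all add: einv_def tv_0)
  next
    case 2
    have "twice_differentiable_curve disc {0..t} \<gamma>" using 2(4) by (simp add: mp_geodesic_def)
    then obtain z v a where sm: "smooth_disc_curve t z \<gamma> v a"
      using twice_differentiable_smooth[OF 2(1)] by blast
    interpret smooth_disc_curve t z \<gamma> v a by (rule sm)
    have 0: "0 \<in> {0..t}" "t \<in> {0..t}" using 2(1) by auto
    have z0: "z 0 = x" using \<gamma>[OF 0(1)] 2(5) by simp
    have \<xi>: "\<xi> = tv x (v 0)" using velocity_disc[OF 0(1)] 2(6) z0 by simp
    have "einv (z 0) (z t) = t *\<^sub>R v 0"
      using 2(2) unfolding \<xi> energy_sphere_disc[OF x] by (intro geodesic_straight[OF sm 2(4)]) (simp add: z0)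
    then have "w = tv x (einv x (z t))"
      using 2(3) by (simp add: \<xi> tv_scale z0 scaleR_conv_of_real)
    then show ?thesis using z_disc[OF 0(2)] \<gamma>[OF 0(2)] 2(7) by blast
  qed
qed

lemma mp_exp_diffeo_disc:
  assumes "p \<in> points disc"
  shows "mp_exp_diffeo disc (met \<epsilon>) zform (pot \<epsilon>) (1/2) p"
proof -
  obtain x where x: "x \<in> cball 0 1" and p: "p = emb x" using assms by auto
  have rel: "tv x k \<in> mp_exp_dom disc (met \<epsilon>) zform (pot \<epsilon>) (1/2) (emb x) \<longleftrightarrow> fexp x k \<in> cball 0 1" for k
  proof -
    have "tv x k \<in> mp_exp_dom disc (met \<epsilon>) zform (pot \<epsilon>) (1/2) (emb x) \<longleftrightarrow>
        (\<exists>y\<in>cball 0 1. k = einv x y)"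
      unfolding mp_exp_dom_def mp_exp_rel_disc[OF x] tangent_space_disc[OF x] using tv_eq_iff[OF x]
      by (auto simp del: mem_cball_0)
    then show ?thesis by (metis einv_fexp fexp_einv)
  qed
  have exp: "mp_exp disc (met \<epsilon>) zform (pot \<epsilon>) (1/2) (emb x) (tv x k) = emb (fexp x k)"
    if "fexp x k \<in> cball 0 1" for k
    unfolding mp_exp_def mp_exp_rel_disc[OF x]
  proof (rule the_equality)
    show "\<exists>y\<in>cball 0 1. emb (fexp x k) = emb y \<and> tv x k = tv x (einv x y)" using that by auto
    show "q = emb (fexp x k)" if "\<exists>y\<in>cball 0 1. q = emb y \<and> tv x k = tv x (einv x y)" for q
      using that tv_eq_iff[OF x] by (metis fexp_einv)
  qed
  show ?thesis
    unfolding mp_exp_diffeo_def Let_def p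
  proof (rule ballI)
    fix c assume "c \<in> charts_at disc (emb x)"
    then obtain s where s: "s \<in> sgns" "x \<noteq> - of_real s" and c: "c = hchart s"
      using charts_at_cases x by blast
    define \<sigma> where "\<sigma> = scal s x"
    have \<sigma>: "\<sigma> \<noteq> 0" unfolding \<sigma>_def by (rule scal_nonzero[OF s])
    let ?L = "\<lambda>w. fexp x (\<sigma> * cpx w)"
    define D where "D = {w \<in> plane. ?L w \<in> cball 0 1}"
    have D: "{w \<in> topspace (Euclidean_space (mdim disc)).
        tvec_of disc c (emb x) w \<in> mp_exp_dom disc (met \<epsilon>) zform (pot \<epsilon>) (1/2) (emb x)} = D"
      unfolding D_def c disc_simps tvec_of_disc[OF s x] rel \<sigma>_def ..
    define F where "F w = mp_exp disc (met \<epsilon>) zform (pot \<epsilon>) (1/2) (emb x) (tvec_of disc c (emb x) w)" for w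
    have F: "F w = emb (?L w)" if "w \<in> D" for w
      using that exp unfolding F_def D_def c tvec_of_disc[OF s x] \<sigma>_def by blast
    define H where "H y = emb (einv x y / \<sigma>)" for y
    have H: "H y \<in> D" "F (H y) = emb y" if "y \<in> cball 0 1" for y
    proof -
      show *: "H y \<in> D" using that \<sigma> by (simp add: H_def D_def)
      show "F (H y) = emb y" unfolding F[OF *] using \<sigma> by (simp add: H_def)
    qed
    have HF: "H (?L w) = w" if "w \<in> D" for w
      using that \<sigma> by (simp add: H_def D_def)
    have bij: "bij_betw F D (points disc)"
    proof (rule bij_betwI[where g = "\<lambda>q. H (cpx q)"])
      show "F \<in> D \<rightarrow> points disc" using F by (auto simp: D_def)
      show "(\<lambda>q. H (cpx q)) \<in> points disc \<rightarrow> D" using H(1) by auto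
      show "H (cpx (F w)) = w" if "w \<in> D" for w using HF[OF that] F[OF that] by simp
      show "F (H (cpx q)) = q" if "q \<in> points disc" for q using that H(2) by auto
    qed
    have G: "inv_into D F (emb y) = H y" if "y \<in> cball 0 1" for y
      using inv_into_f_f[OF bij_betw_imp_inj_on[OF bij] H(1)[OF that]] H(2)[OF that] by simp
    \<comment> \<open>Stated for every order and every subset: here the exponential map is smooth at
      the origin as well, so both regularity clauses of the definition are instances.\<close>
    have into: "Ck_into_manifold disc r A F" if A: "A \<subseteq> D" for A r
      unfolding Ck_into_manifold_def
    proof (intro conjI ballI allI impI)
      have "continuous_on A (\<lambda>w. emb (?L w))"
        by (intro continuous_on_compose2[OF continuous_on_emb[of UNIV]]
            continuous_on_compose2[OF fexp_continuous[of UNIV]] continuous_intros continuous_on_cpx) auto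
      then have "continuous_on A F"
        by (rule continuous_on_eq) (use A F in auto)
      moreover have "F ` A \<subseteq> emb ` cball 0 1" using A F by (auto simp: D_def)
      moreover have "A \<subseteq> plane" using A by (auto simp: D_def)
      ultimately show "continuous_map (subtopology (Euclidean_space (mdim disc)) A) (mtop disc) F"
        by (simp add: Euclidean_plane_subtopology continuous_map_in_subtopology image_subset_iff_funcset)
      fix d i assume "d \<in> atlas disc" "i < mdim disc"
      then obtain s' where s': "s' \<in> sgns" "d = hchart s'" by auto
      \<comment> \<open>Smoothness on \<open>A\<close> needs an extension to an open set, where the
        image may leave the disc; it only has to avoid the pole of the chart. For this
        \<open>fexp\<close> was constructed on the whole plane.\<close>
      let ?W = "{w \<in> plane. ?L w \<noteq> - of_real s'}"
      have "openin (Euclidean_space 2) {w \<in> plane. cpx w \<in> {k. fexp x (\<sigma> * k) \<in> - {- of_real s'}}}"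
      proof (rule openin_plane_vimage)
        have "continuous_on UNIV (\<lambda>k. fexp x (\<sigma> * k))"
          by (intro continuous_on_compose2[OF fexp_continuous[of UNIV]] continuous_intros) auto
        from open_vimage[OF open_Compl[OF closed_singleton] this, of "- of_real s'"]
        show "open {k. fexp x (\<sigma> * k) \<in> - {- of_real s'}}" by (simp add: vimage_def)
      qed
      then have W: "openin (Euclidean_space 2) ?W" by simp
      have L: "crat_alg ?W (lift_base x \<sigma>) ?L"
        unfolding crat_alg_def by (auto simp: lift_base_def intro: rat_alg.base)
      have "crat_alg ?W (lift_base x \<sigma>) (\<lambda>w. cay (of_real s' * ?L w))"
        unfolding cay_def
        by (intro crat_alg_divide crat_alg_diff crat_alg_add crat_alg_const crat_alg_mult L)
          (use sgn_mult_neq[OF s'(1)] one_plus_neq_0_iff in auto)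
      then have "rat_alg ?W (lift_base x \<sigma>) (\<lambda>w. emb (cay (of_real s' * ?L w)) i)"
        unfolding crat_alg_def emb_def by (cases "i = 0"; cases "i = 1") (auto intro: rat_alg.const)
      note R = this
      show "Ck_on (mdim disc) r {w \<in> A. F w \<in> cdom d} (\<lambda>w. cmap d (F w) i)"
      proof -
        have sub: "w \<in> ?W" if "w \<in> A" "F w \<in> cdom d" for w
          using that F[of w] A s' by (auto simp: D_def cdom_hchart)
        have eq: "cmap d (F w) i = emb (cay (of_real s' * ?L w)) i" if "w \<in> A" for w
          using that F[of w] A s' by (auto simp: cmap_hchart)
        show ?thesis
          unfolding disc_simps
          by (rule Ck_on_rat_alg[OF lift_derivation_closed[OF W] R]) (use sub eq in auto)
      qed
    qed
    have from_disc: "Ck_from_manifold disc r B (inv_into D F)" if B: "B \<subseteq> points disc" for B r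
      unfolding Ck_from_manifold_def
    proof (intro ballI allI impI)
      fix d i assume "d \<in> atlas disc" "i < mdim disc"
      then obtain s' where s': "s' \<in> sgns" "d = hchart s'" by auto
      let ?W = "{x \<in> plane. cpx x \<in> - {-1}}"
      have W: "derivation_closed 2 ?W {}"
        by (intro derivation_closed_empty openin_plane_vimage) auto
      have z: "crat_alg ?W {} (\<lambda>w. of_real s' * cay (cpx w))"
        unfolding cay_def by (intro crat_alg_intros) (auto simp: one_plus_neq_0_iff)
      have m: "rat_alg ?W {} (\<lambda>w. mfac x (of_real s' * cay (cpx w) - x))"
        unfolding mfac_def inner_complex_def
        by (intro rat_alg_divide rat_alg.add rat_alg.mult rat_alg.const crat_alg_Re crat_alg_Im
            crat_alg_diff z crat_alg_const) (auto simp: lam_nonzero)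
      have "crat_alg ?W {} (\<lambda>w. einv x (of_real s' * cay (cpx w)) / \<sigma>)"
        unfolding einv_def scaleR_conv_of_real
        by (intro crat_alg_divide crat_alg_mult crat_alg_of_real m crat_alg_diff z crat_alg_const) (simp add: \<sigma>)
      then have R: "rat_alg ?W {} (\<lambda>w. emb (einv x (of_real s' * cay (cpx w)) / \<sigma>) i)"
        unfolding crat_alg_def emb_def by (cases "i = 0"; cases "i = 1") (auto intro: rat_alg.const)
      have half: "w \<in> half_space 2" if "w \<in> cmap d ` (cdom d \<inter> B)" for w
        using that cimg_hchart[OF s'(1)] unfolding cimg_def s'(2) by blast
      show "Ck_on (mdim disc) r (cmap d ` (cdom d \<inter> B)) (\<lambda>w. inv_into D F (cinv d w) i)"
        unfolding disc_simps
      proof (rule Ck_on_rat_alg[OF W R])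
        show "cmap d ` (cdom d \<inter> B) \<subseteq> ?W" using half chart_point(4,5)[OF s'(1)] by auto
        show "inv_into D F (cinv d w) i = emb (einv x (of_real s' * cay (cpx w)) / \<sigma>) i"
          if "w \<in> cmap d ` (cdom d \<inter> B)" for w
          using G[OF chart_point(1)[OF s'(1) half[OF that]]] cinv_hchart[OF s'(1) half[OF that]]
          by (simp add: s'(2) H_def)
      qed
    qed
    show "bij_betw
         (\<lambda>w. mp_exp disc (met \<epsilon>) zform (pot \<epsilon>) (1 / 2) (emb x) (tvec_of disc c (emb x) w))
         {w \<in> topspace (Euclidean_space (mdim disc)).
          tvec_of disc c (emb x) w \<in> mp_exp_dom disc (met \<epsilon>) zform (pot \<epsilon>) (1 / 2) (emb x)} (points disc) \<and>
        Ck_into_manifold disc 1 {w \<in> topspace (Euclidean_space (mdim disc)).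
          tvec_of disc c (emb x) w \<in> mp_exp_dom disc (met \<epsilon>) zform (pot \<epsilon>) (1 / 2) (emb x)}
         (\<lambda>w. mp_exp disc (met \<epsilon>) zform (pot \<epsilon>) (1 / 2) (emb x) (tvec_of disc c (emb x) w)) \<and>
        Ck_from_manifold disc 1 (points disc)
         (inv_into {w \<in> topspace (Euclidean_space (mdim disc)).
          tvec_of disc c (emb x) w \<in> mp_exp_dom disc (met \<epsilon>) zform (pot \<epsilon>) (1 / 2) (emb x)}
         (\<lambda>w. mp_exp disc (met \<epsilon>) zform (pot \<epsilon>) (1 / 2) (emb x) (tvec_of disc c (emb x) w))) \<and>
        Ck_into_manifold disc \<infinity> ({w \<in> topspace (Euclidean_space (mdim disc)).
          tvec_of disc c (emb x) w \<in> mp_exp_dom disc (met \<epsilon>) zform (pot \<epsilon>) (1 / 2) (emb x)} - {\<lambda>_. 0})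
         (\<lambda>w. mp_exp disc (met \<epsilon>) zform (pot \<epsilon>) (1 / 2) (emb x) (tvec_of disc c (emb x) w)) \<and>
        Ck_from_manifold disc \<infinity> (points disc - {emb x})
         (inv_into {w \<in> topspace (Euclidean_space (mdim disc)).
          tvec_of disc c (emb x) w \<in> mp_exp_dom disc (met \<epsilon>) zform (pot \<epsilon>) (1 / 2) (emb x)}
         (\<lambda>w. mp_exp disc (met \<epsilon>) zform (pot \<epsilon>) (1 / 2) (emb x) (tvec_of disc c (emb x) w)))"
      unfolding D F_def[symmetric] F_def[abs_def, symmetric]
      using bij into[OF subset_refl] into[of "D - {\<lambda>_. 0}"] from_disc[OF subset_refl]
        from_disc[of "points disc - {emb x}"] by blast
  qed
qed

end


section \<open>Convexity of the boundary\<close>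

text \<open>For |u| = 1 one has (1 + u)^2 = |1 + u|^2 u. Geometrically, the conformal chart sends
  the boundary circle to the face, so the coordinate direction 0 at the boundary is a positive
  multiple of the inward direction -z.\<close>

lemma scal_boundary:
  assumes s: "s \<in> sgns" and z: "cmod z = 1"
  shows "scal s z = - ((cmod (1 + of_real s * z))\<^sup>2 / 2) *\<^sub>R z"
proof -
  define u where "u = of_real s * z"
  have "cmod u = 1" using assms by (auto simp: u_def norm_mult)
  then have uu: "u * cnj u = 1" using complex_norm_square[of u] by simp
  have "of_real ((cmod (1 + u))\<^sup>2) * u = (1 + u) * (u + u * cnj u)"
    unfolding complex_norm_square by (simp add: algebra_simps)
  then have "(1 + u)\<^sup>2 = of_real ((cmod (1 + u))\<^sup>2) * u" by (simp add: uu power2_eq_square add.commute)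
  moreover have "of_real s * u = z" using s by (auto simp: u_def)
  ultimately have "- of_real s * (1 + u)\<^sup>2 / 2 = - (of_real ((cmod (1 + u))\<^sup>2) / 2) * z"
    by (simp add: mult.left_commute)
  then show ?thesis by (simp add: scal_def u_def scaleR_conv_of_real)
qed

lemma tv_boundary:
  assumes s: "s \<in> sgns" "z \<noteq> - of_real s" and z: "cmod z = 1"
  shows "tv z \<zeta> (hchart s) 0 = - (2 / (cmod (1 + of_real s * z))\<^sup>2) * (z \<bullet> \<zeta>)"
    "tv z (- z) (hchart s) = emb (of_real (2 / (cmod (1 + of_real s * z))\<^sup>2))"
proof -
  define N where "N = (cmod (1 + of_real s * z))\<^sup>2"
  have zc: "z \<in> cball 0 1" and z0: "z \<noteq> 0" using z by auto
  have "1 + of_real s * z \<noteq> 0" using sgn_mult_neq[OF s] one_plus_neq_0_iff by blast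
  then have N: "N \<noteq> 0" by (simp add: N_def)
  have sc: "scal s z = - (N / 2) *\<^sub>R z" unfolding N_def by (rule scal_boundary[OF s(1) z])
  have zz: "cnj z * z = 1" using complex_norm_square[of z] z by (simp add: mult.commute)
  have "\<zeta> / scal s z = - (2 / N) *\<^sub>R (cnj z * \<zeta>)"
  proof -
    have "(- (2 / N) *\<^sub>R (cnj z * \<zeta>)) * scal s z = ((2 / N) * (N / 2)) *\<^sub>R ((cnj z * z) * \<zeta>)"
      unfolding sc by (simp add: mult.commute mult.left_commute)
    also have "\<dots> = \<zeta>" using N by (simp add: zz)
    finally show ?thesis using scal_nonzero[OF s] by (simp add: divide_eq_eq)
  qed
  then show "tv z \<zeta> (hchart s) 0 = - (2 / (cmod (1 + of_real s * z))\<^sup>2) * (z \<bullet> \<zeta>)"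
    by (simp add: tv_hchart[OF s zc] N_def inner_complex_def)
  have "- z / scal s z = of_real (2 / N)" using N z0 by (simp add: sc scaleR_conv_of_real)
  then show "tv z (- z) (hchart s) = emb (of_real (2 / (cmod (1 + of_real s * z))\<^sup>2))"
    by (simp only: tv_hchart[OF s zc] N_def)
qed

lemma boundary_tangent_disc:
  assumes z: "cmod z = 1"
  shows "tv z \<zeta> \<in> boundary_tangent_space disc (emb z) \<longleftrightarrow> z \<bullet> \<zeta> = 0"
    "(\<forall>c\<in>charts_at disc (emb z). 0 < tv z \<zeta> c 0) \<longleftrightarrow> z \<bullet> \<zeta> < 0"
proof -
  have zc: "z \<in> cball 0 1" using z by simp
  have N: "(cmod (1 + of_real s * z))\<^sup>2 > 0" if "s \<in> sgns" "z \<noteq> - of_real s" for s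
    using sgn_mult_neq[OF that] one_plus_neq_0_iff[of "of_real s * z"] by simp
  obtain s where s: "s \<in> sgns" "z \<noteq> - of_real s" using chart_at_disc[OF zc] by blast
  have A: "tv z \<zeta> c 0 = 0 \<longleftrightarrow> z \<bullet> \<zeta> = 0" "0 < tv z \<zeta> c 0 \<longleftrightarrow> z \<bullet> \<zeta> < 0"
    if c: "c \<in> charts_at disc (emb z)" for c
  proof -
    obtain s' where s': "s' \<in> sgns" "z \<noteq> - of_real s'" "c = hchart s'"
      using charts_at_cases[OF c zc] by blast
    show "tv z \<zeta> c 0 = 0 \<longleftrightarrow> z \<bullet> \<zeta> = 0" "0 < tv z \<zeta> c 0 \<longleftrightarrow> z \<bullet> \<zeta> < 0"
      unfolding s'(3) tv_boundary(1)[OF s'(1,2) z] using N[OF s'(1,2)]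
      by (simp_all add: mult_less_0_iff divide_less_0_iff zero_less_mult_iff)
  qed
  have "tv z \<zeta> \<in> tangent_space disc (emb z)" using tangent_space_disc[OF zc] by simp
  then show "tv z \<zeta> \<in> boundary_tangent_space disc (emb z) \<longleftrightarrow> z \<bullet> \<zeta> = 0"
    unfolding boundary_tangent_space_def using A(1) hchart_in_charts_at[OF s zc] by blast
  show "(\<forall>c\<in>charts_at disc (emb z). 0 < tv z \<zeta> c 0) \<longleftrightarrow> z \<bullet> \<zeta> < 0"
    using A(2) hchart_in_charts_at[OF s zc] by blast
qed

section \<open>Normal field and second fundamental form of the circle\<close>

context conformal
begin

text \<open>On the circle \<open>lam \<epsilon>\<close> is 1, so the unit normal is the Euclidean
  one for every \<epsilon>.\<close>

lemma inward_normal_disc: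
  assumes z: "cmod z = 1"
  shows "inward_normal disc (met \<epsilon>) (emb z) = tv z (- z)"
  unfolding inward_normal_def
proof (rule the_equality)
  have zc: "z \<in> cball 0 1" and l: "lam \<epsilon> z = 1" and zz: "z \<bullet> z = 1"
    using z by (simp_all add: lam_boundary dot_square_norm)
  have bt: "\<exists>\<xi>. \<eta> = tv z \<xi> \<and> z \<bullet> \<xi> = 0" if "\<eta> \<in> boundary_tangent_space disc (emb z)" for \<eta>
  proof -
    have "\<eta> \<in> range (tv z)"
      using that tangent_space_disc[OF zc] by (simp add: boundary_tangent_space_def)
    then show ?thesis using that boundary_tangent_disc(1)[OF z] by auto
  qed
  show "tv z (- z) \<in> tangent_space disc (emb z) \<and> met \<epsilon> (emb z) (tv z (- z)) (tv z (- z)) = 1 \<and>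
    (\<forall>\<eta>\<in>boundary_tangent_space disc (emb z). met \<epsilon> (emb z) (tv z (- z)) \<eta> = 0) \<and>
    (\<forall>c\<in>charts_at disc (emb z). 0 < tv z (- z) c 0)"
  proof (intro conjI ballI)
    show "tv z (- z) \<in> tangent_space disc (emb z)" using tangent_space_disc[OF zc] by simp
    show "met \<epsilon> (emb z) (tv z (- z)) (tv z (- z)) = 1" using zz met_tv[OF zc] l by simp
    show "met \<epsilon> (emb z) (tv z (- z)) \<eta> = 0" if "\<eta> \<in> boundary_tangent_space disc (emb z)" for \<eta>
      using bt[OF that] met_tv[OF zc] by auto
    show "0 < tv z (- z) c 0" if "c \<in> charts_at disc (emb z)" for c
      using boundary_tangent_disc(2)[OF z, of "- z"] zz that by simp
  qed
  fix v assume v: "v \<in> tangent_space disc (emb z) \<and> met \<epsilon> (emb z) v v = 1 \<and>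
    (\<forall>\<eta>\<in>boundary_tangent_space disc (emb z). met \<epsilon> (emb z) v \<eta> = 0) \<and>
    (\<forall>c\<in>charts_at disc (emb z). 0 < v c 0)"
  then obtain \<zeta> where \<zeta>: "v = tv z \<zeta>" using tangent_space_disc[OF zc] by blast
  \<comment> \<open>The tangential part of a candidate. Testing the orthogonality condition on it
    gives \<open>\<eta> \<bullet> \<eta> = 0\<close>, so the candidate is a multiple of z; length
    and sign fix the multiple.\<close>
  define \<eta> where "\<eta> = \<zeta> - (z \<bullet> \<zeta>) *\<^sub>R z"
  have z\<eta>: "z \<bullet> \<eta> = 0" by (simp add: \<eta>_def inner_diff_right zz)
  then have "met \<epsilon> (emb z) v (tv z \<eta>) = 0" using v boundary_tangent_disc(1)[OF z] by blast
  then have "\<zeta> \<bullet> \<eta> = 0" using met_tv[OF zc] l by (simp add: \<zeta>)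
  then have "\<eta> \<bullet> \<eta> = 0" using z\<eta> by (simp add: \<eta>_def inner_diff_left)
  then have \<zeta>z: "\<zeta> = (z \<bullet> \<zeta>) *\<^sub>R z" by (simp add: \<eta>_def)
  define c where "c = z \<bullet> \<zeta>"
  have "c < 0" unfolding c_def using v boundary_tangent_disc(2)[OF z] by (simp only: \<zeta>)
  moreover have "c * c = 1"
  proof -
    have "\<zeta> \<bullet> \<zeta> = 1" using v met_tv[OF zc] l by (simp add: \<zeta>)
    then have "(c *\<^sub>R z) \<bullet> (c *\<^sub>R z) = 1" using \<zeta>z by (simp add: c_def)
    then show ?thesis by (simp add: zz)
  qed
  ultimately have "c = -1" by (metis less_numeral_extra(1) mult_eq_1 not_less_iff_gr_or_eq power2_eq_1_iff power2_eq_square)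
  then show "v = tv z (- z)" using \<zeta>z by (simp add: \<zeta> c_def)
qed

text \<open>By conformality the normal has only the component 0 along the entire face. Hence the
  tangential component, the only one that matters for the second fundamental form, has vanishing
  derivative along the face.\<close>

lemma normal_in_chart:
  assumes s: "s \<in> sgns" and y: "y \<in> half_space 2" "y 0 = 0"
  shows "inward_normal disc (met \<epsilon>) (cinv (hchart s) y) (hchart s) =
    emb (of_real ((cmod (1 + cpx y))\<^sup>2 / 2))"
proof -
  define z where "z = of_real s * cay (cpx y)"
  note cp = chart_point[OF s y(1), folded z_def]
  have "cmod (of_real s * z) = 1"
    using Re_cay_eq_0[OF sgn_mult_neq[OF s cp(2)]] cp(1,3) y(2) s by (auto simp: norm_mult)
  then have z: "cmod z = 1" using s by (auto simp: norm_mult)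
  have "1 + of_real s * z = 2 / (1 + cpx y)"
    using one_plus_cay[OF cp(4)] s by (simp add: z_def)
  then have N: "2 / (cmod (1 + of_real s * z))\<^sup>2 = (cmod (1 + cpx y))\<^sup>2 / 2"
    by (simp add: norm_divide power_divide)
  show ?thesis
    unfolding cinv_hchart[OF s y(1)] z_def[symmetric] inward_normal_disc[OF z]
      tv_boundary(2)[OF s cp(2) z] N ..
qed

text \<open>1 is the Euclidean curvature of the unit circle, and \<epsilon> is half the radial
  derivative of log \<lambda> there.\<close>

lemma second_fund_form_disc:
  assumes z: "cmod z = 1" and \<zeta>: "z \<bullet> \<zeta> = 0"
  shows "second_fund_form disc (met \<epsilon>) (emb z) (tv z \<zeta>) = (1 + \<epsilon>) * (\<zeta> \<bullet> \<zeta>)"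
proof -
  have zc: "z \<in> cball 0 1" and l: "lam \<epsilon> z = 1" and zz: "z \<bullet> z = 1"
    using z by (simp_all add: lam_boundary dot_square_norm)
  obtain s where s: "s \<in> sgns" "z \<noteq> - of_real s" and c: "chart_at disc (emb z) = hchart s"
    using chart_at_disc[OF zc] by blast
  define N where "N = (cmod (1 + of_real s * z))\<^sup>2"
  have "1 + of_real s * z \<noteq> 0" using sgn_mult_neq[OF s] one_plus_neq_0_iff by blast
  then have N: "N \<noteq> 0" by (simp add: N_def)
  define \<sigma> where "\<sigma> = scal s z"
  have \<sigma>: "\<sigma> = - (N / 2) *\<^sub>R z" unfolding \<sigma>_def N_def by (rule scal_boundary[OF s(1) z])
  have \<sigma>0: "\<sigma> \<noteq> 0" unfolding \<sigma>_def by (rule scal_nonzero[OF s])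
  define \<tau> where "\<tau> = Im (\<zeta> / \<sigma>)"
  have "Re (\<zeta> / \<sigma>) = 0"
    using tv_boundary(1)[OF s z, of \<zeta>] \<zeta> by (simp add: tv_hchart[OF s zc] \<sigma>_def)
  then have \<zeta>\<tau>: "\<zeta> / \<sigma> = \<tau> *\<^sub>R \<i>" by (simp add: complex_eq_iff \<tau>_def)
  then have \<zeta>\<sigma>: "\<zeta> = \<sigma> * (\<tau> *\<^sub>R \<i>)" using \<sigma>0 by (simp add: field_simps)
  define w where "w = cay (of_real s * z)"
  have w: "Re w = 0" "w \<noteq> -1"
    using Re_cay_eq_0[OF sgn_mult_neq[OF s]] z s(1) cay_neq[OF sgn_mult_neq[OF s]]
    by (auto simp: w_def norm_mult)
  have p: "cmap (hchart s) (emb z) = emb w" by (simp add: cmap_hchart w_def)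
  have wh: "emb w \<in> half_space 2" using cmap_in_half_space[OF s(1) zc s(2)] p by simp
  have \<nu>: "inward_normal disc (met \<epsilon>) (emb z) (hchart s) = emb (of_real (2 / N))"
    unfolding inward_normal_disc[OF z] tv_boundary(2)[OF s z] N_def ..
  have face: "pderiv {x \<in> cimg (hchart s). x 0 = 0} 1
      (\<lambda>x. inward_normal disc (met \<epsilon>) (cinv (hchart s) x) (hchart s) 1) (emb w) = 0"
  proof (rule pderiv_plane[where h = "\<lambda>_. 0" and h' = "\<lambda>_. 0" and O' = UNIV])
    show "inward_normal disc (met \<epsilon>) (cinv (hchart s) y) (hchart s) 1 = 0"
      if "y \<in> {x \<in> cimg (hchart s). x 0 = 0}" for y
      using that s(1) normal_in_chart[OF s(1), of y] by (simp add: cimg_hchart)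
  qed (use wh w s(1) in \<open>auto simp: cimg_hchart\<close>)
  \<comment> \<open>The direction \<zeta> has only chart component 1 and the normal only component
    0, while pairing with \<zeta> picks out component 1 of the covariant derivative. Thus a single
    Christoffel symbol enters.\<close>
  have chr: "christoffel disc (met \<epsilon>) (hchart s) (emb z) 1 1 0 = (logd s z \<bullet> \<sigma>) / 2"
    using christoffel_disc[OF s zc, of 1 0 1] by (simp add: \<sigma>_def ax_def)
  have logd: "logd s z \<bullet> \<sigma> = - (1 + \<epsilon>) * N"
  proof -
    have "cnj b \<bullet> \<sigma> = Re (b * \<sigma>)" for b
      by (simp add: inner_complex_def)
    then have "cnj (of_real s / (1 + of_real s * z)) \<bullet> \<sigma> = Re (of_real s / (1 + of_real s * z) * \<sigma>)" .
    also have "of_real s / (1 + of_real s * z) * \<sigma> = - ((1 + of_real s * z) / 2)"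
      using s(1) \<open>1 + of_real s * z \<noteq> 0\<close> by (auto simp: \<sigma>_def scal_def power2_eq_square)
    also have "Re (- ((1 + of_real s * z) / 2)) = - N / 4"
    proof -
      have "N = 1 + 2 * Re (of_real s * z) + (cmod (of_real s * z))\<^sup>2"
        unfolding N_def cmod_power2 by (simp add: power2_sum)
      also have "(cmod (of_real s * z))\<^sup>2 = 1" using z s(1) by (auto simp: norm_mult)
      finally have "Re (1 + of_real s * z) = N / 2" by simp
      moreover have "Re (- (w / 2)) = - (Re w / 2)" for w by simp
      ultimately show ?thesis by (simp only:)
    qed
    finally have 1: "cnj (of_real s / (1 + of_real s * z)) \<bullet> \<sigma> = - N / 4" .
    have 2: "z \<bullet> \<sigma> = - N / 2" by (simp add: \<sigma> zz)
    show ?thesis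
      unfolding logd_def inner_add_left inner_scaleR_left 1 2 l by (simp add: algebra_simps)
  qed
  define r where "r k = (\<Sum>i\<in>{1..<mdim disc}. pderiv {x \<in> cimg (hchart s). x 0 = 0} i
        (\<lambda>x. inward_normal disc (met \<epsilon>) (cinv (hchart s) x) (hchart s) k) (cmap (hchart s) (emb z)) *
        tv z \<zeta> (hchart s) i) +
      (\<Sum>i<mdim disc. \<Sum>j<mdim disc. christoffel disc (met \<epsilon>) (hchart s) (emb z) k i j *
        tv z \<zeta> (hchart s) i * inward_normal disc (met \<epsilon>) (emb z) (hchart s) j)" for k
  have "tv z \<zeta> (hchart s) = emb (\<tau> *\<^sub>R \<i>)" by (simp add: tv_hchart[OF s zc] \<zeta>\<tau>[symmetric] \<sigma>_def)
  moreover have "{1..<2 :: nat} = {1}" by auto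
  ultimately have r1: "r 1 = (logd s z \<bullet> \<sigma>) / 2 * \<tau> * (2 / N)"
    unfolding r_def disc_simps p using face chr by (simp add: sum_less_2 \<nu>)
  have "cov_deriv_normal disc (met \<epsilon>) (emb z) (tv z \<zeta>) = tv z (\<sigma> * cpx r)"
    unfolding cov_deriv_normal_def c Let_def r_def[symmetric] \<sigma>_def
    by (simp add: tvec_of_disc[OF s zc] r_def[abs_def])
  then have "second_fund_form disc (met \<epsilon>) (emb z) (tv z \<zeta>) = - ((\<sigma> * cpx r) \<bullet> \<zeta>)"
    unfolding second_fund_form_def using met_tv[OF zc] by (simp add: l)
  also have "\<dots> = - ((\<sigma> * cpx r) \<bullet> (\<sigma> * (\<tau> *\<^sub>R \<i>)))"
    unfolding \<zeta>\<sigma>[symmetric] ..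
  also have "\<dots> = - ((cmod \<sigma>)\<^sup>2 * (r 1 * \<tau>))"
    unfolding inner_mult_complex by (simp add: inner_complex_def)
  also have "\<dots> = (1 + \<epsilon>) * ((cmod \<sigma>)\<^sup>2 * \<tau>\<^sup>2)"
  proof -
    have "r 1 = - ((1 + \<epsilon>) * \<tau>)" unfolding r1 logd using N by (simp add: field_simps)
    then show ?thesis by (simp only: power2_eq_square) (simp add: algebra_simps)
  qed
  also have "(cmod \<sigma>)\<^sup>2 * \<tau>\<^sup>2 = \<zeta> \<bullet> \<zeta>"
    unfolding \<zeta>\<sigma> inner_mult_complex by (simp add: inner_complex_def power2_eq_square)
  finally show ?thesis .
qed

text \<open>A tangential vector of energy 1/2 is a Euclidean unit vector at the boundary. The
  inequality reads 1 + \<epsilon> > \<epsilon>: the force term -dU(\<nu>) takes back exactly the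
  contribution of \<lambda>, and the curvature of the Euclidean circle is left over.\<close>

lemma strictly_mp_convex_disc: "strictly_mp_convex disc (met \<epsilon>) zform (pot \<epsilon>) (1/2)"
  unfolding strictly_mp_convex_def mboundary_disc
proof (intro ballI)
  fix p \<xi> assume "p \<in> emb ` sphere 0 1"
    and \<xi>: "\<xi> \<in> energy_sphere disc (met \<epsilon>) (pot \<epsilon>) (1/2) p \<inter> boundary_tangent_space disc p"
  then obtain z where z: "cmod z = 1" and p: "p = emb z" by auto
  have zc: "z \<in> cball 0 1" and l: "lam \<epsilon> z = 1" and zz: "z \<bullet> z = 1"
    using z by (simp_all add: lam_boundary dot_square_norm)
  obtain \<zeta> where \<zeta>: "\<xi> = tv z \<zeta>"
    using \<xi> tangent_space_disc[OF zc] unfolding p energy_sphere_def by blast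
  have 1: "\<zeta> \<bullet> \<zeta> = 1" using \<xi> energy_sphere_disc[OF zc] l by (simp add: p \<zeta>)
  have 2: "z \<bullet> \<zeta> = 0" using \<xi> boundary_tangent_disc(1)[OF z] by (simp add: p \<zeta>)
  show "met \<epsilon> p (lorentz_force disc (met \<epsilon>) zform p \<xi>) (inward_normal disc (met \<epsilon>) p) -
       differential disc (pot \<epsilon>) p (inward_normal disc (met \<epsilon>) p)
      < second_fund_form disc (met \<epsilon>) p \<xi>"
    unfolding p \<zeta> second_fund_form_disc[OF z 2] lorentz_zero[OF zc] inward_normal_disc[OF z]
      pot_differential[OF zc] using met_tv[OF zc] by (simp add: 1 l zz)
qed

lemma mp_simple_disc: "mp_simple disc (met \<epsilon>) zform (pot \<epsilon>) (1/2)"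
  unfolding mp_simple_def using strictly_mp_convex_disc mp_exp_diffeo_disc by blast

end


section \<open>Absolutely continuous functions\<close>

text \<open>Intervals are stored as pairs of endpoints. Their strict order makes each open interval
  nonempty, so families inside different intervals of a nonoverlapping set cannot share a
  member.\<close>

definition nonoverlapping :: "(real \<times> real) set \<Rightarrow> bool"
  where "nonoverlapping I \<longleftrightarrow> finite I \<and> (\<forall>(u, v)\<in>I. u < v) \<and>
    (\<forall>p\<in>I. \<forall>q\<in>I. p \<noteq> q \<longrightarrow> {fst p<..<snd p} \<inter> {fst q<..<snd q} = {})"

definition len :: "(real \<times> real) set \<Rightarrow> real"
  where "len I = (\<Sum>p\<in>I. snd p - fst p)"

definition incr :: "(real \<Rightarrow> real) \<Rightarrow> (real \<times> real) set \<Rightarrow> real"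
  where "incr f I = (\<Sum>p\<in>I. \<bar>f (snd p) - f (fst p)\<bar>)"

definition within_iv :: "(real \<times> real) set \<Rightarrow> real \<Rightarrow> real \<Rightarrow> bool"
  where "within_iv I a b \<longleftrightarrow> (\<forall>p\<in>I. a \<le> fst p \<and> snd p \<le> b)"

text \<open>Absolute continuity on the whole line, with sets in place of indexed families so that
  they can be split and united. A function on \<open>{a..b}\<close> enters by clamping its
  argument.\<close>

definition abs_cont :: "(real \<Rightarrow> real) \<Rightarrow> bool"
  where "abs_cont f \<longleftrightarrow> (\<forall>e>0. \<exists>d>0. \<forall>I. nonoverlapping I \<and> len I < d \<longrightarrow> incr f I < e)"

lemma abs_contD:
  assumes "abs_cont f" "0 < e"
  shows "\<exists>d>0. \<forall>I. nonoverlapping I \<longrightarrow> len I < d \<longrightarrow> incr f I < e"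
  using assms unfolding abs_cont_def by blast

lemma nonoverlapping_subset: "nonoverlapping I \<Longrightarrow> J \<subseteq> I \<Longrightarrow> nonoverlapping J"
  unfolding nonoverlapping_def by (meson finite_subset subsetD)

lemma nonoverlapping_single: "u < v \<Longrightarrow> nonoverlapping {(u, v)}"
  by (simp add: nonoverlapping_def)

lemma nonoverlapping_empty [simp]: "nonoverlapping {}"
  by (simp add: nonoverlapping_def)

lemma nonoverlappingD:
  assumes "nonoverlapping I"
  shows "finite I" "p \<in> I \<Longrightarrow> fst p < snd p"
    "p \<in> I \<Longrightarrow> q \<in> I \<Longrightarrow> p \<noteq> q \<Longrightarrow> {fst p<..<snd p} \<inter> {fst q<..<snd q} = {}"
  using assms unfolding nonoverlapping_def by (auto simp: split_beta)

lemma nonoverlappingI: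
  assumes "finite I" "\<And>p. p \<in> I \<Longrightarrow> fst p < snd p"
    "\<And>p q. p \<in> I \<Longrightarrow> q \<in> I \<Longrightarrow> p \<noteq> q \<Longrightarrow> {fst p<..<snd p} \<inter> {fst q<..<snd q} = {}"
  shows "nonoverlapping I"
  using assms unfolding nonoverlapping_def by (auto simp: split_beta)

lemma nonoverlapping_UN:
  assumes E: "nonoverlapping E"
    and J: "\<And>e. e \<in> E \<Longrightarrow> nonoverlapping (J e)" "\<And>e. e \<in> E \<Longrightarrow> within_iv (J e) (fst e) (snd e)"
  shows "nonoverlapping (\<Union>e\<in>E. J e)" "disjoint_family_on J E"
proof -
  have *: "{fst p<..<snd p} \<inter> {fst q<..<snd q} = {}"
    if "e \<in> E" "e' \<in> E" "e \<noteq> e'" "p \<in> J e" "q \<in> J e'" for e e' p q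
  proof -
    have "{fst p<..<snd p} \<subseteq> {fst e<..<snd e}" "{fst q<..<snd q} \<subseteq> {fst e'<..<snd e'}"
      using J(2) that unfolding within_iv_def by fastforce+
    then show ?thesis using nonoverlappingD(3)[OF E that(1,2,3)] by blast
  qed
  show "nonoverlapping (\<Union>e\<in>E. J e)"
  proof (rule nonoverlappingI)
    show "finite (\<Union>e\<in>E. J e)" using nonoverlappingD(1) E J(1) by blast
    show "fst p < snd p" if "p \<in> (\<Union>e\<in>E. J e)" for p
      using that nonoverlappingD(2)[OF J(1)] by blast
    show "{fst p<..<snd p} \<inter> {fst q<..<snd q} = {}"
      if pq: "p \<in> (\<Union>e\<in>E. J e)" "q \<in> (\<Union>e\<in>E. J e)" "p \<noteq> q" for p q
    proof -
      obtain e e' where "e \<in> E" "e' \<in> E" "p \<in> J e" "q \<in> J e'" using pq by blast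
      then show ?thesis
        using * nonoverlappingD(3)[OF J(1)] \<open>p \<noteq> q\<close> by (cases "e = e'") blast+
    qed
  qed
  show "disjoint_family_on J E"
    unfolding disjoint_family_on_def
  proof (intro ballI impI equals0I)
    fix e e' p assume e: "e \<in> E" "e' \<in> E" "e \<noteq> e'" "p \<in> J e \<inter> J e'"
    then have "{fst p<..<snd p} = {}" using *[of e e' p p] by blast
    moreover have "fst p < snd p" using nonoverlappingD(2)[OF J(1)] e by blast
    ultimately show False by (simp add: greaterThanLessThan_empty_iff)
  qed
qed

text \<open>At most one interval of a nonoverlapping family contains \<open>x\<close> in its
  interior. Cutting it there does not decrease the sum of increments, by the triangle
  inequality.\<close>

lemma split_at:
  assumes I: "nonoverlapping I" "within_iv I a y"
  obtains I1 I2 where "nonoverlapping I1" "within_iv I1 a x" "nonoverlapping I2" "within_iv I2 x y"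
    "incr f I \<le> incr f I1 + incr f I2"
proof -
  define A where "A = {p \<in> I. snd p \<le> x}"
  define B where "B = {p \<in> I. x \<le> fst p}"
  define C where "C = {p \<in> I. fst p < x \<and> x < snd p}"
  have fin: "finite A" "finite B" "finite C" using nonoverlappingD(1)[OF I(1)] by (auto simp: A_def B_def C_def)
  have I_eq: "I = A \<union> B \<union> C" by (auto simp: A_def B_def C_def)
  have ABC: "A \<inter> B = {}" "(A \<union> B) \<inter> C = {}"
    using nonoverlappingD(2)[OF I(1)] by (fastforce simp: A_def B_def C_def)+
  have nA: "nonoverlapping A" "within_iv A a x" and nB: "nonoverlapping B" "within_iv B x y"
    using I nonoverlapping_subset[OF I(1)] by (auto simp: A_def B_def within_iv_def)
  have inc: "incr f I = incr f A + incr f B + incr f C"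
    unfolding incr_def I_eq using ABC fin by (simp add: sum.union_disjoint)
  have "C = {} \<or> (\<exists>p. C = {p})"
  proof -
    have "p = q" if "p \<in> C" "q \<in> C" for p q
    proof (rule ccontr)
      assume "p \<noteq> q"
      then have "{fst p<..<snd p} \<inter> {fst q<..<snd q} = {}"
        using nonoverlappingD(3)[OF I(1)] that by (simp add: C_def)
      moreover have "x \<in> {fst p<..<snd p} \<inter> {fst q<..<snd q}" using that by (simp add: C_def)
      ultimately show False by blast
    qed
    then show ?thesis by blast
  qed
  then consider "C = {}" | u v where "C = {(u, v)}" by (metis surj_pair)
  then show ?thesis
  proof cases
    case 1
    then show ?thesis using that[OF nA nB] inc by (simp add: incr_def)
  next
    case 2
    then have "(u, v) \<in> C" by simp
    then have uv: "u < x" "x < v" "(u, v) \<in> I" by (simp_all add: C_def)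
    have d: "{fst p<..<snd p} \<inter> {u<..<v} = {}" if "p \<in> A \<union> B" for p
    proof -
      have "p \<noteq> (u, v)" using that 2 ABC(2) by auto
      then show ?thesis using nonoverlappingD(3)[OF I(1) _ uv(3), of p] that by (auto simp: A_def B_def)
    qed
    have "nonoverlapping (insert (u, x) A)"
    proof (rule nonoverlappingI)
      show "{fst p<..<snd p} \<inter> {fst q<..<snd q} = {}"
        if "p \<in> insert (u, x) A" "q \<in> insert (u, x) A" "p \<noteq> q" for p q
        using that nonoverlappingD(3)[OF nA(1), of p q] d[of p] d[of q] uv by auto
    qed (use fin uv nonoverlappingD(2)[OF nA(1)] in auto)
    moreover have "nonoverlapping (insert (x, v) B)"
    proof (rule nonoverlappingI)
      show "{fst p<..<snd p} \<inter> {fst q<..<snd q} = {}"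
        if "p \<in> insert (x, v) B" "q \<in> insert (x, v) B" "p \<noteq> q" for p q
        using that nonoverlappingD(3)[OF nB(1), of p q] d[of p] d[of q] uv by auto
    qed (use fin uv nonoverlappingD(2)[OF nB(1)] in auto)
    moreover have "within_iv (insert (u, x) A) a x" "within_iv (insert (x, v) B) x y"
      using nA(2) nB(2) uv I(2) by (auto simp: within_iv_def)
    moreover have "incr f I \<le> incr f (insert (u, x) A) + incr f (insert (x, v) B)"
    proof -
      have "(u, x) \<notin> A" "(x, v) \<notin> B" using d[of "(u, x)"] d[of "(x, v)"] uv by auto
      then show ?thesis unfolding inc using fin by (simp add: incr_def 2)
    qed
    ultimately show ?thesis using that by blast
  qed
qed

text \<open>Without bounded variation, \<open>vari\<close> is the unspecified supremum of an unbounded set.\<close>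

definition vars :: "(real \<Rightarrow> real) \<Rightarrow> real \<Rightarrow> real \<Rightarrow> real set"
  where "vars f x y = {incr f I |I. nonoverlapping I \<and> within_iv I x y}"

definition vari :: "(real \<Rightarrow> real) \<Rightarrow> real \<Rightarrow> real \<Rightarrow> real"
  where "vari f x y = Sup (vars f x y)"

lemma zero_in_vars: "0 \<in> vars f x y"
  unfolding vars_def by (force simp: within_iv_def incr_def intro: exI[of _ "{}"])

text \<open>The open intervals are disjoint, so the total length is the Lebesgue measure of their
  union; this avoids sorting the intervals.\<close>

lemma within_len:
  assumes "nonoverlapping I" "within_iv I x y" "x \<le> y"
  shows "len I \<le> y - x"
proof -
  have f: "finite I" using nonoverlappingD(1)[OF assms(1)] .
  have "len I = (\<Sum>p\<in>I. measure lborel {fst p<..<snd p})"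
    unfolding len_def
    by (rule sum.cong) (simp_all add: nonoverlappingD(2)[OF assms(1)] less_imp_le)
  also have "\<dots> = measure lborel (\<Union>p\<in>I. {fst p<..<snd p})"
  proof (rule measure_finite_Union[symmetric, OF f])
    show "disjoint_family_on (\<lambda>p. {fst p<..<snd p}) I"
      using nonoverlappingD(3)[OF assms(1)] unfolding disjoint_family_on_def by blast
    show "emeasure lborel {fst p<..<snd p} \<noteq> \<infinity>" for p :: "real \<times> real"
      using emeasure_bounded_finite[of "{fst p<..<snd p}"] by simp
  qed auto
  also have "\<dots> \<le> measure lborel {x..y}"
  proof (rule measure_mono_fmeasurable)
    show "(\<Union>p\<in>I. {fst p<..<snd p}) \<subseteq> {x..y}"
    proof
      fix t assume "t \<in> (\<Union>p\<in>I. {fst p<..<snd p})"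
      then obtain p where "p \<in> I" "fst p < t" "t < snd p" by auto
      moreover from this(1) assms(2) have "x \<le> fst p" "snd p \<le> y" by (simp_all add: within_iv_def)
      ultimately show "t \<in> {x..y}" by simp
    qed
    show "{x..y} \<in> fmeasurable lborel" using emeasure_bounded_finite[OF bounded_closed_interval, of x y] by (simp add: fmeasurable_def)
  qed (simp add: borel_open open_UN)
  finally show ?thesis using assms(3) by simp
qed

section \<open>Variation of an absolutely continuous function\<close>

locale abs_cont_fun =
  fixes f :: "real \<Rightarrow> real"
  assumes ac: "abs_cont f"
begin

lemma vars_bdd: "bdd_above (vars f x y)"
proof -
  obtain d where d: "0 < d" "\<And>I. nonoverlapping I \<Longrightarrow> len I < d \<Longrightarrow> incr f I < 1"
    using abs_contD[OF ac zero_less_one] by blast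
  \<comment> \<open>Half of the admissible length is used per step, because
    \<open>within_len\<close> bounds a length only weakly while \<open>d\<close> is a strict bound.
    Each step then contributes less than 1.\<close>
  have *: "incr f I \<le> real n" if "nonoverlapping I" "within_iv I x (x + real n * (d / 2))" for n I
    using that
  proof (induction n arbitrary: I)
    case 0
    have "I = {}"
    proof (rule ccontr)
      assume "I \<noteq> {}"
      then obtain p where "p \<in> I" by blast
      then have "x \<le> fst p" "snd p \<le> x" "fst p < snd p"
        using 0(2) nonoverlappingD(2)[OF 0(1)] by (simp_all add: within_iv_def)
      then show False by linarith
    qed
    then show ?case by (simp add: incr_def)
  next
    case (Suc n)
    let ?m = "x + real n * (d / 2)"
    obtain I1 I2 where I: "nonoverlapping I1" "within_iv I1 x ?m" "nonoverlapping I2"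
      "within_iv I2 ?m (x + real (Suc n) * (d / 2))" "incr f I \<le> incr f I1 + incr f I2"
      using split_at[OF Suc.prems] by blast
    have "len I2 \<le> (x + real (Suc n) * (d / 2)) - ?m"
      using d(1) by (intro within_len I) (simp add: algebra_simps)
    also have "\<dots> < d" using d(1) by (simp add: algebra_simps)
    finally have "incr f I2 < 1" using d(2) I(3) by blast
    then show ?case using Suc.IH[OF I(1,2)] I(5) by simp
  qed
  obtain n :: nat where "(y - x) / (d / 2) \<le> real n" using real_arch_simple by blast
  then have n: "y \<le> x + real n * (d / 2)" using d(1) by (simp add: field_simps)
  have "incr f I \<le> real n" if "nonoverlapping I" "within_iv I x y" for I
    using that n by (intro *) (auto simp: within_iv_def)
  then show ?thesis unfolding vars_def by (intro bdd_aboveI[of _ "real n"]) auto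
qed

lemma vari_upper: "nonoverlapping I \<Longrightarrow> within_iv I x y \<Longrightarrow> incr f I \<le> vari f x y"
  unfolding vari_def by (intro cSup_upper vars_bdd) (auto simp: vars_def)

lemma vari_least: "(\<And>I. nonoverlapping I \<Longrightarrow> within_iv I x y \<Longrightarrow> incr f I \<le> c) \<Longrightarrow> vari f x y \<le> c"
  unfolding vari_def using zero_in_vars[of f x y] by (intro cSup_least) (auto simp: vars_def)

lemma vari_split: "vari f a y \<le> vari f a x + vari f x y"
proof (rule vari_least)
  fix I assume "nonoverlapping I" "within_iv I a y"
  then obtain I1 I2 where "nonoverlapping I1" "within_iv I1 a x" "nonoverlapping I2" "within_iv I2 x y"
    "incr f I \<le> incr f I1 + incr f I2" by (rule split_at)
  then show "incr f I \<le> vari f a x + vari f x y"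
    using vari_upper[of I1 a x] vari_upper[of I2 x y] by linarith
qed

lemma vari_append:
  assumes "a \<le> x" "x < y"
  shows "vari f a x + \<bar>f y - f x\<bar> \<le> vari f a y"
proof -
  have "vari f a x \<le> vari f a y - \<bar>f y - f x\<bar>"
  proof (rule vari_least)
    fix I assume I: "nonoverlapping I" "within_iv I a x"
    have new: "(x, y) \<notin> I" using I(2) assms by (auto simp: within_iv_def)
    have d: "{x<..<y} \<inter> {fst q<..<snd q} = {}" if "q \<in> I" for q
    proof -
      have "snd q \<le> x" using I(2) that by (simp add: within_iv_def)
      then show ?thesis by auto
    qed
    have "nonoverlapping (insert (x, y) I)"
    proof (rule nonoverlappingI)
      show "{fst p<..<snd p} \<inter> {fst q<..<snd q} = {}"
        if "p \<in> insert (x, y) I" "q \<in> insert (x, y) I" "p \<noteq> q" for p q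
        using that nonoverlappingD(3)[OF I(1), of p q] d[of p] d[of q] by auto
    qed (use nonoverlappingD(1,2)[OF I(1)] assms in auto)
    moreover have "within_iv (insert (x, y) I) a y"
      unfolding within_iv_def
    proof
      fix p assume "p \<in> insert (x, y) I"
      then consider "p = (x, y)" | "a \<le> fst p" "snd p \<le> x"
        using I(2) by (auto simp: within_iv_def)
      then show "a \<le> fst p \<and> snd p \<le> y" using assms by cases simp_all
    qed
    ultimately have "incr f (insert (x, y) I) \<le> vari f a y" by (rule vari_upper)
    then show "incr f I \<le> vari f a y - \<bar>f y - f x\<bar>"
      using new nonoverlappingD(1)[OF I(1)] by (simp add: incr_def)
  qed
  then show ?thesis by simp
qed

lemma vari_mono: "x \<le> y \<Longrightarrow> vari f a x \<le> vari f a y"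
  by (rule vari_least, rule vari_upper) (auto simp: within_iv_def)

text \<open>The variation over each interval of a short family is nearly attained by a finite family
  inside it. These families together are again nonoverlapping and no longer in total, so the
  absolute continuity of \<open>f\<close> bounds their joint increment.\<close>

lemma vari_abs_cont: "abs_cont (vari f a)"
  unfolding abs_cont_def
proof (intro allI impI)
  fix e :: real assume "0 < e"
  then have "0 < e / 2" by simp
  then obtain d where d: "0 < d" "\<And>I. nonoverlapping I \<Longrightarrow> len I < d \<Longrightarrow> incr f I < e / 2"
    using abs_contD[OF ac] by blast
  have "incr (vari f a) E < e" if E: "nonoverlapping E" "len E < d" for E
  proof -
    note fin = nonoverlappingD(1)[OF E(1)]
    \<comment> \<open>Half of e is distributed over the intervals; the summand 1 keeps the quotient
      meaningful for an empty \<open>E\<close>.\<close>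
    define \<eta> where "\<eta> = e / 2 / (real (card E) + 1)"
    have \<eta>: "0 < \<eta>" using \<open>0 < e\<close> by (simp add: \<eta>_def)
    have "\<exists>I. nonoverlapping I \<and> within_iv I (fst p) (snd p) \<and> vari f (fst p) (snd p) < incr f I + \<eta>" for p
    proof -
      have "\<exists>y\<in>vars f (fst p) (snd p). Sup (vars f (fst p) (snd p)) - \<eta> < y"
        using \<eta> zero_in_vars by (intro less_cSupD) auto
      then show ?thesis unfolding vars_def vari_def by (force simp: algebra_simps)
    qed
    then obtain J where J: "\<And>p. nonoverlapping (J p)" "\<And>p. within_iv (J p) (fst p) (snd p)"
      "\<And>p. vari f (fst p) (snd p) < incr f (J p) + \<eta>" by metis
    note U = nonoverlapping_UN[of E J, OF E(1) J(1,2)]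
    have fJ: "finite (J p)" for p using nonoverlappingD(1)[OF J(1)] .
    have disj: "\<forall>i\<in>E. \<forall>j\<in>E. i \<noteq> j \<longrightarrow> J i \<inter> J j = {}" using U(2) by (auto simp: disjoint_family_on_def)
    have "len (\<Union>p\<in>E. J p) = (\<Sum>p\<in>E. len (J p))"
      unfolding len_def using fin fJ disj by (intro sum.UNION_disjoint) auto
    also have "\<dots> \<le> len E"
      unfolding len_def[of E] using nonoverlappingD(2)[OF E(1)] J(1,2)
      by (intro sum_mono within_len) (auto intro: less_imp_le)
    finally have "incr f (\<Union>p\<in>E. J p) < e / 2" using d(2)[OF U(1)] E(2) by simp
    moreover have "incr f (\<Union>p\<in>E. J p) = (\<Sum>p\<in>E. incr f (J p))"
      unfolding incr_def using fin fJ disj by (intro sum.UNION_disjoint) auto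
    moreover have "incr (vari f a) E \<le> (\<Sum>p\<in>E. incr f (J p) + \<eta>)"
      unfolding incr_def[of "vari f a"]
    proof (rule sum_mono)
      fix p assume "p \<in> E"
      then have "fst p \<le> snd p" using nonoverlappingD(2)[OF E(1)] by (simp add: less_imp_le)
      then show "\<bar>vari f a (snd p) - vari f a (fst p)\<bar> \<le> incr f (J p) + \<eta>"
        using vari_mono[of "fst p" "snd p" a] vari_split[of a "snd p" "fst p"] J(3)[of p] by linarith
    qed
    moreover have "real (card E) * \<eta> \<le> e / 2"
    proof -
      define m where "m = real (card E) + 1"
      have m: "0 < m" "real (card E) \<le> m" by (simp_all add: m_def add_nonneg_pos)
      have "real (card E) * \<eta> \<le> m * \<eta>" using \<eta> m(2) by (simp add: mult_right_mono)
      also have "\<dots> = e / 2" using m(1) by (simp add: \<eta>_def flip: m_def)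
      finally show ?thesis .
    qed
    ultimately show ?thesis by (simp add: sum.distrib)
  qed
  then show "\<exists>d>0. \<forall>E. nonoverlapping E \<and> len E < d \<longrightarrow> incr (vari f a) E < e"
    using d(1) by blast
qed

end

lemma abs_cont_add:
  assumes "abs_cont f" "abs_cont g"
  shows "abs_cont (\<lambda>x. f x + g x)"
  unfolding abs_cont_def
proof (intro allI impI)
  fix e :: real assume "0 < e"
  then have e: "0 < e / 2" by simp
  obtain d where d: "0 < d" "\<And>I. nonoverlapping I \<Longrightarrow> len I < d \<Longrightarrow> incr f I < e / 2"
    using abs_contD[OF assms(1) e] by blast
  obtain d' where d': "0 < d'" "\<And>I. nonoverlapping I \<Longrightarrow> len I < d' \<Longrightarrow> incr g I < e / 2"
    using abs_contD[OF assms(2) e] by blast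
  have le: "incr (\<lambda>x. f x + g x) I \<le> incr f I + incr g I" for I
    unfolding incr_def sum.distrib[symmetric] by (intro sum_mono) linarith
  have "incr (\<lambda>x. f x + g x) I < e" if "nonoverlapping I" "len I < min d d'" for I
  proof -
    have "incr f I < e / 2" "incr g I < e / 2"
      using d(2)[OF that(1)] d'(2)[OF that(1)] that(2) by simp_all
    then show ?thesis using le[of I] by linarith
  qed
  then show "\<exists>d>0. \<forall>I. nonoverlapping I \<and> len I < d \<longrightarrow> incr (\<lambda>x. f x + g x) I < e"
    using d(1) d'(1) by (intro exI[of _ "min d d'"]) auto
qed

lemma abs_cont_continuous:
  assumes "abs_cont f"
  shows "continuous_on UNIV f"
  unfolding continuous_on_iff
proof (intro ballI allI impI)
  fix x e :: real assume "0 < e"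
  then obtain d where d: "0 < d" "\<And>I. nonoverlapping I \<Longrightarrow> len I < d \<Longrightarrow> incr f I < e"
    using abs_contD[OF assms] by blast
  have "dist (f y) (f x) < e" if "dist y x < d" for y
  proof (cases rule: linorder_cases[of x y])
    case less
    then show ?thesis using d(2)[OF nonoverlapping_single[OF less]] that
      by (simp add: len_def incr_def dist_real_def)
  next
    case greater
    then show ?thesis using d(2)[OF nonoverlapping_single[OF greater]] that
      by (simp add: len_def incr_def dist_real_def abs_minus_commute)
  qed (use \<open>0 < e\<close> in simp)
  then show "\<exists>d>0. \<forall>x'\<in>UNIV. dist x' x < d \<longrightarrow> dist (f x') (f x) < e" using d(1) by blast
qed

text \<open>The Stieltjes measure of \<open>G\<close> is absolutely continuous with respect to
  Lebesgue measure, so Radon-Nikodym gives a density. For a null set, outer regularity provides an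
  open superset of small Lebesgue measure, and absolute continuity of \<open>G\<close> makes its
  Stieltjes measure small.\<close>

lemma mono_abs_cont_density:
  assumes ac: "abs_cont G" and mono: "\<And>x y. x \<le> y \<Longrightarrow> G x \<le> G y"
  obtains \<phi> :: "real \<Rightarrow> ennreal" where "\<phi> \<in> borel_measurable borel"
    "\<And>x y. x \<le> y \<Longrightarrow> (\<integral>\<^sup>+t\<in>{x..y}. \<phi> t \<partial>lborel) = ennreal (G y - G x)"
proof -
  have cont: "continuous_on UNIV G" by (rule abs_cont_continuous[OF ac])
  let ?\<mu> = "interval_measure G"
  have Icc: "emeasure ?\<mu> {x..y} = ennreal (G y - G x)" if "x \<le> y" for x y
    using emeasure_interval_measure_Icc[OF that mono cont] .
  \<comment> \<open>An open set is the increasing union of finite unions of boxes. Each finite union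
    has a division, and its nondegenerate members form a nonoverlapping family of total length below
    d.\<close>
  have small: "emeasure ?\<mu> U \<le> ennreal e" if U: "open U" "emeasure lborel U < ennreal d" and "0 < d"
    and d: "\<And>I. nonoverlapping I \<Longrightarrow> len I < d \<Longrightarrow> incr G I < e" for U d e
  proof -
    obtain \<D> where \<D>: "countable \<D>" "\<D> \<subseteq> Pow U" "\<And>X. X \<in> \<D> \<Longrightarrow> \<exists>a b. X = cbox a b" "\<Union>\<D> = U"
      using open_countable_Union_open_cbox[OF U(1)] by metis
    have fin: "emeasure ?\<mu> (\<Union>\<F>) \<le> ennreal e" if \<F>: "finite \<F>" "\<F> \<subseteq> \<D>" for \<F>
    proof -
      obtain p where p: "p division_of \<Union>\<F>"
        using elementary_unions_intervals[OF \<F>(1)] \<D>(3) \<F>(2) by blast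
      define I where "I = {(u, v). u < v \<and> cbox u v \<in> p}"
      have inj: "inj_on (\<lambda>q. {fst q..snd q}) I" by (auto simp: inj_on_def I_def Icc_eq_Icc)
      have "(\<lambda>q. {fst q..snd q}) ` I \<subseteq> p" by (auto simp: I_def)
      then have "finite I" using finite_imageD[OF finite_subset inj] division_ofD(1)[OF p] by blast
      then have I: "nonoverlapping I"
      proof (rule nonoverlappingI)
        fix q r assume qr: "q \<in> I" "r \<in> I" "q \<noteq> r"
        then have "cbox (fst q) (snd q) \<noteq> cbox (fst r) (snd r)" by (auto simp: I_def Icc_eq_Icc)
        then show "{fst q<..<snd q} \<inter> {fst r<..<snd r} = {}"
          using division_ofD(5)[OF p, of "cbox (fst q) (snd q)" "cbox (fst r) (snd r)"] qr
          by (auto simp: I_def)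
      qed (auto simp: I_def)
      have "ennreal (len I) = (\<Sum>q\<in>I. ennreal (snd q - fst q))"
        unfolding len_def by (rule sum_ennreal[symmetric]) (simp add: nonoverlappingD(2)[OF I] less_imp_le)
      also have "\<dots> = (\<Sum>q\<in>I. emeasure lborel {fst q<..<snd q})"
        by (rule sum.cong) (simp_all add: nonoverlappingD(2)[OF I] less_imp_le)
      also have "\<dots> = emeasure lborel (\<Union>q\<in>I. {fst q<..<snd q})"
      proof (rule sum_emeasure)
        show "disjoint_family_on (\<lambda>q. {fst q<..<snd q}) I"
          using nonoverlappingD(3)[OF I] unfolding disjoint_family_on_def by blast
      qed (use nonoverlappingD(1)[OF I] in auto)
      also have "\<dots> \<le> emeasure lborel U"
      proof (rule emeasure_mono)
        have "{fst q<..<snd q} \<subseteq> \<Union>\<F>" if "q \<in> I" for q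
        proof -
          have "cbox (fst q) (snd q) \<in> p" using that by (simp add: I_def split_beta)
          then have "cbox (fst q) (snd q) \<subseteq> \<Union>\<F>" by (rule division_ofD(2)[OF p])
          then show ?thesis by (auto simp: subset_iff)
        qed
        then show "(\<Union>q\<in>I. {fst q<..<snd q}) \<subseteq> U" using \<F>(2) \<D>(4) by blast
      qed (use U(1) in simp)
      finally have "ennreal (len I) < ennreal d" using U(2) by (rule le_less_trans)
      then have "len I < d" using \<open>0 < d\<close> by (simp add: ennreal_less_iff len_def sum_nonneg nonoverlappingD(2)[OF I] less_imp_le)
      from d[OF I this] have inc: "incr G I < e" .
      have "emeasure ?\<mu> (\<Union>\<F>) = emeasure ?\<mu> (\<Union>k\<in>p. k)" using division_ofD(6)[OF p] by simp
      also have "\<dots> \<le> (\<Sum>k\<in>p. emeasure ?\<mu> k)"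
      proof (rule emeasure_subadditive_finite[OF division_ofD(1)[OF p]])
        have "k \<in> sets borel" if k: "k \<in> p" for k
        proof -
          obtain u v where "k = cbox u v" using division_ofD(4)[OF p k] by blast
          then show ?thesis by simp
        qed
        then show "(\<lambda>k. k) ` p \<subseteq> sets ?\<mu>" by auto
      qed
      also have "\<dots> = (\<Sum>k\<in>(\<lambda>q. {fst q..snd q}) ` I. emeasure ?\<mu> k)"
      proof (rule sum.mono_neutral_right)
        \<comment> \<open>The remaining members of the division are single points; the Stieltjes
          measure of a point is 0 because \<open>G\<close> is continuous.\<close>
        show "\<forall>k\<in>p - (\<lambda>q. {fst q..snd q}) ` I. emeasure ?\<mu> k = 0"
        proof
          fix k assume k: "k \<in> p - (\<lambda>q. {fst q..snd q}) ` I"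
          then obtain u v where uv: "k = {u..v}" using division_ofD(4)[OF p, of k] by auto
          then have "u \<le> v" using k division_ofD(3)[OF p, of k] by auto
          moreover have "\<not> u < v" using k uv by (force simp: I_def)
          ultimately show "emeasure ?\<mu> k = 0" using Icc[of u v] uv by simp
        qed
      qed (use division_ofD(1)[OF p] in \<open>auto simp: I_def\<close>)
      also have "\<dots> = (\<Sum>q\<in>I. emeasure ?\<mu> {fst q..snd q})" by (simp add: sum.reindex[OF inj])
      also have "\<dots> = (\<Sum>q\<in>I. ennreal \<bar>G (snd q) - G (fst q)\<bar>)"
      proof (rule sum.cong)
        fix q assume "q \<in> I"
        then have "fst q \<le> snd q" using nonoverlappingD(2)[OF I] by (simp add: less_imp_le)
        then show "emeasure ?\<mu> {fst q..snd q} = ennreal \<bar>G (snd q) - G (fst q)\<bar>"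
          using Icc mono by simp
      qed simp
      also have "\<dots> = ennreal (incr G I)" unfolding incr_def by (rule sum_ennreal) simp
      also have "\<dots> \<le> ennreal e" using inc by (simp add: ennreal_leI)
      finally show ?thesis .
    qed
    show ?thesis
    proof (cases "\<D> = {}")
      case True
      then show ?thesis using \<D>(4) by simp
    next
      case False
      define D where "D = from_nat_into \<D>"
      have D: "range D = \<D>" unfolding D_def by (rule range_from_nat_into[OF False \<D>(1)])
      have "U = (\<Union>n. \<Union>(D ` {..n}))" using D \<D>(4) by auto
      moreover have "(SUP n. emeasure ?\<mu> (\<Union>(D ` {..n}))) = emeasure ?\<mu> (\<Union>n. \<Union>(D ` {..n}))"
      proof (rule SUP_emeasure_incseq)
        have "\<Union>(D ` {..n}) \<in> sets borel" for n
        proof (rule sets.finite_Union)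
          show "D ` {..n} \<subseteq> sets borel"
          proof
            fix X assume "X \<in> D ` {..n}"
            then have "X \<in> \<D>" using D by blast
            then obtain u v where "X = cbox u v" using \<D>(3) by blast
            then show "X \<in> sets borel" by simp
          qed
        qed simp
        then show "range (\<lambda>n. \<Union>(D ` {..n})) \<subseteq> sets ?\<mu>" by auto
        show "incseq (\<lambda>n. \<Union>(D ` {..n}))"
          unfolding incseq_def by (intro allI impI Union_mono image_mono) simp
      qed
      moreover have "(SUP n. emeasure ?\<mu> (\<Union>(D ` {..n}))) \<le> ennreal e"
        using D by (intro SUP_least fin) auto
      ultimately show ?thesis by simp
    qed
  qed
  have "absolutely_continuous lborel ?\<mu>"
    unfolding absolutely_continuous_def
  proof
    fix A :: "real set" assume A: "A \<in> null_sets lborel"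
    then have Ab: "A \<in> sets borel" "emeasure lborel A = 0" by (auto simp: null_sets_def)
    have le: "emeasure ?\<mu> A \<le> 0 + ennreal e" if "0 < e" for e :: real
    proof -
      obtain d where d: "0 < d" "\<And>I. nonoverlapping I \<Longrightarrow> len I < d \<Longrightarrow> incr G I < e"
        using abs_contD[OF ac \<open>0 < e\<close>] by blast
      obtain U where U: "open U" "A \<subseteq> U" "emeasure lborel (U - A) < ennreal d"
        using outer_regular_lborel[OF Ab(1) d(1)] by metis
      have "emeasure lborel U \<le> emeasure lborel (U - A) + emeasure lborel A"
        using U Ab by (subst plus_emeasure) (auto simp: Un_absorb2)
      then have "emeasure lborel U < ennreal d" using U(3) Ab(2) by simp
      from small[OF U(1) this d] have "emeasure ?\<mu> U \<le> ennreal e" .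
      moreover have "emeasure ?\<mu> A \<le> emeasure ?\<mu> U" using U by (intro emeasure_mono) auto
      ultimately show ?thesis by simp
    qed
    have "emeasure ?\<mu> A \<le> 0" by (rule ennreal_le_epsilon) (rule le)
    then show "A \<in> null_sets ?\<mu>" using Ab by (auto simp: null_sets_def)
  qed
  moreover have "sets ?\<mu> = sets lborel" by simp
  ultimately have "\<exists>\<phi>\<in>borel_measurable lborel. density lborel \<phi> = ?\<mu>"
    by (rule sigma_finite_measure.Radon_Nikodym[OF sigma_finite_lborel])
  then
  obtain \<phi> where \<phi>: "\<phi> \<in> borel_measurable lborel" "density lborel \<phi> = ?\<mu>" by blast
  have "(\<integral>\<^sup>+t\<in>{x..y}. \<phi> t \<partial>lborel) = ennreal (G y - G x)" if "x \<le> y" for x y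
    using Icc[OF that] emeasure_density[OF \<phi>(1), of "{x..y}"] unfolding \<phi>(2) by simp
  then show ?thesis using \<phi>(1) by (intro that[of \<phi>]) auto
qed


section \<open>Primitives and derivatives almost everywhere\<close>

lemma density_integral:
  fixes \<phi> :: "real \<Rightarrow> ennreal"
  assumes \<phi>: "\<phi> \<in> borel_measurable borel" and c: "0 \<le> c"
    and int: "(\<integral>\<^sup>+t\<in>{x..y}. \<phi> t \<partial>lborel) = ennreal c"
  shows "set_integrable lborel {x..y} (\<lambda>t. enn2real (\<phi> t))"
    "(LINT t:{x..y}|lborel. enn2real (\<phi> t)) = c"
proof -
  let ?g = "\<lambda>t. indicator {x..y} t * enn2real (\<phi> t)"
  have m: "(\<lambda>t. \<phi> t * indicator {x..y} t) \<in> borel_measurable lborel"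
    "?g \<in> borel_measurable lborel" using \<phi> by measurable
  have "AE t in lborel. \<phi> t * indicator {x..y} t \<noteq> \<infinity>"
    using int by (intro nn_integral_PInf_AE[OF m(1)]) simp
  then have "AE t in lborel. ennreal (?g t) = \<phi> t * indicator {x..y} t"
    by eventually_elim (auto simp: indicator_def less_top)
  then have nn: "(\<integral>\<^sup>+t. ennreal (?g t) \<partial>lborel) = ennreal c"
    using int by (simp cong: nn_integral_cong_AE)
  have "integrable lborel ?g"
    using nn by (intro integrableI_nonneg m(2)) auto
  then show "set_integrable lborel {x..y} (\<lambda>t. enn2real (\<phi> t))"
    by (simp add: set_integrable_def)
  have "integral\<^sup>L lborel ?g = c"
    using integral_eq_nn_integral[OF m(2)] nn c by simp
  then show "(LINT t:{x..y}|lborel. enn2real (\<phi> t)) = c"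
    by (simp add: set_lebesgue_integral_def)
qed

text \<open>The Jordan decomposition f = (V + f) - V with V the variation from \<open>a\<close>.
  Both parts are increasing and absolutely continuous, so each has a density. Left of
  \<open>a\<close> the variation from \<open>a\<close> does not control f, whence the hypothesis
  \<open>left\<close>.\<close>

lemma abs_cont_primitive:
  assumes ac: "abs_cont f" and left: "\<And>x. x \<le> a \<Longrightarrow> f x = f a"
  obtains h where "h \<in> borel_measurable borel" "\<And>x y. x \<le> y \<Longrightarrow> set_integrable lborel {x..y} h"
    "\<And>x y. x \<le> y \<Longrightarrow> (LINT t:{x..y}|lborel. h t) = f y - f x"
proof -
  interpret abs_cont_fun f by unfold_locales (rule ac)
  let ?V = "vari f a"
  let ?G = "\<lambda>x. vari f a x + f x"
  \<comment> \<open>Right of \<open>a\<close>, V grows by at least |f y - f x|; left of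
    \<open>a\<close>, f is constant; an interval across \<open>a\<close> is treated as if it began
    at \<open>a\<close>.\<close>
  have mono: "?G x \<le> ?G y" if "x \<le> y" for x y
  proof (cases "x < y")
    case True
    show ?thesis
    proof (cases "a \<le> x")
      case True
      then show ?thesis using vari_append[OF True \<open>x < y\<close>] by linarith
    next
      case False
      show ?thesis
      proof (cases "a < y")
        case True
        then show ?thesis
          using vari_append[OF order_refl True] vari_mono[of x a a] left[of x] False by linarith
      next
        case F: False
        then show ?thesis using vari_mono[OF that, of a] left[of x] left[of y] False by simp
      qed
    qed
  qed (use that in simp)
  obtain \<phi> where \<phi>: "\<phi> \<in> borel_measurable borel"
    "\<And>x y. x \<le> y \<Longrightarrow> (\<integral>\<^sup>+t\<in>{x..y}. \<phi> t \<partial>lborel) = ennreal (?G y - ?G x)"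
    by (rule mono_abs_cont_density[OF abs_cont_add[OF vari_abs_cont ac] mono]) blast+
  obtain \<psi> where \<psi>: "\<psi> \<in> borel_measurable borel"
    "\<And>x y. x \<le> y \<Longrightarrow> (\<integral>\<^sup>+t\<in>{x..y}. \<psi> t \<partial>lborel) = ennreal (?V y - ?V x)"
    by (rule mono_abs_cont_density[OF vari_abs_cont vari_mono]) blast+
  have G: "0 \<le> ?G y - ?G x" "0 \<le> ?V y - ?V x" if "x \<le> y" for x y
    using mono[OF that] vari_mono[OF that, of a] by simp_all
  show ?thesis
  proof (rule that[of "\<lambda>t. enn2real (\<phi> t) - enn2real (\<psi> t)"])
    show "(\<lambda>t. enn2real (\<phi> t) - enn2real (\<psi> t)) \<in> borel_measurable borel"
      using \<phi>(1) \<psi>(1) by measurable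
    fix x y :: real assume xy: "x \<le> y"
    note 1 = density_integral[OF \<phi>(1) G(1)[OF xy] \<phi>(2)[OF xy]]
    note 2 = density_integral[OF \<psi>(1) G(2)[OF xy] \<psi>(2)[OF xy]]
    show "set_integrable lborel {x..y} (\<lambda>t. enn2real (\<phi> t) - enn2real (\<psi> t))"
      by (rule set_integral_diff(1)[OF 1(1) 2(1)])
    show "(LINT t:{x..y}|lborel. enn2real (\<phi> t) - enn2real (\<psi> t)) = f y - f x"
      using set_integral_diff(2)[OF 1(1) 2(1)] 1(2) 2(2) by simp
  qed
qed

text \<open>The Lebesgue differentiation theorem as used here concerns averages over intervals that
  start at the point, which controls difference quotients from the right. Applying it also to the
  reflected function controls those from the left.\<close>

lemma primitive_ae_derivative:
  fixes f h :: "real \<Rightarrow> real"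
  assumes h: "\<And>x y. x \<le> y \<Longrightarrow> (h has_integral f y - f x) {x..y}"
  obtains N where "negligible N" "\<And>x. x \<notin> N \<Longrightarrow> (f has_real_derivative h x) (at x)"
proof -
  have int: "h integrable_on cbox a b" for a b
    using h[of a b] by (cases "a \<le> b") (auto simp: integrable_on_def)
  have refl: "((\<lambda>t. h (- t)) has_integral f (- x) - f (- y)) {x..y}" if "x \<le> y" for x y
    using h[of "- y" "- x"] that has_integral_reflect_real[of h "f (- x) - f (- y)" "- x" "- y"] by simp
  have int': "(\<lambda>t. h (- t)) integrable_on cbox a b" for a b
    using refl[of a b] by (cases "a \<le> b") (auto simp: integrable_on_def)
  obtain N1 where N1: "negligible N1" "\<And>x e. x \<notin> N1 \<Longrightarrow> 0 < e \<Longrightarrow>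
      \<exists>d>0. \<forall>k. 0 < k \<and> k < d \<longrightarrow> norm (integral (cbox x (x + k *\<^sub>R One)) h /\<^sub>R k ^ DIM(real) - h x) < e"
    using integrable_ccontinuous_explicit[of h] int by blast
  obtain N2 where N2: "negligible N2" "\<And>x e. x \<notin> N2 \<Longrightarrow> 0 < e \<Longrightarrow>
      \<exists>d>0. \<forall>k. 0 < k \<and> k < d \<longrightarrow> norm (integral (cbox x (x + k *\<^sub>R One)) (\<lambda>t. h (- t)) /\<^sub>R k ^ DIM(real) - h (- x)) < e"
    using integrable_ccontinuous_explicit[of "\<lambda>t. h (- t)"] int' by blast
  have "(uminus :: real \<Rightarrow> real) differentiable_on N2"
    by (rule linear_imp_differentiable_on[OF linear_uminus])
  from negligible_Un[OF N1(1) negligible_differentiable_image_negligible[OF order_refl N2(1) this]]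
  have neg: "negligible (N1 \<union> uminus ` N2)" .
  have "(f has_real_derivative h x) (at x)" if x: "x \<notin> N1 \<union> uminus ` N2" for x
    unfolding DERIV_def
  proof (rule LIM_I)
    fix e :: real assume e: "0 < e"
    obtain d1 where d1: "0 < d1" "\<And>k. 0 < k \<Longrightarrow> k < d1 \<Longrightarrow> \<bar>(f (x + k) - f x) / k - h x\<bar> < e"
    proof -
      obtain d where d: "d > 0" "\<forall>k. 0 < k \<and> k < d \<longrightarrow>
          norm (integral (cbox x (x + k *\<^sub>R One)) h /\<^sub>R k ^ DIM(real) - h x) < e"
        using N1(2)[OF _ e] x by blast
      have "integral {x..x + k} h = f (x + k) - f x" if "0 < k" for k
        using h[of x "x + k"] that by (intro integral_unique) simp
      then show ?thesis using that[of d] d by (simp add: divide_inverse mult.commute)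
    qed
    obtain d2 where d2: "0 < d2" "\<And>k. 0 < k \<Longrightarrow> k < d2 \<Longrightarrow> \<bar>(f x - f (x - k)) / k - h x\<bar> < e"
    proof -
      have "- x \<notin> N2" using x by force
      then obtain d where d: "d > 0" "\<forall>k. 0 < k \<and> k < d \<longrightarrow>
          norm (integral (cbox (- x) (- x + k *\<^sub>R One)) (\<lambda>t. h (- t)) /\<^sub>R k ^ DIM(real) - h (- (- x))) < e"
        using N2(2)[OF _ e] by blast
      have "integral {- x..- x + k} (\<lambda>t. h (- t)) = f x - f (x - k)" if "0 < k" for k
        using refl[of "- x" "- x + k"] that by (intro integral_unique) simp
      then show ?thesis using that[of d] d by (simp add: divide_inverse mult.commute)
    qed
    have "\<bar>(f (x + k) - f x) / k - h x\<bar> < e" if "k \<noteq> 0" "\<bar>k\<bar> < min d1 d2" for k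
    proof (cases "0 < k")
      case True
      then show ?thesis using d1(2)[of k] that by simp
    next
      case False
      have "(f (x + k) - f x) / k = (f x - f (x - (- k))) / (- k)"
        using that(1) by (simp add: field_simps)
      then show ?thesis using d2(2)[of "- k"] that False by simp
    qed
    then show "\<exists>s>0. \<forall>k. k \<noteq> 0 \<and> norm (k - 0) < s \<longrightarrow> norm ((f (x + k) - f x) / k - h x) < e"
      using d1(1) d2(1) by (intro exI[of _ "min d1 d2"]) auto
  qed
  then show ?thesis using that neg by blast
qed

text \<open>Clamping is monotone and shortens distances, so it turns a nonoverlapping family on the
  line into an admissible one on \<open>{a..b}\<close>. Intervals collapsed to points do no harm,
  since \<open>abs_continuous\<close> admits them.\<close>

lemma abs_continuous_clamp:
  assumes f: "abs_continuous a b f" and ab: "a \<le> b"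
  shows "abs_cont (\<lambda>x. f (max a (min b x)))"
  unfolding abs_cont_def
proof (intro allI impI)
  fix e :: real assume "0 < e"
  then obtain d where d: "0 < d" "\<And>(m::nat) u v.
       (\<forall>i<m. a \<le> u i \<and> u i \<le> v i \<and> v i \<le> b) \<and>
       (\<forall>i<m. \<forall>j<m. i \<noteq> j \<longrightarrow> {u i<..<v i} \<inter> {u j<..<v j} = {}) \<and>
       (\<Sum>i<m. v i - u i) < d \<Longrightarrow> (\<Sum>i<m. \<bar>f (v i) - f (u i)\<bar>) < e"
    using f unfolding abs_continuous_def by blast
  define c where "c x = max a (min b x)" for x
  have "incr (\<lambda>x. f (c x)) I < e" if I: "nonoverlapping I" "len I < d" for I
  proof -
    obtain p where p: "bij_betw p {0..<card I} I"
      using ex_bij_betw_nat_finite[OF nonoverlappingD(1)[OF I(1)]] by blast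
    have p': "bij_betw p {..<card I} I" using p by (simp add: atLeast0LessThan)
    have pI: "p i \<in> I" if "i < card I" for i using p' that by (auto simp: bij_betw_def)
    let ?u = "\<lambda>i. c (fst (p i))" and ?v = "\<lambda>i. c (snd (p i))"
    have "(\<Sum>i<card I. \<bar>f (?v i) - f (?u i)\<bar>) < e"
    proof (rule d(2), intro conjI allI impI)
      fix i assume i: "i < card I"
      have "fst (p i) < snd (p i)" using nonoverlappingD(2)[OF I(1) pI[OF i]] .
      then show "?u i \<le> ?v i" by (simp add: c_def)
      show "a \<le> ?u i" "?v i \<le> b" using ab by (simp_all add: c_def)
      fix j assume j: "j < card I" "i \<noteq> j"
      have "p i \<noteq> p j" using p' i j by (auto simp: bij_betw_def inj_on_def)
      then have "{fst (p i)<..<snd (p i)} \<inter> {fst (p j)<..<snd (p j)} = {}"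
        using nonoverlappingD(3)[OF I(1) pI[OF i] pI[OF j(1)]] by blast
      moreover have "{c q<..<c r} \<subseteq> {q<..<r}" for q r
        by (auto simp: c_def)
      ultimately show "{?u i<..<?v i} \<inter> {?u j<..<?v j} = {}" by blast
    next
      have "(\<Sum>i<card I. ?v i - ?u i) \<le> (\<Sum>i<card I. snd (p i) - fst (p i))"
      proof (rule sum_mono)
        fix i assume "i \<in> {..<card I}"
        then have "fst (p i) < snd (p i)" using nonoverlappingD(2)[OF I(1) pI] by simp
        then show "?v i - ?u i \<le> snd (p i) - fst (p i)" by (auto simp: c_def)
      qed
      also have "\<dots> = len I"
        unfolding len_def by (rule sum.reindex_bij_betw[OF p'])
      finally show "(\<Sum>i<card I. ?v i - ?u i) < d" using I(2) by simp
    qed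
    moreover have "(\<Sum>i<card I. \<bar>f (?v i) - f (?u i)\<bar>) = incr (\<lambda>x. f (c x)) I"
      unfolding incr_def by (rule sum.reindex_bij_betw[OF p', of "\<lambda>q. \<bar>f (c (snd q)) - f (c (fst q))\<bar>"])
    ultimately show ?thesis by simp
  qed
  then show "\<exists>d>0. \<forall>I. nonoverlapping I \<and> len I < d \<longrightarrow> incr (\<lambda>x. f (max a (min b x))) I < e"
    using d(1) unfolding c_def by blast
qed

text \<open>The fundamental theorem of calculus for absolutely continuous functions. It is proved
  for the clamped function, which agrees with \<open>f\<close> on \<open>{a..b}\<close>; two-sided
  derivatives are transferred on the open interval.\<close>

lemma abs_continuous_derivative:
  assumes f: "abs_continuous a b f" and ab: "a < b"
  obtains h N where "h \<in> borel_measurable borel" "set_integrable lborel {a..b} h"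
    "(LINT t:{a..b}|lborel. h t) = f b - f a" "negligible N"
    "\<And>x. x \<in> {a<..<b} - N \<Longrightarrow> (f has_real_derivative h x) (at x)"
proof -
  let ?F = "\<lambda>x. f (max a (min b x))"
  obtain h where h: "h \<in> borel_measurable borel" "\<And>x y. x \<le> y \<Longrightarrow> set_integrable lborel {x..y} h"
    "\<And>x y. x \<le> y \<Longrightarrow> (LINT t:{x..y}|lborel. h t) = ?F y - ?F x"
    by (rule abs_cont_primitive[OF abs_continuous_clamp[OF f less_imp_le[OF ab]], of a]) (use ab in auto)
  have "(h has_integral ?F y - ?F x) {x..y}" if "x \<le> y" for x y
    using set_borel_integral_eq_integral[OF h(2)[OF that]] h(3)[OF that] by (simp add: has_integral_integral)
  then obtain N where N: "negligible N" "\<And>x. x \<notin> N \<Longrightarrow> (?F has_real_derivative h x) (at x)"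
    using primitive_ae_derivative[of h ?F] by blast
  show ?thesis
  proof (rule that[OF h(1) h(2)[OF less_imp_le[OF ab]] _ N(1)])
    show "(LINT t:{a..b}|lborel. h t) = f b - f a" using h(3)[of a b] ab by simp
    show "(f has_real_derivative h x) (at x)" if x: "x \<in> {a<..<b} - N" for x
    proof (rule has_field_derivative_transform_within_open[of ?F _ _ "{a<..<b}"])
      show "(?F has_real_derivative h x) (at x)" using N(2) x by blast
    qed (use x in auto)
  qed
qed


section \<open>The action\<close>

text \<open>Two dominating functions are allowed because a real or imaginary part of a curve is
  controlled by both of its chart components jointly.\<close>

lemma abs_continuous_dominated:
  assumes g: "abs_continuous a b g" and h: "abs_continuous a b h"
    and le: "\<And>s t. s \<in> {a..b} \<Longrightarrow> t \<in> {a..b} \<Longrightarrow> \<bar>f s - f t\<bar> \<le> C * (\<bar>g s - g t\<bar> + \<bar>h s - h t\<bar>)"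
    and C: "0 < C"
  shows "abs_continuous a b f"
  unfolding abs_continuous_def
proof (intro allI impI)
  fix e :: real assume "0 < e"
  then have e: "0 < e / (2 * C)" using C by simp
  obtain d1 where d1: "0 < d1" "\<forall>(m::nat) u v.
       (\<forall>i<m. a \<le> u i \<and> u i \<le> v i \<and> v i \<le> b) \<and>
       (\<forall>i<m. \<forall>j<m. i \<noteq> j \<longrightarrow> {u i<..<v i} \<inter> {u j<..<v j} = {}) \<and>
       (\<Sum>i<m. v i - u i) < d1 \<longrightarrow> (\<Sum>i<m. \<bar>g (v i) - g (u i)\<bar>) < e / (2 * C)"
    using g e unfolding abs_continuous_def by blast
  obtain d2 where d2: "0 < d2" "\<forall>(m::nat) u v.
       (\<forall>i<m. a \<le> u i \<and> u i \<le> v i \<and> v i \<le> b) \<and>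
       (\<forall>i<m. \<forall>j<m. i \<noteq> j \<longrightarrow> {u i<..<v i} \<inter> {u j<..<v j} = {}) \<and>
       (\<Sum>i<m. v i - u i) < d2 \<longrightarrow> (\<Sum>i<m. \<bar>h (v i) - h (u i)\<bar>) < e / (2 * C)"
    using h e unfolding abs_continuous_def by blast
  show "\<exists>d>0. \<forall>(m::nat) u v.
       (\<forall>i<m. a \<le> u i \<and> u i \<le> v i \<and> v i \<le> b) \<and>
       (\<forall>i<m. \<forall>j<m. i \<noteq> j \<longrightarrow> {u i<..<v i} \<inter> {u j<..<v j} = {}) \<and>
       (\<Sum>i<m. v i - u i) < d \<longrightarrow> (\<Sum>i<m. \<bar>f (v i) - f (u i)\<bar>) < e"
  proof (intro exI[of _ "min d1 d2"] conjI allI impI)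
    fix m :: nat and u v :: "nat \<Rightarrow> real"
    assume A: "(\<forall>i<m. a \<le> u i \<and> u i \<le> v i \<and> v i \<le> b) \<and>
       (\<forall>i<m. \<forall>j<m. i \<noteq> j \<longrightarrow> {u i<..<v i} \<inter> {u j<..<v j} = {}) \<and>
       (\<Sum>i<m. v i - u i) < min d1 d2"
    have "(\<Sum>i<m. \<bar>g (v i) - g (u i)\<bar>) < e / (2 * C)" using A d1(2) by simp
    moreover have "(\<Sum>i<m. \<bar>h (v i) - h (u i)\<bar>) < e / (2 * C)" using A d2(2) by simp
    moreover have "(\<Sum>i<m. \<bar>f (v i) - f (u i)\<bar>) \<le>
        (\<Sum>i<m. C * (\<bar>g (v i) - g (u i)\<bar> + \<bar>h (v i) - h (u i)\<bar>))"
    proof (rule sum_mono)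
      fix i assume "i \<in> {..<m}"
      then have "a \<le> u i" "u i \<le> v i" "v i \<le> b" using A by auto
      then show "\<bar>f (v i) - f (u i)\<bar> \<le> C * (\<bar>g (v i) - g (u i)\<bar> + \<bar>h (v i) - h (u i)\<bar>)"
        by (intro le) auto
    qed
    moreover have "(\<Sum>i<m. C * (\<bar>g (v i) - g (u i)\<bar> + \<bar>h (v i) - h (u i)\<bar>)) =
        C * ((\<Sum>i<m. \<bar>g (v i) - g (u i)\<bar>) + (\<Sum>i<m. \<bar>h (v i) - h (u i)\<bar>))"
      by (simp add: sum.distrib flip: sum_distrib_left)
    moreover have "C * (e / (2 * C) + e / (2 * C)) = e" using C by simp
    ultimately show "(\<Sum>i<m. \<bar>f (v i) - f (u i)\<bar>) < e"
      using C mult_strict_left_mono[of "(\<Sum>i<m. \<bar>g (v i) - g (u i)\<bar>) + (\<Sum>i<m. \<bar>h (v i) - h (u i)\<bar>)"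
          "e / (2 * C) + e / (2 * C)" C] by linarith
  qed (use d1 d2 in auto)
qed

lemma abs_continuous_ident: "abs_continuous a b (\<lambda>t. t)"
  unfolding abs_continuous_def
proof (intro allI impI)
  fix e :: real assume "0 < e"
  then show "\<exists>d>0. \<forall>(m::nat) u v.
       (\<forall>i<m. a \<le> u i \<and> u i \<le> v i \<and> v i \<le> b) \<and>
       (\<forall>i<m. \<forall>j<m. i \<noteq> j \<longrightarrow> {u i<..<v i} \<inter> {u j<..<v j} = {}) \<and>
       (\<Sum>i<m. v i - u i) < d \<longrightarrow> (\<Sum>i<m. \<bar>v i - u i\<bar>) < e"
  proof (intro exI[of _ e] conjI allI impI)
    fix m :: nat and u v :: "nat \<Rightarrow> real"
    assume A: "(\<forall>i<m. a \<le> u i \<and> u i \<le> v i \<and> v i \<le> b) \<and>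
       (\<forall>i<m. \<forall>j<m. i \<noteq> j \<longrightarrow> {u i<..<v i} \<inter> {u j<..<v j} = {}) \<and>
       (\<Sum>i<m. v i - u i) < e"
    then have "(\<Sum>i<m. \<bar>v i - u i\<bar>) = (\<Sum>i<m. v i - u i)" by (intro sum.cong) auto
    then show "(\<Sum>i<m. \<bar>v i - u i\<bar>) < e" using A by simp
  qed
qed

lemma abs_continuous_Lipschitz:
  assumes "\<And>s t. s \<in> {a..b} \<Longrightarrow> t \<in> {a..b} \<Longrightarrow> \<bar>f s - f t\<bar> \<le> C * \<bar>s - t\<bar>" "0 < C"
  shows "abs_continuous a b f"
proof (rule abs_continuous_dominated[OF abs_continuous_ident abs_continuous_ident _ assms(2)])
  fix s t assume "s \<in> {a..b}" "t \<in> {a..b}"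
  then have "\<bar>f s - f t\<bar> \<le> C * \<bar>s - t\<bar>" by (rule assms(1))
  also have "\<dots> \<le> C * (\<bar>s - t\<bar> + \<bar>s - t\<bar>)" using assms(2) by simp
  finally show "\<bar>f s - f t\<bar> \<le> C * (\<bar>s - t\<bar> + \<bar>s - t\<bar>)" .
qed

lemma abs_continuous_join:
  assumes f: "abs_continuous a b f" "abs_continuous b c f" and abc: "a \<le> b" "b \<le> c"
  shows "abs_continuous a c f"
  unfolding abs_continuous_def
proof (intro allI impI)
  fix e :: real assume "0 < e"
  then have e: "0 < e / 2" by simp
  obtain d1 where d1: "0 < d1" "\<forall>(m::nat) u v.
       (\<forall>i<m. a \<le> u i \<and> u i \<le> v i \<and> v i \<le> b) \<and>
       (\<forall>i<m. \<forall>j<m. i \<noteq> j \<longrightarrow> {u i<..<v i} \<inter> {u j<..<v j} = {}) \<and>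
       (\<Sum>i<m. v i - u i) < d1 \<longrightarrow> (\<Sum>i<m. \<bar>f (v i) - f (u i)\<bar>) < e / 2"
    using f(1) e unfolding abs_continuous_def by blast
  obtain d2 where d2: "0 < d2" "\<forall>(m::nat) u v.
       (\<forall>i<m. b \<le> u i \<and> u i \<le> v i \<and> v i \<le> c) \<and>
       (\<forall>i<m. \<forall>j<m. i \<noteq> j \<longrightarrow> {u i<..<v i} \<inter> {u j<..<v j} = {}) \<and>
       (\<Sum>i<m. v i - u i) < d2 \<longrightarrow> (\<Sum>i<m. \<bar>f (v i) - f (u i)\<bar>) < e / 2"
    using f(2) e unfolding abs_continuous_def by blast
  show "\<exists>d>0. \<forall>(m::nat) u v.
       (\<forall>i<m. a \<le> u i \<and> u i \<le> v i \<and> v i \<le> c) \<and>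
       (\<forall>i<m. \<forall>j<m. i \<noteq> j \<longrightarrow> {u i<..<v i} \<inter> {u j<..<v j} = {}) \<and>
       (\<Sum>i<m. v i - u i) < d \<longrightarrow> (\<Sum>i<m. \<bar>f (v i) - f (u i)\<bar>) < e"
  proof (intro exI[of _ "min d1 d2"] conjI allI impI)
    fix m :: nat and u v :: "nat \<Rightarrow> real"
    assume A: "(\<forall>i<m. a \<le> u i \<and> u i \<le> v i \<and> v i \<le> c) \<and>
       (\<forall>i<m. \<forall>j<m. i \<noteq> j \<longrightarrow> {u i<..<v i} \<inter> {u j<..<v j} = {}) \<and>
       (\<Sum>i<m. v i - u i) < min d1 d2"
    have uv: "a \<le> u i" "u i \<le> v i" "v i \<le> c" if "i < m" for i using A that by auto
    have len: "(\<Sum>i<m. min b (v i) - min b (u i)) \<le> (\<Sum>i<m. v i - u i)"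
      "(\<Sum>i<m. max b (v i) - max b (u i)) \<le> (\<Sum>i<m. v i - u i)"
      by (rule sum_mono; use uv in fastforce)+
    have sub: "{min b p<..<min b q} \<subseteq> {p<..<q}" "{max b p<..<max b q} \<subseteq> {p<..<q}" for p q by auto
    have dis: "{u i<..<v i} \<inter> {u j<..<v j} = {}" if "i < m" "j < m" "i \<noteq> j" for i j
      using A that by blast
    have "(\<forall>i<m. a \<le> min b (u i) \<and> min b (u i) \<le> min b (v i) \<and> min b (v i) \<le> b) \<and>
       (\<forall>i<m. \<forall>j<m. i \<noteq> j \<longrightarrow> {min b (u i)<..<min b (v i)} \<inter> {min b (u j)<..<min b (v j)} = {}) \<and>
       (\<Sum>i<m. min b (v i) - min b (u i)) < d1"
    proof (intro conjI allI impI)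
      show "{min b (u i)<..<min b (v i)} \<inter> {min b (u j)<..<min b (v j)} = {}"
        if "i < m" "j < m" "i \<noteq> j" for i j
        using dis[OF that] sub(1)[of "u i" "v i"] sub(1)[of "u j" "v j"] by blast
      show "(\<Sum>i<m. min b (v i) - min b (u i)) < d1" using len(1) A by linarith
      show "a \<le> min b (u i)" "min b (u i) \<le> min b (v i)" if "i < m" for i
        using uv[OF that] abc by (auto simp: min_le_iff_disj)
    qed auto
    then have 1: "(\<Sum>i<m. \<bar>f (min b (v i)) - f (min b (u i))\<bar>) < e / 2"
      using d1(2)[rule_format, of m "\<lambda>i. min b (u i)" "\<lambda>i. min b (v i)"] by blast
    have "(\<forall>i<m. b \<le> max b (u i) \<and> max b (u i) \<le> max b (v i) \<and> max b (v i) \<le> c) \<and>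
       (\<forall>i<m. \<forall>j<m. i \<noteq> j \<longrightarrow> {max b (u i)<..<max b (v i)} \<inter> {max b (u j)<..<max b (v j)} = {}) \<and>
       (\<Sum>i<m. max b (v i) - max b (u i)) < d2"
    proof (intro conjI allI impI)
      show "{max b (u i)<..<max b (v i)} \<inter> {max b (u j)<..<max b (v j)} = {}"
        if "i < m" "j < m" "i \<noteq> j" for i j
        using dis[OF that] sub(2)[of "u i" "v i"] sub(2)[of "u j" "v j"] by blast
      show "(\<Sum>i<m. max b (v i) - max b (u i)) < d2" using len(2) A by linarith
      show "max b (u i) \<le> max b (v i)" "max b (v i) \<le> c" if "i < m" for i
        using uv[OF that] abc by auto
    qed auto
    then have 2: "(\<Sum>i<m. \<bar>f (max b (v i)) - f (max b (u i))\<bar>) < e / 2"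
      using d2(2)[rule_format, of m "\<lambda>i. max b (u i)" "\<lambda>i. max b (v i)"] by blast
    \<comment> \<open>\<open>min b q\<close> and \<open>max b q\<close> are \<open>b\<close> and
      \<open>q\<close> in some order, and likewise for \<open>p\<close>, so the two values at
      \<open>b\<close> cancel.\<close>
    have *: "f q - f p = (f (min b q) - f (min b p)) + (f (max b q) - f (max b p))" for p q
      by (auto simp: min_def max_def)
    have "(\<Sum>i<m. \<bar>f (v i) - f (u i)\<bar>) \<le>
        (\<Sum>i<m. \<bar>f (min b (v i)) - f (min b (u i))\<bar> + \<bar>f (max b (v i)) - f (max b (u i))\<bar>)"
      unfolding *[of "v _"] by (intro sum_mono abs_triangle_ineq)
    also have "\<dots> < e" unfolding sum.distrib using 1 2 by linarith
    finally show "(\<Sum>i<m. \<bar>f (v i) - f (u i)\<bar>) < e" .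
  qed (use d1 d2 in auto)
qed

lemma set_integrable_lebesgue:
  fixes f :: "real \<Rightarrow> real"
  assumes "set_integrable lborel S f"
  shows "set_integrable lebesgue S f" "(LINT t:S|lebesgue. f t) = (LINT t:S|lborel. f t)"
proof -
  have m: "(\<lambda>x. indicator S x *\<^sub>R f x) \<in> borel_measurable lborel"
    using assms unfolding set_integrable_def by (rule borel_measurable_integrable)
  show "set_integrable lebesgue S f"
    using assms m unfolding set_integrable_def by (simp add: integrable_completion)
  show "(LINT t:S|lebesgue. f t) = (LINT t:S|lborel. f t)"
    using m unfolding set_lebesgue_integral_def by (rule integral_completion)
qed

lemma continuous_set_integrable:
  "continuous_on {a..b} (f :: real \<Rightarrow> real) \<Longrightarrow> set_integrable lborel {a..b} f"
  unfolding set_integrable_def using borel_integrable_compact[of "{a..b}" f]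
  by (simp add: indicator_scaleR_eq_if)

section \<open>Absolutely continuous curves in the disc\<close>

context disc_curve
begin

text \<open>Absolute continuity is given only in charts, on time intervals spent in one chart. The
  parametrisation is Lipschitz on the half-plane, which carries it to the disc coordinate piece by
  piece, and finitely many pieces are joined.\<close>

lemma curve_components_abs_continuous:
  assumes ac: "abs_continuous_curve disc T \<gamma>"
  shows "continuous_on {0..T} z" "abs_continuous 0 T (\<lambda>t. Re (z t))" "abs_continuous 0 T (\<lambda>t. Im (z t))"
proof -
  have "continuous_on {0..T} \<gamma>" using ac by (simp add: abs_continuous_curve_def)
  then have "continuous_on {0..T} (\<lambda>t. cpx (\<gamma> t))"
    by (intro continuous_on_compose2[OF continuous_on_cpx[of UNIV]]) auto
  then show zc: "continuous_on {0..T} z" by (rule continuous_on_eq) (simp add: \<gamma>)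
  have loc: "abs_continuous a b (\<lambda>t. Re (z t))" "abs_continuous a b (\<lambda>t. Im (z t))"
    if s: "s \<in> sgns" and ab: "0 \<le> a" "a \<le> b" "b \<le> T" and av: "\<And>t. t \<in> {a..b} \<Longrightarrow> z t \<noteq> - of_real s" for a b s
  proof -
    define w where "w t = cay (of_real s * z t)" for t
    have I: "t \<in> {0..T}" if "t \<in> {a..b}" for t using that ab by simp
    have "\<gamma> ` {a..b} \<subseteq> cdom (hchart s)" using \<gamma>_in_chart[OF I s] av by blast
    moreover have "hchart s \<in> atlas disc" using s by auto
    ultimately have "\<forall>i<mdim disc. abs_continuous a b (\<lambda>t. cmap (hchart s) (\<gamma> t) i)"
      using ac ab unfolding abs_continuous_curve_def by blast
    then have c: "abs_continuous a b (\<lambda>t. cmap (hchart s) (\<gamma> t) i)" if "i < 2" for i using that by simp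
    have cm: "cmap (hchart s) (\<gamma> t) = emb (w t)" if "t \<in> {a..b}" for t
      using \<gamma>[OF I[OF that]] by (simp add: cmap_hchart w_def)
    have le: "cmod (z t - z t') \<le> 2 * (\<bar>cmap (hchart s) (\<gamma> t) 0 - cmap (hchart s) (\<gamma> t') 0\<bar> +
        \<bar>cmap (hchart s) (\<gamma> t) 1 - cmap (hchart s) (\<gamma> t') 1\<bar>)"
      if t: "t \<in> {a..b}" "t' \<in> {a..b}" for t t'
    proof -
      have r: "0 \<le> Re (w t)" "0 \<le> Re (w t')"
        using Re_cay_ge_0[of "of_real s * z t"] Re_cay_ge_0[of "of_real s * z t'"] z_disc[OF I[OF t(1)]]
          z_disc[OF I[OF t(2)]] s by (auto simp: w_def norm_mult)
      \<comment> \<open>On Re w \<ge> 0 one has |1 + w| \<ge> 1. As cay p - cay r = 2(r - p) / ((1 +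
        p)(1 + r)), this gives the Lipschitz constant 2.\<close>
      then have n: "1 \<le> cmod (1 + w t)" "1 \<le> cmod (1 + w t')"
        using complex_Re_le_cmod[of "1 + w t"] complex_Re_le_cmod[of "1 + w t'"] by simp_all
      then have n0: "1 + w t \<noteq> 0" "1 + w t' \<noteq> 0" by auto
      have zw: "z t = of_real s * cay (w t)" "z t' = of_real s * cay (w t')"
        unfolding w_def using s sgn_mult_neq[OF s av[OF t(1)]] sgn_mult_neq[OF s av[OF t(2)]] by simp_all
      have "cay p - cay r = 2 * (r - p) / ((1 + p) * (1 + r))"
        if "1 + p \<noteq> 0" "1 + r \<noteq> 0" for p r :: complex
      proof -
        have "(1 - p) * (1 + r) - (1 - r) * (1 + p) = 2 * (r - p)" by (simp add: algebra_simps)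
        then show ?thesis using that by (simp add: cay_def diff_frac_eq)
      qed
      from this[OF n0] have "z t - z t' = of_real s * (2 * (w t' - w t) / ((1 + w t) * (1 + w t')))"
        unfolding zw right_diff_distrib[symmetric] by (rule arg_cong)
      then have "cmod (z t - z t') = \<bar>s\<bar> * (2 * cmod (w t' - w t) / (cmod (1 + w t) * cmod (1 + w t')))"
        by (simp only: norm_mult norm_divide norm_of_real norm_numeral)
      also have "\<bar>s\<bar> = 1" using s by auto
      also have "1 * (2 * cmod (w t' - w t) / (cmod (1 + w t) * cmod (1 + w t'))) =
          2 * cmod (w t' - w t) / (cmod (1 + w t) * cmod (1 + w t'))" by simp
      also have "\<dots> \<le> 2 * cmod (w t' - w t) / 1"
        using mult_mono[OF n] n by (intro divide_left_mono) auto
      also have "\<dots> \<le> 2 * (\<bar>Re (w t' - w t)\<bar> + \<bar>Im (w t' - w t)\<bar>)"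
        unfolding div_by_1 by (intro mult_left_mono cmod_le) simp
      finally show ?thesis using t by (simp add: cm abs_minus_commute)
    qed
    show "abs_continuous a b (\<lambda>t. Re (z t))"
    proof (rule abs_continuous_dominated[OF c[of 0] c[of 1]])
      show "\<bar>Re (z t) - Re (z t')\<bar> \<le> 2 * (\<bar>cmap (hchart s) (\<gamma> t) 0 - cmap (hchart s) (\<gamma> t') 0\<bar> +
        \<bar>cmap (hchart s) (\<gamma> t) 1 - cmap (hchart s) (\<gamma> t') 1\<bar>)" if "t \<in> {a..b}" "t' \<in> {a..b}" for t t'
        using le[OF that] abs_Re_le_cmod[of "z t - z t'"] by simp
    qed auto
    show "abs_continuous a b (\<lambda>t. Im (z t))"
    proof (rule abs_continuous_dominated[OF c[of 0] c[of 1]])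
      show "\<bar>Im (z t) - Im (z t')\<bar> \<le> 2 * (\<bar>cmap (hchart s) (\<gamma> t) 0 - cmap (hchart s) (\<gamma> t') 0\<bar> +
        \<bar>cmap (hchart s) (\<gamma> t) 1 - cmap (hchart s) (\<gamma> t') 1\<bar>)" if "t \<in> {a..b}" "t' \<in> {a..b}" for t t'
        using le[OF that] abs_Im_le_cmod[of "z t - z t'"] by simp
    qed auto
  qed
  define P where "P a b \<longleftrightarrow> (0 \<le> a \<longrightarrow> b \<le> T \<longrightarrow>
    abs_continuous a b (\<lambda>t. Re (z t)) \<and> abs_continuous a b (\<lambda>t. Im (z t)))" for a b
  have "P 0 T"
  \<comment> \<open>Bisection in place of a finite subcover: each time has a neighbourhood spent in
    one chart, and adjacent intervals join.\<close>
  proof (rule Bolzano)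
    show "0 \<le> T" using T by simp
    show "P a c" if "P a b" "P b c" "a \<le> b" "b \<le> c" for a b c
      using that abs_continuous_join unfolding P_def by auto
    fix t assume t: "0 \<le> t" "t \<le> T"
    then have tI: "t \<in> {0..T}" by simp
    obtain s where s: "s \<in> sgns" "z t \<noteq> - of_real s" using chart_at_disc[OF z_disc[OF tI]] by blast
    obtain d where d: "d > 0" "\<And>u. u \<in> {0..T} \<Longrightarrow> dist u t < d \<Longrightarrow> z u \<noteq> - of_real s"
      using avoid_near[OF zc tI s(2)] by blast
    have "P a b" if "a \<le> t" "t \<le> b" "b - a < d" for a b
      unfolding P_def
    proof (intro impI)
      assume ab: "0 \<le> a" "b \<le> T"
      have "z u \<noteq> - of_real s" if "u \<in> {a..b}" for u
        using that ab \<open>a \<le> t\<close> \<open>t \<le> b\<close> \<open>b - a < d\<close> by (intro d(2)) (auto simp: dist_real_def)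
      then show "abs_continuous a b (\<lambda>t. Re (z t)) \<and> abs_continuous a b (\<lambda>t. Im (z t))"
        using loc[OF s(1) ab(1) _ ab(2)] that by simp
    qed
    then show "\<exists>d>0. \<forall>a b. a \<le> t \<and> t \<le> b \<and> b - a < d \<longrightarrow> P a b" using d(1) by blast
  qed
  then show "abs_continuous 0 T (\<lambda>t. Re (z t))" "abs_continuous 0 T (\<lambda>t. Im (z t))"
    by (simp_all add: P_def)
qed

end

section \<open>The boundary action function\<close>

context conformal
begin

lemma pot_emb: "pot \<epsilon> (emb z) = 1/2 - 1 / (2 * lam \<epsilon> z)"
  by (simp add: pot_def)

lemma lam_continuous: "continuous_on S (lam \<epsilon>)"
  unfolding lam_def[abs_def] by (intro continuous_intros)

text \<open>AM-GM: \<open>\<lambda>|z'|\<^sup>2/2 + 1/(2\<lambda>) \<ge> |z'|\<close>, where the left-hand side is the integrand of the action.\<close>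

lemma action_ge_dist:
  assumes dc: "disc_curve T z \<gamma>" and ac: "abs_continuous_curve disc T \<gamma>"
  shows "ereal (dist (z 0) (z T)) \<le> mp_action disc (met \<epsilon>) zform (pot \<epsilon>) (1/2) T \<gamma>"
proof -
  interpret disc_curve T z \<gamma> by (rule dc)
  note cc = curve_components_abs_continuous[OF ac]
  obtain h0 N0 where h0: "h0 \<in> borel_measurable borel" "set_integrable lborel {0..T} h0"
    "(LINT t:{0..T}|lborel. h0 t) = Re (z T) - Re (z 0)" "negligible N0"
    "\<And>t. t \<in> {0<..<T} - N0 \<Longrightarrow> ((\<lambda>t. Re (z t)) has_real_derivative h0 t) (at t)"
    using abs_continuous_derivative[OF cc(2) T] by metis
  obtain h1 N1 where h1: "h1 \<in> borel_measurable borel" "set_integrable lborel {0..T} h1"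
    "(LINT t:{0..T}|lborel. h1 t) = Im (z T) - Im (z 0)" "negligible N1"
    "\<And>t. t \<in> {0<..<T} - N1 \<Longrightarrow> ((\<lambda>t. Im (z t)) has_real_derivative h1 t) (at t)"
    using abs_continuous_derivative[OF cc(3) T] by metis
  \<comment> \<open>The unit vector towards the endpoint turns the distance into the integral of the
    scalar \<theta> . z'; for a closed curve the value 0 makes the same identities hold.\<close>
  define \<theta> where "\<theta> = (if z 0 = z T then 0 else (z T - z 0) /\<^sub>R dist (z 0) (z T))"
  have \<theta>: "cmod \<theta> \<le> 1" "(z T - z 0) \<bullet> \<theta> = dist (z 0) (z T)"
    by (auto simp: \<theta>_def dist_norm norm_minus_commute dot_square_norm power2_eq_square)
  define pt where "pt t = pot \<epsilon> (\<gamma> t)" for t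
  have pt: "set_integrable lborel {0..T} pt"
  proof (rule continuous_set_integrable)
    have "continuous_on {0..T} (\<lambda>t. 1/2 - 1 / (2 * lam \<epsilon> (z t)))"
      by (intro continuous_intros continuous_on_compose2[OF lam_continuous[of UNIV] cc(1)])
        (auto simp: lam_nonzero)
    then show "continuous_on {0..T} pt"
      by (rule continuous_on_eq) (simp add: pt_def \<gamma> pot_emb)
  qed
  have one: "set_integrable lborel {0..T} (\<lambda>_. 1/2 :: real)"
    by (rule continuous_set_integrable) simp
  have one': "(LINT t:{0..T}|lborel. 1/2 :: real) = T / 2"
    using T by (simp add: set_lebesgue_integral_def)
  \<comment> \<open>\<theta> . z' - 1/(2\<lambda>), which is at most half of the kinetic integrand.
    Its integral is the distance minus the part of the action that does not depend on the
    velocity.\<close>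
  define q where "q t = (Re \<theta> * h0 t + Im \<theta> * h1 t) - (1/2 - pt t)" for t
  have i01: "set_integrable lborel {0..T} (\<lambda>t. Re \<theta> * h0 t)" "set_integrable lborel {0..T} (\<lambda>t. Im \<theta> * h1 t)"
    using h0(2) h1(2) by auto
  note i2 = set_integral_add[OF i01] and i3 = set_integral_diff[OF one pt]
  note i4 = set_integral_diff[OF i2(1) i3(1)]
  have q: "set_integrable lborel {0..T} q" using i4(1) by (simp add: q_def[abs_def])
  have "(LINT t:{0..T}|lborel. q t) = Re \<theta> * (Re (z T) - Re (z 0)) + Im \<theta> * (Im (z T) - Im (z 0)) -
      (T / 2 - (LINT t:{0..T}|lborel. pt t))"
    using i4(2) i2(2) i3(2) one' h0(3) h1(3) by (simp add: q_def[abs_def])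
  also have "Re \<theta> * (Re (z T) - Re (z 0)) + Im \<theta> * (Im (z T) - Im (z 0)) = dist (z 0) (z T)"
    using \<theta>(2) by (simp add: inner_complex_def mult.commute)
  finally have Iq: "(LINT t:{0..T}|lborel. q t) = dist (z 0) (z T) - (T / 2 - (LINT t:{0..T}|lborel. pt t))" .
  let ?kin = "\<lambda>t. met \<epsilon> (\<gamma> t) (velocity disc {0..T} \<gamma> t) (velocity disc {0..T} \<gamma> t)"
  define K where "K = (\<integral>\<^sup>+ t. ennreal (?kin t) * indicator {0..T} t \<partial>lebesgue)"
  \<comment> \<open>The two end times are added because derivatives are available in the open
    interval only.\<close>
  have "negligible (N0 \<union> N1 \<union> {0, T})" using h0(4) h1(4) by simp
  then have "N0 \<union> N1 \<union> {0, T} \<in> null_sets lebesgue" by (simp add: negligible_iff_null_sets)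
  moreover have "2 * q t \<le> ?kin t" if t: "t \<in> {0..T}" "t \<notin> N0 \<union> N1 \<union> {0, T}" for t
  proof -
    define h where "h = Complex (h0 t) (h1 t)"
    have td: "t \<in> {0<..<T} - N0" "t \<in> {0<..<T} - N1" using t by auto
    have "((\<lambda>t. of_real (Re (z t)) + \<i> * of_real (Im (z t))) has_vector_derivative of_real (h0 t) + \<i> * of_real (h1 t)) (at t)"
      using h0(5)[OF td(1)] h1(5)[OF td(2)]
      by (intro has_vector_derivative_add has_vector_derivative_mult_right has_vector_derivative_of_real)
        (simp_all)
    moreover have "of_real (Re u) + \<i> * of_real (Im u) = u" for u by (simp add: complex_eq_iff)
    ultimately have "(z has_vector_derivative h) (at t)"
      by (simp add: h_def Complex_eq)
    then have "(z has_vector_derivative h) (at t within {0..T})" by (rule has_vector_derivative_at_within)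
    from velocity_at[OF this t(1)] have k: "?kin t = lam \<epsilon> (z t) * (cmod h)\<^sup>2"
      using \<gamma>[OF t(1)] z_disc[OF t(1)] by (simp add: dot_square_norm)
    define l where "l = lam \<epsilon> (z t)"
    have l: "0 < l" unfolding l_def by (rule lam_pos)
    have "Re \<theta> * h0 t + Im \<theta> * h1 t = \<theta> \<bullet> h" by (simp add: h_def inner_complex_def)
    also have "\<dots> \<le> cmod \<theta> * cmod h" by (rule norm_cauchy_schwarz)
    also have "\<dots> \<le> cmod h" using \<theta>(1) by (simp add: mult_left_le_one_le)
    finally have 1: "Re \<theta> * h0 t + Im \<theta> * h1 t \<le> cmod h" .
    have "1/2 - pt t = 1 / (2 * l)" by (simp add: pt_def \<gamma>[OF t(1)] pot_emb l_def)
    then have "2 * q t \<le> 2 * cmod h - 1 / l" using 1 by (simp add: q_def)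
    also have "\<dots> \<le> l * (cmod h)\<^sup>2"
    proof -
      have "0 \<le> (l * cmod h - 1)\<^sup>2 / l" using l by simp
      also have "(l * cmod h - 1)\<^sup>2 / l = l * (cmod h)\<^sup>2 - (2 * cmod h - 1 / l)"
        using l by (simp add: power2_eq_square field_simps)
      finally show ?thesis by simp
    qed
    finally show ?thesis using k by (simp add: l_def)
  qed
  ultimately have AE: "AE t in lebesgue. ennreal (2 * (indicator {0..T} t * q t)) \<le> ennreal (?kin t) * indicator {0..T} t"
    by (intro AE_I'[of "N0 \<union> N1 \<union> {0, T}"]) (auto simp: indicator_def intro: ennreal_leI)
  have qL: "integrable lebesgue (\<lambda>t. indicator {0..T} t * q t)"
    using set_integrable_lebesgue(1)[OF q] by (simp add: set_integrable_def)
  have main: "dist (z 0) (z T) \<le> k / 2 + (T / 2 - (LINT t:{0..T}|lborel. pt t))" if k: "K = ennreal k" "0 \<le> k" for k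
  proof -
    have "2 * (LINT t:{0..T}|lborel. q t) = integral\<^sup>L lebesgue (\<lambda>t. 2 * (indicator {0..T} t * q t))"
      using set_integrable_lebesgue(2)[OF q] by (simp add: set_lebesgue_integral_def)
    \<comment> \<open>\<open>q\<close> may be negative: the integral is the nonnegative integral of
      the positive part minus that of the negative part, and dropping the latter allows comparison
      with \<open>K\<close>.\<close>
    also have "\<dots> \<le> enn2real (\<integral>\<^sup>+ t. ennreal (2 * (indicator {0..T} t * q t)) \<partial>lebesgue)"
      using qL by (subst real_lebesgue_integral_def) auto
    also have "\<dots> \<le> enn2real K"
      unfolding K_def using k by (intro enn2real_mono nn_integral_mono_AE AE) (simp flip: K_def)
    also have "\<dots> = k" using k by simp
    finally show ?thesis using Iq by simp
  qed
  have P: "(LINT t:{0..T}|lebesgue. zform (\<gamma> t) (velocity disc {0..T} \<gamma> t) + pot \<epsilon> (\<gamma> t)) =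
      (LINT t:{0..T}|lborel. pt t)"
    using set_integrable_lebesgue(2)[OF pt] by (simp add: pt_def)
  have act: "mp_action disc (met \<epsilon>) zform (pot \<epsilon>) (1/2) T \<gamma> =
      ereal (1/2) * enn2ereal K + ereal (1/2 * T - (LINT t:{0..T}|lborel. pt t))"
    unfolding mp_action_def Let_def P K_def ..
  show ?thesis
  proof (cases K)
    case (real k)
    then show ?thesis using main[OF real(2,1)] by (simp add: act)
  next
    case top
    then show ?thesis by (simp add: act)
  qed
qed

text \<open>Chart velocities are bounded on a compact time interval, so the components are Lipschitz
  and thereby absolutely continuous. All integrands are continuous, so the action becomes a
  Henstock-Kurzweil integral, for which antiderivatives can be used.\<close>

lemma smooth_curve_action:
  assumes sm: "smooth_disc_curve T z \<gamma> v a"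
  shows "abs_continuous_curve disc T \<gamma>"
    "mp_action disc (met \<epsilon>) zform (pot \<epsilon>) (1/2) T \<gamma> =
      ereal (integral {0..T} (\<lambda>t. lam \<epsilon> (z t) * (v t \<bullet> v t) / 2 + 1 / (2 * lam \<epsilon> (z t))))"
proof -
  interpret smooth_disc_curve T z \<gamma> v a by (rule sm)
  have vc: "continuous_on {0..T} v"
    unfolding continuous_on_eq_continuous_within
    by (rule ballI, rule has_vector_derivative_continuous, rule v_deriv)
  have lc: "continuous_on {0..T} (\<lambda>t. lam \<epsilon> (z t))"
    by (rule continuous_on_compose2[OF lam_continuous[of UNIV] z_continuous]) simp
  show "abs_continuous_curve disc T \<gamma>"
    unfolding abs_continuous_curve_def
  proof (intro conjI allI impI ballI)
    show "continuous_map (top_of_set {0..T}) (mtop disc) \<gamma>"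
      using twice_differentiable unfolding twice_differentiable_curve_def by blast
    fix p q c i assume pq: "0 \<le> p \<and> p \<le> q \<and> q \<le> T" and c: "c \<in> atlas disc" "\<gamma> ` {p..q} \<subseteq> cdom c"
      and "i < mdim disc"
    obtain s where s: "s \<in> sgns" "c = hchart s" using c(1) by auto
    have I: "t \<in> {0..T}" "z t \<noteq> - of_real s" if "t \<in> {p..q}" for t
    proof -
      show *: "t \<in> {0..T}" using that pq by simp
      show "z t \<noteq> - of_real s" using \<gamma>_in_chart[OF * s(1)] c(2) s(2) that by blast
    qed
    define g where "g t = emb (v t / scal s (z t)) i" for t
    have "continuous_on {p..q} (\<lambda>t. v t / scal s (z t))"
      unfolding scal_def using pq scal_nonzero[OF s(1) I(2)]
      by (intro continuous_intros continuous_on_subset[OF vc] continuous_on_subset[OF z_continuous])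
        (auto simp: scal_def)
    then have "continuous_on {p..q} g"
      unfolding g_def by (rule bounded_linear.continuous_on[OF bounded_linear_emb_component])
    then have "bounded (g ` {p..q})" by (intro compact_imp_bounded compact_continuous_image) auto
    then obtain B where B: "0 < B" "\<And>t. t \<in> {p..q} \<Longrightarrow> \<bar>g t\<bar> \<le> B"
      unfolding bounded_pos by auto
    show "abs_continuous p q (\<lambda>t. cmap c (\<gamma> t) i)"
    proof (rule abs_continuous_Lipschitz[OF _ B(1)])
      fix t t' assume t: "t \<in> {p..q}" "t' \<in> {p..q}"
      have "norm (cmap c (\<gamma> t) i - cmap c (\<gamma> t') i) \<le> B * norm (t - t')"
      proof (rule differentiable_bound[OF _ _ _ t])
        show "convex {p..q}" by simp
        fix u assume u: "u \<in> {p..q}"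
        have "((\<lambda>t. cmap c (\<gamma> t) i) has_vector_derivative g u) (at u within {p..q})"
          unfolding s(2) g_def
          by (rule has_vector_derivative_within_subset[OF chart_deriv[OF I(1)[OF u] s(1) I(2)[OF u] I(1)[OF u]]])
            (use pq in auto)
        then show "((\<lambda>t. cmap c (\<gamma> t) i) has_derivative (\<lambda>h. h *\<^sub>R g u)) (at u within {p..q})"
          by (simp add: has_vector_derivative_def)
        show "onorm (\<lambda>h. h *\<^sub>R g u) \<le> B"
        proof (rule onorm_le)
          show "norm (x *\<^sub>R g u) \<le> B * norm x" for x
            using mult_right_mono[OF B(2)[OF u] abs_ge_zero[of x]] by (simp add: abs_mult mult.commute)
        qed
      qed
      then show "\<bar>cmap c (\<gamma> t) i - cmap c (\<gamma> t') i\<bar> \<le> B * \<bar>t - t'\<bar>" by simp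
    qed
  qed
  define k where "k t = lam \<epsilon> (z t) * (v t \<bullet> v t)" for t
  define pt where "pt t = 1/2 - 1 / (2 * lam \<epsilon> (z t))" for t
  have kc: "continuous_on {0..T} k" unfolding k_def by (intro continuous_intros lc vc)
  have k0: "0 \<le> k t" for t using lam_pos[of "z t"] by (simp add: k_def)
  have pc: "continuous_on {0..T} pt" unfolding pt_def using lam_nonzero by (intro continuous_intros lc) auto
  note ki = continuous_set_integrable[OF kc] and pi = continuous_set_integrable[OF pc]
  have hk: "(LINT t:{0..T}|lebesgue. k t) = integral {0..T} k"
    using set_integrable_lebesgue(2)[OF ki] set_borel_integral_eq_integral(2)[OF ki] by simp
  have hp: "(LINT t:{0..T}|lebesgue. pt t) = integral {0..T} pt"
    using set_integrable_lebesgue(2)[OF pi] set_borel_integral_eq_integral(2)[OF pi] by simp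
  have "(\<integral>\<^sup>+ t. ennreal (met \<epsilon> (\<gamma> t) (velocity disc {0..T} \<gamma> t) (velocity disc {0..T} \<gamma> t)) *
      indicator {0..T} t \<partial>lebesgue) = (\<integral>\<^sup>+ t. ennreal (indicator {0..T} t * k t) \<partial>lebesgue)"
    by (rule nn_integral_cong) (use z_disc in \<open>auto simp: indicator_def velocity_disc \<gamma> k_def\<close>)
  also have "\<dots> = ennreal (integral {0..T} k)"
    using set_integrable_lebesgue(1)[OF ki] k0 hk
    by (subst nn_integral_eq_integral) (auto simp: set_integrable_def set_lebesgue_integral_def)
  finally have K: "(\<integral>\<^sup>+ t. ennreal (met \<epsilon> (\<gamma> t) (velocity disc {0..T} \<gamma> t) (velocity disc {0..T} \<gamma> t)) *
      indicator {0..T} t \<partial>lebesgue) = ennreal (integral {0..T} k)" .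
  have "(LINT t:{0..T}|lebesgue. zform (\<gamma> t) (velocity disc {0..T} \<gamma> t) + pot \<epsilon> (\<gamma> t)) =
      (LINT t:{0..T}|lebesgue. pt t)"
    unfolding set_lebesgue_integral_def
    by (rule Bochner_Integration.integral_cong) (auto simp: indicator_def \<gamma> pot_emb pt_def)
  then have "mp_action disc (met \<epsilon>) zform (pot \<epsilon>) (1/2) T \<gamma> =
      ereal (1/2) * enn2ereal (ennreal (integral {0..T} k)) + ereal (1/2 * T - integral {0..T} pt)"
    unfolding mp_action_def Let_def K hp by simp
  moreover have "0 \<le> integral {0..T} k"
    using k0 integrable_continuous_real[OF kc] by (intro integral_nonneg) auto
  moreover have "integral {0..T} (\<lambda>t. k t / 2 + 1 / (2 * lam \<epsilon> (z t))) = integral {0..T} k / 2 + (1/2 * T - integral {0..T} pt)"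
  proof -
    have 1: "(k has_integral integral {0..T} k) {0..T}" "(pt has_integral integral {0..T} pt) {0..T}"
      using integrable_continuous_real[OF kc] integrable_continuous_real[OF pc] by (simp_all add: has_integral_integral)
    have "((\<lambda>t. k t * (1/2) + (1/2 - pt t)) has_integral integral {0..T} k * (1/2) + (1/2 * T - integral {0..T} pt)) {0..T}"
      using has_integral_const_real[of "1/2 :: real" 0 T] T
      by (intro has_integral_add has_integral_diff has_integral_mult_left 1) simp
    then show ?thesis by (simp add: pt_def integral_unique)
  qed
  ultimately show "mp_action disc (met \<epsilon>) zform (pot \<epsilon>) (1/2) T \<gamma> =
      ereal (integral {0..T} (\<lambda>t. lam \<epsilon> (z t) * (v t \<bullet> v t) / 2 + 1 / (2 * lam \<epsilon> (z t))))"
    by (simp add: k_def enn2ereal_ennreal)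
qed

text \<open>For distinct points the straight segment at speed 1/\<lambda> is the equality case of
  the AM-GM estimate, so the lower bound is attained. For equal points the infimum 0 is only
  approached, because durations are positive.\<close>

lemma action_function_disc:
  assumes x: "x \<in> cball 0 1" and y: "y \<in> cball 0 1"
  shows "action_function disc (met \<epsilon>) zform (pot \<epsilon>) (1/2) (emb x) (emb y) = ereal (dist x y)"
proof (rule antisym)
  let ?S = "{mp_action disc (met \<epsilon>) zform (pot \<epsilon>) (1/2) T \<gamma> |T \<gamma>.
      0 < T \<and> abs_continuous_curve disc T \<gamma> \<and> \<gamma> 0 = emb x \<and> \<gamma> T = emb y}"
  show "ereal (dist x y) \<le> action_function disc (met \<epsilon>) zform (pot \<epsilon>) (1/2) (emb x) (emb y)"
    unfolding action_function_def
  proof (rule Inf_greatest)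
    fix r assume "r \<in> ?S"
    then obtain T \<gamma> where r: "r = mp_action disc (met \<epsilon>) zform (pot \<epsilon>) (1/2) T \<gamma>"
      and T: "0 < T" and ac: "abs_continuous_curve disc T \<gamma>" and e: "\<gamma> 0 = emb x" "\<gamma> T = emb y" by blast
    define z where "z t = cpx (\<gamma> t)" for t
    have "disc_curve T z \<gamma>"
    proof
      fix t assume "t \<in> {0..T}"
      then have "\<gamma> t \<in> emb ` cball 0 1"
        using ac unfolding abs_continuous_curve_def disc_simps by auto
      then show "z t \<in> cball 0 1" "\<gamma> t = emb (z t)" by (auto simp: z_def)
    qed fact
    from action_ge_dist[OF this ac] show "ereal (dist x y) \<le> r" by (simp add: r z_def e)
  qed
  show "action_function disc (met \<epsilon>) zform (pot \<epsilon>) (1/2) (emb x) (emb y) \<le> ereal (dist x y)"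
  proof (cases "x = y")
    case True
    have "action_function disc (met \<epsilon>) zform (pot \<epsilon>) (1/2) (emb x) (emb y) \<le> 0 + ereal e" if e: "0 < e" for e
    proof -
      \<comment> \<open>Resting at \<open>x\<close> costs 1/(2 lam x) per unit of time, so this
        duration costs exactly \<open>e\<close>.\<close>
      define T where "T = 2 * lam \<epsilon> x * e"
      have T: "0 < T" using e lam_pos[of x] by (simp add: T_def)
      have sm: "smooth_disc_curve T (\<lambda>_. x) (\<lambda>_. emb x) (\<lambda>_. 0) (\<lambda>_. 0)"
        by unfold_locales (use T x in auto)
      have "mp_action disc (met \<epsilon>) zform (pot \<epsilon>) (1/2) T (\<lambda>_. emb x) \<in> ?S"
        using smooth_curve_action(1)[OF sm] T True by blast
      then have "action_function disc (met \<epsilon>) zform (pot \<epsilon>) (1/2) (emb x) (emb y) \<le>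
          mp_action disc (met \<epsilon>) zform (pot \<epsilon>) (1/2) T (\<lambda>_. emb x)"
        unfolding action_function_def by (rule Inf_lower)
      also have "\<dots> = ereal e"
        unfolding smooth_curve_action(2)[OF sm] using T lam_nonzero[of x] by (simp add: T_def)
      finally show ?thesis by simp
    qed
    then have "action_function disc (met \<epsilon>) zform (pot \<epsilon>) (1/2) (emb x) (emb y) \<le> 0"
      by (rule ereal_le_epsilon2) 
    then show ?thesis using True by (simp add: zero_ereal_def)
  next
    case False
    define r where "r = cmod (y - x)"
    define \<theta> where "\<theta> = (y - x) /\<^sub>R r"
    have r: "0 < r" "y = x + r *\<^sub>R \<theta>" using False by (simp_all add: r_def \<theta>_def)
    have \<theta>: "\<theta> \<bullet> \<theta> = 1"
      using r(1) by (simp add: \<theta>_def dot_square_norm power2_eq_square flip: r_def)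
    define T where "T = radial x \<theta> r"
    obtain z where z: "z 0 = x" "z T = y" "0 < T"
      "smooth_disc_curve T z (\<lambda>u. emb (z u)) (\<lambda>u. \<theta> /\<^sub>R lam \<epsilon> (z u))
        (\<lambda>u. - (2 * \<epsilon> * (z u \<bullet> \<theta>) / lam \<epsilon> (z u) ^ 3) *\<^sub>R \<theta>)"
      unfolding T_def by (rule segment_curve[OF x y \<theta> r(2,1)])
    interpret smooth_disc_curve T z "\<lambda>u. emb (z u)" "\<lambda>u. \<theta> /\<^sub>R lam \<epsilon> (z u)"
      "\<lambda>u. - (2 * \<epsilon> * (z u \<bullet> \<theta>) / lam \<epsilon> (z u) ^ 3) *\<^sub>R \<theta>" by (rule z(4))
    \<comment> \<open>The integrand of the action along the segment is 1/\<lambda>, which is the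
      derivative of the position z . \<theta> on the line.\<close>
    have "((\<lambda>t. 1 / lam \<epsilon> (z t)) has_integral (z T \<bullet> \<theta> - z 0 \<bullet> \<theta>)) {0..T}"
    proof (rule fundamental_theorem_of_calculus)
      show "0 \<le> T" using T by simp
      fix t assume "t \<in> {0..T}"
      from bounded_linear.has_vector_derivative[OF bounded_linear_inner_left z_deriv[OF this], of \<theta>]
      show "((\<lambda>t. z t \<bullet> \<theta>) has_vector_derivative 1 / lam \<epsilon> (z t)) (at t within {0..T})"
        using \<theta> by (simp add: inverse_eq_divide)
    qed
    moreover have "z T \<bullet> \<theta> - z 0 \<bullet> \<theta> = r" by (simp add: z r(2) inner_add_left \<theta>)
    ultimately have "integral {0..T} (\<lambda>t. 1 / lam \<epsilon> (z t)) = r" by (simp add: integral_unique)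
    moreover have "lam \<epsilon> (z t) * ((\<theta> /\<^sub>R lam \<epsilon> (z t)) \<bullet> (\<theta> /\<^sub>R lam \<epsilon> (z t))) / 2 + 1 / (2 * lam \<epsilon> (z t)) = 1 / lam \<epsilon> (z t)" for t
      using \<theta> lam_nonzero[of "z t"] by (simp add: field_simps)
    ultimately have act: "mp_action disc (met \<epsilon>) zform (pot \<epsilon>) (1/2) T (\<lambda>u. emb (z u)) = ereal r"
      unfolding smooth_curve_action(2)[OF z(4)] by simp
    have "mp_action disc (met \<epsilon>) zform (pot \<epsilon>) (1/2) T (\<lambda>u. emb (z u)) \<in> ?S"
      using smooth_curve_action(1)[OF z(4)] z(1,2,3) by blast
    then have "action_function disc (met \<epsilon>) zform (pot \<epsilon>) (1/2) (emb x) (emb y) \<le> ereal r"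
      unfolding action_function_def act[symmetric] by (rule Inf_lower)
    then show ?thesis by (simp add: r_def dist_norm norm_minus_commute)
  qed
qed

end

section \<open>Comparison of the parameters 0 and 1/2\<close>

theorem mainTheorem5:
  shows "\<exists>(M :: (nat \<Rightarrow> real) bmanifold) (k :: real) g \<alpha> U g' \<alpha>' U'.
    smooth_manifold_with_boundary M \<and> compact_space (mtop M) \<and> 2 \<le> mdim M \<and>
    mp_system M g \<alpha> U \<and> mp_system M g' \<alpha>' U' \<and>
    (SUP p\<in>points M. U p) < k \<and> (SUP p\<in>points M. U' p) < k \<and>
    mp_simple M g \<alpha> U k \<and> mp_simple M g' \<alpha>' U' k \<and>
    same_boundary_action M k g \<alpha> U g' \<alpha>' U' \<and>
    same_boundary_restriction M g \<alpha> U g' \<alpha>' U' \<and>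
    \<not> gauge_equivalent M g \<alpha> U g' \<alpha>' U'"
proof -
  interpret c0: conformal 0 by unfold_locales auto
  interpret c1: conformal "1/2" by unfold_locales auto
  have sup: "(SUP p\<in>points disc. pot \<epsilon> p) < 1/2" if "conformal \<epsilon>" for \<epsilon>
  proof -
    interpret conformal \<epsilon> by fact
    \<comment> \<open>\<lambda> \<le> 1 on the disc, so the potential is nonpositive, uniformly
      below the energy.\<close>
    have "(SUP p\<in>points disc. pot \<epsilon> p) \<le> 0"
    proof (rule cSUP_least)
      fix p assume "p \<in> points disc"
      then obtain z where z: "cmod z \<le> 1" "p = emb z" by auto
      have "\<epsilon> * (cmod z)\<^sup>2 \<le> \<epsilon> * 1"
        using z(1) eps by (intro mult_left_mono) (auto simp: power_le_one)
      then have "lam \<epsilon> z \<le> 1" by (simp add: lam_def)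
      then show "pot \<epsilon> p \<le> 0" using lam_pos[of z] by (simp add: z(2) pot_emb field_simps)
    qed simp
    then show ?thesis by linarith
  qed
  have "same_boundary_action disc (1/2) (met 0) zform (pot 0) (met (1/2)) zform (pot (1/2))"
    unfolding same_boundary_action_def mboundary_disc
    using c0.action_function_disc c1.action_function_disc by auto
  moreover have "same_boundary_restriction disc (met 0) zform (pot 0) (met (1/2)) zform (pot (1/2))"
    unfolding same_boundary_restriction_def mboundary_disc
    by (auto simp: met_def pot_def lam_boundary)
  moreover have "\<not> gauge_equivalent disc (met 0) zform (pot 0) (met (1/2)) zform (pot (1/2))"
  proof
    assume "gauge_equivalent disc (met 0) zform (pot 0) (met (1/2)) zform (pot (1/2))"
    \<comment> \<open>Only the clause for the potentials is used: at the centre one potential is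
      -1/2, while the other is 0 at every point, wherever \<open>f\<close> sends the centre.\<close>
    then obtain f where "\<forall>p\<in>points disc. pot (1/2) p = pot 0 (f p)"
      unfolding gauge_equivalent_def by blast
    moreover have "emb 0 \<in> points disc" by auto
    ultimately have "pot (1/2) (emb 0) = pot 0 (f (emb 0))" by blast
    then show False by (simp add: pot_def lam_def)
  qed
  moreover have "2 \<le> mdim disc" by simp
  ultimately show ?thesis
    using disc_smooth_manifold disc_compact c0.mp_system_disc c1.mp_system_disc
      c0.mp_simple_disc c1.mp_simple_disc sup[OF c0.conformal_axioms] sup[OF c1.conformal_axioms]
    by blast
qed

end
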